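(* Let $\Upsilon$ be a gain signed graph with signed graph $\Sigma=(\Gamma,\sigma)$. (I) If $\Upsilon$ is hyperbalanced, the coatoms and cocircuits of $M(\Upsilon)$ are those of $F(\Sigma)$. (II) If $\Upsilon$ is hyperfrustrated, $M(\Upsilon)$ has both hyperbalanced and hyperfrustrated coatoms, and: (A) For a hyperbalanced set $A\subseteq E$ the following are equivalent: (i) $A$ is a coatom; (ii) $A$ is a maximal hyperbalanced edge set; (iii) $A=\mathrm{clos}_\Upsilon(F)$ for a basis $F$ of $F(\Sigma)$; (iv) $A=\mathrm{bcl}_\Upsilon(F)$ for a basis $F$ of $F(\Sigma)$. The corresponding cocircuits (complements of these coatoms) are the minimal hyperbalancing sets. (B) The hyperfrustrated coatoms of $M(\Upsilon)$ are the coatoms of $F(\Sigma)$ that are hyperfrustrated. The corresponding cocircuits are the following sets $D$: (i) if $\Gamma{:}X$ is a component such that $\Upsilon\setminus X$ is hyperfrustrated (including the case that $\Upsilon\setminus X$ contains a non-neutral loose edge), any cocircuit of $F(\Sigma{:}X)$; (ii) if $\Gamma{:}X$ is a component such that $\Upsilon\setminus X$ is hyperbalanced: (a) if $\Sigma{:}X$ is sign balanced, a bond $D$ of $\Gamma{:}X$ such that $(\Upsilon{:}X)\setminus D$ is hyperfrustrated; (b) if $\Sigma{:}X$ is sign unbalanced, either a minimal deletion set $D$ of $\Sigma{:}X$ such that $(\Upsilon{:}X)\setminus D$ is hyperfrustrated, or a set $D$ of one of the types (D2)–(D4) below such that $(\Upsilon{:}X)\setminus D$ is hyperfrustrated. Here,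 for a sign-unbalanced component $\Sigma{:}X$: (D2) $D$ is a minimal deletion set of $\Sigma{:}X$; (D3) $D$ is a cut in $\Gamma{:}X$ such that one side is connected and sign balanced and the other side has no sign-balanced component; (D4) $D$ consists of a cut in $\Gamma{:}X$ such that both sides are sign unbalanced, one side is connected and sign unbalanced, and the other side has no sign-balanced component, together with a minimal deletion set of the first side.
   Context: Let $\mathbb{K}$ be a field of characteristic $\ne2$. A graph $\Gamma=(V,E)$ has vertex set $V=\{v_1,\dots,v_n\}$ and finite edge set $E$; edges are links (two ends at distinct vertices), loops (two ends at one vertex), half edges (one end) or loose edges (no ends); parallel edges allowed. A gain signed graph $\Upsilon=(\Gamma,\sigma,\varphi)$: $\sigma:E\to\{\pm1\}$ (half edges negative, loose edges positive); with an orientation $\tau$ (signs $\tau(v,e)\in\{\pm1\}$ on edge ends, $\tau(v,e)\tau(w,e)=-\sigma(e)$ for a link or loop with ends $v,w$) each edge has gain $\varphi(e)\in\mathbb{K}$, negated on reorientation. Neutral = gain $0$. Walk gain of $W=u_0e_1\cdots e_lu_l$: $\varphi(W)=-\sum_i\varphi(e_i)\sigma(W_{0,i-1})\tau(u_{i-1},e_i)$, $\sigma(W_{0,j})=\prod_{i\le j}\sigma(e_i)$. Ultrawalks may begin with a half edge $e_0$ at $u_0$ and/or end with a half edge $e_{l+1}$ at $u_l$; their gain adds $\tau(u_0,e_0)\varphi(e_0)$ and/or $-\varphi(e_{l+1})\sigma(W_{0,l})\tau(u_l,e_{l+1})$ to $\varphi(W_{0,l})$. Circles: connected 2-regular subgraphs,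 sign = product of edge signs; a negative figure is a negative circle or a half edge. A sign circuit is a positive circle, a loose edge, or a handcuff (two negative figures with exactly one common vertex, or two disjoint negative figures plus a path joining them meeting them only at its ends). Its gain: the edge gain for a loose edge; else $\varphi(W)$ for a circuit walk (once around a positive circle; for a handcuff with figures $C_1,C_2$, connecting path $P$ of length $\ge0$: around $C_1$, along $P$, around $C_2$, back along $P$ if both circles; from half edge $C_1$ along $P$, around $C_2$, back, ending with $C_1$ if $C_1$ half edge and $C_2$ circle; from one half edge along $P$ to the other if both half edges); well defined up to sign; neutral if $0$. An edge set (or subgraph, or $\Upsilon$ itself via $E$) is hyperbalanced if all sign circuits in it are neutral, hyperfrustrated otherwise; sign balanced if it has no negative circle and no half edge. Components of $S$: connected components of $(V,S)$ (loose edges excluded); $b_\Sigma(S)$ = number of sign-balanced components. $M(\Upsilon)$: matroid on $E$ with rank $n-b_\Sigma(S)+\delta(S)$ ($\delta=0$ if hyperbalanced, $1$ otherwise); $F(\Sigma)$: frame matroid on $E$ with rank $n-b_\Sigma(S)$. A coatom is a flat of rank one less than the whole; cocircuits are complements of coatoms. $\mathrm{clos}_\Upsilon$ = closure in $M(\Upsilon)$; $\mathrm{bcl}_\Upsilon(S)=S\cup\{e\notin S:\exists$ neutral sign circuit $C$ with $e\in C\subseteq S\cup\{e\}\}$. A hyperbalancing set is an edge set whose deletion leaves a hyperbalanced set. A component $\Gamma{:}X$ is a connected component of $\Gamma$ with vertex set $X$; $\Sigma{:}X$, $\Upsilon{:}X$ are its signed/gain-signed versions (edges with all endpoints in $X$),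 and $\Upsilon\setminus X$ is $\Upsilon$ with the edges of $\Gamma{:}X$ removed. A deletion set of a signed graph is an edge set whose complement is sign balanced. A cut is a nonempty set consisting of all edges between some vertex subset $Y$ and its complement (within the component); its sides are the subgraphs induced on $Y$ and on its complement; a bond is a minimal cut.
   Formalization: In (II), hyperfrustrated coatoms need not exist (e.g. a single non-neutral positive loop); the formal statement says that hyperbalanced coatoms always exist and hyperfrustrated ones exist iff some non-neutral sign circuit has rank in F(Σ) below that of E. *)

theory Defs
  imports Main
begin

section \<open>Matroids given by a rank function\<close>

record 'e matroid =
  ground :: "'e set"
  rk :: "'e set \<Rightarrow> nat"

definition minimal_set :: "('a set \<Rightarrow> bool) \<Rightarrow> 'a set \<Rightarrow> bool" where
  "minimal_set P A \<longleftrightarrow> P A \<and> (\<forall>B. B \<subset> A \<longrightarrow> \<not> P B)"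

definition maximal_set :: "('a set \<Rightarrow> bool) \<Rightarrow> 'a set \<Rightarrow> bool" where
  "maximal_set P A \<longleftrightarrow> P A \<and> (\<forall>B. A \<subset> B \<longrightarrow> \<not> P B)"

definition indep :: "'e matroid \<Rightarrow> 'e set \<Rightarrow> bool" where
  "indep M S \<longleftrightarrow> S \<subseteq> ground M \<and> rk M S = card S"

definition basis :: "'e matroid \<Rightarrow> 'e set \<Rightarrow> bool" where
  "basis M B \<longleftrightarrow> maximal_set (indep M) B"

definition clos :: "'e matroid \<Rightarrow> 'e set \<Rightarrow> 'e set" where
  "clos M S = {e \<in> ground M. rk M (insert e S) = rk M S}"

definition flat :: "'e matroid \<Rightarrow> 'e set \<Rightarrow> bool" where
  "flat M A \<longleftrightarrow> A \<subseteq> ground M \<and> clos M A = A"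

definition coatom :: "'e matroid \<Rightarrow> 'e set \<Rightarrow> bool" where
  "coatom M A \<longleftrightarrow> flat M A \<and> rk M A + 1 = rk M (ground M)"

definition cocircuit :: "'e matroid \<Rightarrow> 'e set \<Rightarrow> bool" where
  "cocircuit M D \<longleftrightarrow> (\<exists>A. coatom M A \<and> D = ground M - A)"

section \<open>Graphs, signed graphs, gain signed graphs\<close>

text \<open>
  \<open>ends G e\<close> lists the vertices at the ends of \<open>e\<close>: no entry for a loose edge, one for a
  half edge, two distinct ones for a link, the same vertex twice for a loop. The position in this
  list serves as the name of an end, so that the two ends of a loop can carry their own orientation
  signs: \<open>end_sign G e i\<close> is the sign \<open>\<tau>(v,e)\<close> of the end number \<open>i\<close>, at the vertex
  \<open>v = ends G e ! i\<close>.
\<close>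

record ('v, 'e) graph =
  verts :: "'v set"
  edges :: "'e set"
  ends :: "'e \<Rightarrow> 'v list"

record ('v, 'e) signed_graph = "('v, 'e) graph" +
  esign :: "'e \<Rightarrow> int"

record ('v, 'e, 'k) gain_signed_graph = "('v, 'e) signed_graph" +
  end_sign :: "'e \<Rightarrow> nat \<Rightarrow> int"
  gain :: "'e \<Rightarrow> 'k"

definition loose_edge :: "('v, 'e, 'z) graph_scheme \<Rightarrow> 'e \<Rightarrow> bool" where
  "loose_edge G e \<longleftrightarrow> ends G e = []"

definition half_edge :: "('v, 'e, 'z) graph_scheme \<Rightarrow> 'e \<Rightarrow> bool" where
  "half_edge G e \<longleftrightarrow> length (ends G e) = 1"

definition ordinary_edge :: "('v, 'e, 'z) graph_scheme \<Rightarrow> 'e \<Rightarrow> bool" where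
  "ordinary_edge G e \<longleftrightarrow> length (ends G e) = 2"

definition is_graph :: "('v, 'e, 'z) graph_scheme \<Rightarrow> bool" where
  "is_graph G \<longleftrightarrow> finite (verts G) \<and> finite (edges G) \<and>
     (\<forall>e\<in>edges G. length (ends G e) \<le> 2 \<and> set (ends G e) \<subseteq> verts G)"

definition is_signed_graph :: "('v, 'e, 'z) signed_graph_scheme \<Rightarrow> bool" where
  "is_signed_graph G \<longleftrightarrow> is_graph G \<and>
     (\<forall>e\<in>edges G. esign G e \<in> {1, -1} \<and>
        (half_edge G e \<longrightarrow> esign G e = -1) \<and> (loose_edge G e \<longrightarrow> esign G e = 1))"

definition is_gain_signed_graph :: "('v, 'e, 'k) gain_signed_graph \<Rightarrow> bool" where
  "is_gain_signed_graph G \<longleftrightarrow> is_signed_graph G \<and>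
     (\<forall>e\<in>edges G. (\<forall>i < length (ends G e). end_sign G e i \<in> {1, -1}) \<and>
        (ordinary_edge G e \<longrightarrow> end_sign G e 0 * end_sign G e 1 = - esign G e))"

definition delete_edges :: "('v, 'e, 'z) graph_scheme \<Rightarrow> 'e set \<Rightarrow> ('v, 'e, 'z) graph_scheme" where
  "delete_edges G D = G\<lparr>edges := edges G - D\<rparr>"

text \<open>Loose edges belong to no induced subgraph.\<close>

definition induced :: "('v, 'e, 'z) graph_scheme \<Rightarrow> 'v set \<Rightarrow> ('v, 'e, 'z) graph_scheme" where
  "induced G X = G\<lparr>verts := X, edges := {e \<in> edges G. ends G e \<noteq> [] \<and> set (ends G e) \<subseteq> X}\<rparr>"

definition cover :: "('v, 'e, 'z) graph_scheme \<Rightarrow> 'e set \<Rightarrow> 'v set" where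
  "cover G S = (\<Union>e\<in>S. set (ends G e))"

definition linked :: "('v, 'e, 'z) graph_scheme \<Rightarrow> 'e set \<Rightarrow> ('v \<times> 'v) set" where
  "linked G S = {(u, w). \<exists>e\<in>S. ends G e = [u, w] \<or> ends G e = [w, u]}\<^sup>*"

definition components :: "('v, 'e, 'z) graph_scheme \<Rightarrow> 'e set \<Rightarrow> 'v set set" where
  "components G S = verts G // (linked G S \<inter> verts G \<times> verts G)"

definition connected_graph :: "('v, 'e, 'z) graph_scheme \<Rightarrow> bool" where
  "connected_graph G \<longleftrightarrow> (\<exists>X. components G (edges G) = {X})"

definition circle :: "('v, 'e, 'z) graph_scheme \<Rightarrow> 'e set \<Rightarrow> bool" where
  "circle G C \<longleftrightarrow> C \<noteq> {} \<and> C \<subseteq> edges G \<and> (\<forall>e\<in>C. ordinary_edge G e) \<and>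
     (\<forall>v\<in>cover G C. (\<Sum>e\<in>C. count_list (ends G e) v) = 2) \<and>
     (\<forall>u\<in>cover G C. \<forall>w\<in>cover G C. (u, w) \<in> linked G C)"

definition positive_circle :: "('v, 'e, 'z) signed_graph_scheme \<Rightarrow> 'e set \<Rightarrow> bool" where
  "positive_circle G C \<longleftrightarrow> circle G C \<and> (\<Prod>e\<in>C. esign G e) = 1"

definition negative_circle :: "('v, 'e, 'z) signed_graph_scheme \<Rightarrow> 'e set \<Rightarrow> bool" where
  "negative_circle G C \<longleftrightarrow> circle G C \<and> (\<Prod>e\<in>C. esign G e) = -1"

definition negative_figure :: "('v, 'e, 'z) signed_graph_scheme \<Rightarrow> 'e set \<Rightarrow> bool" where
  "negative_figure G C \<longleftrightarrow> negative_circle G C \<or> (\<exists>h\<in>edges G. half_edge G h \<and> C = {h})"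

definition sign_balanced :: "('v, 'e, 'z) signed_graph_scheme \<Rightarrow> 'e set \<Rightarrow> bool" where
  "sign_balanced G S \<longleftrightarrow> \<not> (\<exists>C\<subseteq>S. negative_circle G C) \<and> \<not> (\<exists>h\<in>S. half_edge G h)"

definition balanced_components :: "('v, 'e, 'z) signed_graph_scheme \<Rightarrow> 'e set \<Rightarrow> 'v set set" where
  "balanced_components G S =
     {X \<in> components G S. sign_balanced G (S \<inter> edges (induced G X))}"

definition frame_matroid :: "('v, 'e, 'z) signed_graph_scheme \<Rightarrow> 'e matroid" where
  "frame_matroid G =
     \<lparr>ground = edges G, rk = (\<lambda>S. card (verts G) - card (balanced_components G S))\<rparr>"

section \<open>Walks and their gains\<close>

text \<open>
  A walk is given by its initial vertex and a list of steps; the step \<open>(e, i)\<close> traverses the link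
  or loop \<open>e\<close> starting from its end number \<open>i\<close>.
\<close>

fun walk :: "('v, 'e, 'z) graph_scheme \<Rightarrow> 'v \<Rightarrow> ('e \<times> nat) list \<Rightarrow> 'v \<Rightarrow> bool" where
  "walk G u [] w \<longleftrightarrow> u = w"
| "walk G u ((e, i) # p) w \<longleftrightarrow> e \<in> edges G \<and> ordinary_edge G e \<and> i < 2 \<and>
     ends G e ! i = u \<and> walk G (ends G e ! (1 - i)) p w"

definition walk_verts :: "('v, 'e, 'z) graph_scheme \<Rightarrow> 'v \<Rightarrow> ('e \<times> nat) list \<Rightarrow> 'v list" where
  "walk_verts G u p = u # map (\<lambda>(e, i). ends G e ! (1 - i)) p"

definition walk_edges :: "('e \<times> nat) list \<Rightarrow> 'e set" where
  "walk_edges p = fst ` set p"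

definition reverse_walk :: "('e \<times> nat) list \<Rightarrow> ('e \<times> nat) list" where
  "reverse_walk p = rev (map (\<lambda>(e, i). (e, 1 - i)) p)"

definition walk_sign :: "('v, 'e, 'z) signed_graph_scheme \<Rightarrow> ('e \<times> nat) list \<Rightarrow> int" where
  "walk_sign G p = prod_list (map (\<lambda>(e, i). esign G e) p)"

definition walk_gain :: "('v, 'e, 'k::field) gain_signed_graph \<Rightarrow> ('e \<times> nat) list \<Rightarrow> 'k" where
  "walk_gain G p = - (\<Sum>j<length p. case p ! j of (e, i) \<Rightarrow>
     gain G e * of_int (walk_sign G (take j p)) * of_int (end_sign G e i))"

text \<open>The contributions of an initial half edge, and of a final half edge after the walk \<open>p\<close>.\<close>

definition initial_gain :: "('v, 'e, 'k::field) gain_signed_graph \<Rightarrow> 'e \<Rightarrow> 'k" where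
  "initial_gain G h = of_int (end_sign G h 0) * gain G h"

definition final_gain :: "('v, 'e, 'k::field) gain_signed_graph \<Rightarrow> ('e \<times> nat) list \<Rightarrow> 'e \<Rightarrow> 'k" where
  "final_gain G p h = - (gain G h * of_int (walk_sign G p) * of_int (end_sign G h 0))"

section \<open>Sign circuits and neutrality\<close>

text \<open>
  The path \<open>p\<close> from \<open>u\<close> to \<open>w\<close> connects the figures \<open>C1\<close>, \<open>C2\<close> of a handcuff. If it has length
  \<open>0\<close>, the figures have exactly the vertex \<open>u = w\<close> in common; otherwise they are disjoint.
\<close>

definition connecting_path ::
  "('v, 'e, 'z) graph_scheme \<Rightarrow> 'e set \<Rightarrow> 'e set \<Rightarrow> 'v \<Rightarrow> ('e \<times> nat) list \<Rightarrow> 'v \<Rightarrow> bool" where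
  "connecting_path G C1 C2 u p w \<longleftrightarrow> walk G u p w \<and> distinct (walk_verts G u p) \<and>
     cover G C1 \<inter> set (walk_verts G u p) = {u} \<and> cover G C2 \<inter> set (walk_verts G u p) = {w} \<and>
     cover G C1 \<inter> cover G C2 = (if p = [] then {u} else {})"

definition handcuff :: "('v, 'e, 'z) signed_graph_scheme \<Rightarrow> 'e set \<Rightarrow> bool" where
  "handcuff G C \<longleftrightarrow> (\<exists>C1 C2 u p w. negative_figure G C1 \<and> negative_figure G C2 \<and> C1 \<noteq> C2 \<and>
     connecting_path G C1 C2 u p w \<and> C = C1 \<union> walk_edges p \<union> C2)"

definition sign_circuit :: "('v, 'e, 'z) signed_graph_scheme \<Rightarrow> 'e set \<Rightarrow> bool" where
  "sign_circuit G C \<longleftrightarrow>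
     positive_circle G C \<or> (\<exists>e\<in>edges G. loose_edge G e \<and> C = {e}) \<or> handcuff G C"

definition once_around ::
  "('v, 'e, 'z) graph_scheme \<Rightarrow> 'e set \<Rightarrow> 'v \<Rightarrow> ('e \<times> nat) list \<Rightarrow> bool" where
  "once_around G C u p \<longleftrightarrow> walk G u p u \<and> distinct (map fst p) \<and> walk_edges p = C"

text \<open>
  \<open>circuit_gain G C g\<close>: the value \<open>g\<close> is the gain of some circuit walk of the sign circuit \<open>C\<close>.
  It is determined by \<open>C\<close> only up to sign, so neutrality does not depend on the circuit walk.
\<close>

inductive circuit_gain :: "('v, 'e, 'k::field) gain_signed_graph \<Rightarrow> 'e set \<Rightarrow> 'k \<Rightarrow> bool"
  for G where
  loose: "\<lbrakk>e \<in> edges G; loose_edge G e\<rbrakk> \<Longrightarrow> circuit_gain G {e} (gain G e)"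
| circle: "\<lbrakk>positive_circle G C; once_around G C u p\<rbrakk> \<Longrightarrow> circuit_gain G C (walk_gain G p)"
| circle_circle:
    "\<lbrakk>negative_circle G C1; negative_circle G C2; C1 \<noteq> C2; connecting_path G C1 C2 u p w;
      once_around G C1 u p1; once_around G C2 w p2\<rbrakk> \<Longrightarrow>
     circuit_gain G (C1 \<union> walk_edges p \<union> C2) (walk_gain G (p1 @ p @ p2 @ reverse_walk p))"
| half_circle:
    "\<lbrakk>h \<in> edges G; half_edge G h; negative_circle G C2; connecting_path G {h} C2 u p w;
      once_around G C2 w p2; q = p @ p2 @ reverse_walk p\<rbrakk> \<Longrightarrow>
     circuit_gain G ({h} \<union> walk_edges p \<union> C2)
       (initial_gain G h + walk_gain G q + final_gain G q h)"
| half_half: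
    "\<lbrakk>h1 \<in> edges G; half_edge G h1; h2 \<in> edges G; half_edge G h2; h1 \<noteq> h2;
      connecting_path G {h1} {h2} u p w\<rbrakk> \<Longrightarrow>
     circuit_gain G ({h1} \<union> walk_edges p \<union> {h2})
       (initial_gain G h1 + walk_gain G p + final_gain G p h2)"

definition neutral :: "('v, 'e, 'k::field) gain_signed_graph \<Rightarrow> 'e set \<Rightarrow> bool" where
  "neutral G C \<longleftrightarrow> (\<forall>g. circuit_gain G C g \<longrightarrow> g = 0)"

definition hyperbalanced :: "('v, 'e, 'k::field) gain_signed_graph \<Rightarrow> 'e set \<Rightarrow> bool" where
  "hyperbalanced G S \<longleftrightarrow> (\<forall>C. sign_circuit G C \<and> C \<subseteq> S \<longrightarrow> neutral G C)"

abbreviation hyperfrustrated :: "('v, 'e, 'k::field) gain_signed_graph \<Rightarrow> 'e set \<Rightarrow> bool" where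
  "hyperfrustrated G S \<equiv> \<not> hyperbalanced G S"

abbreviation hyperbalanced_graph :: "('v, 'e, 'k::field) gain_signed_graph \<Rightarrow> bool" where
  "hyperbalanced_graph G \<equiv> hyperbalanced G (edges G)"

abbreviation hyperfrustrated_graph :: "('v, 'e, 'k::field) gain_signed_graph \<Rightarrow> bool" where
  "hyperfrustrated_graph G \<equiv> \<not> hyperbalanced_graph G"

definition gain_matroid :: "('v, 'e, 'k::field) gain_signed_graph \<Rightarrow> 'e matroid" where
  "gain_matroid G =
     \<lparr>ground = edges G,
      rk = (\<lambda>S. card (verts G) - card (balanced_components G S) +
                (if hyperbalanced G S then 0 else 1))\<rparr>"

definition bcl :: "('v, 'e, 'k::field) gain_signed_graph \<Rightarrow> 'e set \<Rightarrow> 'e set" where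
  "bcl G S = S \<union>
     {e \<in> edges G - S. \<exists>C. sign_circuit G C \<and> neutral G C \<and> e \<in> C \<and> C \<subseteq> insert e S}"

definition hyperbalancing_set :: "('v, 'e, 'k::field) gain_signed_graph \<Rightarrow> 'e set \<Rightarrow> bool" where
  "hyperbalancing_set G D \<longleftrightarrow> D \<subseteq> edges G \<and> hyperbalanced G (edges G - D)"

section \<open>Deletion sets, cuts and bonds\<close>

definition delete_component ::
  "('v, 'e, 'z) graph_scheme \<Rightarrow> 'v set \<Rightarrow> ('v, 'e, 'z) graph_scheme" where
  "delete_component G X = delete_edges G (edges (induced G X))"

definition deletion_set :: "('v, 'e, 'z) signed_graph_scheme \<Rightarrow> 'e set \<Rightarrow> bool" where
  "deletion_set G D \<longleftrightarrow> D \<subseteq> edges G \<and> sign_balanced G (edges G - D)"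

definition between :: "('v, 'e, 'z) graph_scheme \<Rightarrow> 'v set \<Rightarrow> 'e set" where
  "between G Y =
     {e \<in> edges G. set (ends G e) \<inter> Y \<noteq> {} \<and> set (ends G e) \<inter> (verts G - Y) \<noteq> {}}"

definition cut :: "('v, 'e, 'z) graph_scheme \<Rightarrow> 'e set \<Rightarrow> bool" where
  "cut G D \<longleftrightarrow> D \<noteq> {} \<and> (\<exists>Y\<subseteq>verts G. D = between G Y)"

definition bond :: "('v, 'e, 'z) graph_scheme \<Rightarrow> 'e set \<Rightarrow> bool" where
  "bond G D \<longleftrightarrow> minimal_set (cut G) D"

text \<open>
  In the following types of edge sets, \<open>G\<close> is meant to be a sign-unbalanced component
  \<open>\<Sigma>:X\<close>; the sides of the cut are induced by \<open>Y\<close> and \<open>verts G - Y\<close>.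
\<close>

definition type_D2 :: "('v, 'e, 'z) signed_graph_scheme \<Rightarrow> 'e set \<Rightarrow> bool" where
  "type_D2 G D \<longleftrightarrow> minimal_set (deletion_set G) D"

definition type_D3 :: "('v, 'e, 'z) signed_graph_scheme \<Rightarrow> 'e set \<Rightarrow> bool" where
  "type_D3 G D \<longleftrightarrow> (\<exists>Y\<subseteq>verts G. \<exists>G1 G2. G1 = induced G Y \<and> G2 = induced G (verts G - Y) \<and>
     between G Y \<noteq> {} \<and> D = between G Y \<and>
     connected_graph G1 \<and> sign_balanced G1 (edges G1) \<and>
     balanced_components G2 (edges G2) = {})"

definition type_D4 :: "('v, 'e, 'z) signed_graph_scheme \<Rightarrow> 'e set \<Rightarrow> bool" where
  "type_D4 G D \<longleftrightarrow> (\<exists>Y\<subseteq>verts G. \<exists>G1 G2 D1. G1 = induced G Y \<and> G2 = induced G (verts G - Y) \<and>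
     between G Y \<noteq> {} \<and>
     \<not> sign_balanced G1 (edges G1) \<and> \<not> sign_balanced G2 (edges G2) \<and>
     connected_graph G1 \<and> balanced_components G2 (edges G2) = {} \<and>
     minimal_set (deletion_set G1) D1 \<and> D = between G Y \<union> D1)"

end

theory Submission
  imports Defs "HOL-Library.Function_Algebras" "HOL.Vector_Spaces"
begin

text \<open>
  Attach to an edge \<open>e\<close> the linear form \<open>inc e\<close> on \<open>K\<close>-valued vertex functions that adds up the values
  at the ends of \<open>e\<close>, weighted by the end signs. The vertex functions annihilated by an edge set \<open>S\<close>
  form a space whose dimension is the number of sign-balanced components of \<open>S\<close>, so the frame matroid
  is the matroid of these forms; characteristic \<open>\<noteq> 2\<close> makes the form of a negative loop nonzero.
  Sign circuits are the minimal linear dependencies, and the gain of a circuit is the corresponding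
  combination of the edge gains. Hence \<open>S\<close> is hyperbalanced iff it has a potential \<open>\<theta>\<close>, that is,
  \<open>gain e = inc \<theta> e\<close> on \<open>S\<close>. Potentials of a spanning set of the frame matroid agree on all
  edges, which gives the hyperbalanced coatoms. Above a hyperfrustrated set the two ranks differ by the constant \<open>1\<close>,
  so the hyperfrustrated coatoms come from the frame matroid, whose cocircuits are the minimal edge
  sets whose removal enlarges the annihilator; these are found component by component.
\<close>

section \<open>Walks, paths and trails\<close>

text \<open>The step that is not linear algebra is to find a combinatorial sign circuit inside an
  arbitrary dependency; a longest path, whose extra end edges must return to it, avoids any analysis
  of how the edge set is connected. In the other direction a sign circuit must yield a relation in
  which every edge has a nonzero coefficient. A handcuff with a negative circle runs through its
  connecting path twice with equal signs, so the path edges get coefficients 2 or -2, and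
  characteristic \<noteq> 2 enters there as well. Neutrality quantifies over all circuit walks: a
  potential kills every one of them, but using neutrality requires that some circuit walk exists,
  whence the traversal of circles by trails. Equality of ranks of nested sets is read as equality of
  their annihilators, which turns closures, bases and coatoms into statements about potentials.
  Whether hyperfrustrated coatoms exist depends on the graph; the exact condition is a non-neutral
  sign circuit of less than full frame rank.\<close>

lemma walk_verts_simps [simp]:
  "walk_verts G u [] = [u]"
  "walk_verts G u ((e, i) # p) = u # walk_verts G (ends G e ! (1 - i)) p"
  by (simp_all add: walk_verts_def)

lemma walk_verts_nonempty [simp]: "walk_verts G u p \<noteq> []"
  by (simp add: walk_verts_def)

lemma start_in_walk_verts [simp]: "u \<in> set (walk_verts G u p)"
  by (simp add: walk_verts_def)

lemma walk_edges_simps [simp]: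
  "walk_edges [] = {}"
  "walk_edges ((e, i) # p) = insert e (walk_edges p)"
  "walk_edges (p @ q) = walk_edges p \<union> walk_edges q"
  by (auto simp: walk_edges_def)

lemma reverse_walk_simps [simp]:
  "reverse_walk [] = []"
  "reverse_walk ((e, i) # p) = reverse_walk p @ [(e, 1 - i)]"
  "reverse_walk (p @ q) = reverse_walk q @ reverse_walk p"
  "reverse_walk p = [] \<longleftrightarrow> p = []"
  "length (reverse_walk p) = length p"
  by (auto simp: reverse_walk_def)

lemma walk_edges_reverse [simp]: "walk_edges (reverse_walk p) = walk_edges p"
  by (induction p) auto

lemma walk_sign_simps [simp]:
  "walk_sign G [] = 1"
  "walk_sign G ((e, i) # p) = esign G e * walk_sign G p"
  "walk_sign G (p @ q) = walk_sign G p * walk_sign G q"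
  by (auto simp: walk_sign_def)

lemma walk_sign_reverse [simp]: "walk_sign G (reverse_walk p) = walk_sign G p"
  by (induction p) auto

lemma ends_ordinary: "ordinary_edge G e \<Longrightarrow> ends G e = [ends G e ! 0, ends G e ! 1]"
  unfolding ordinary_edge_def by (cases "ends G e"; cases "tl (ends G e)") auto

lemma set_ends_step:
  assumes "ordinary_edge G e" "i < 2"
  shows "set (ends G e) = {ends G e ! i, ends G e ! (1 - i)}"
proof -
  obtain x y where "ends G e = [x, y]" using ends_ordinary[OF assms(1)] by blast
  moreover have "i = 0 \<or> i = 1" using assms by auto
  ultimately show ?thesis by auto
qed

lemma count_ends_step:
  assumes "ordinary_edge G e" "i < 2"
  shows "count_list (ends G e) v = of_bool (v = ends G e ! i) + of_bool (v = ends G e ! (1 - i))"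
proof -
  obtain x y where "ends G e = [x, y]" using ends_ordinary[OF assms(1)] by blast
  moreover have "i = 0 \<or> i = 1" using assms by auto
  ultimately show ?thesis by auto
qed

lemma walk_induct [consumes 1, case_names Nil Cons]:
  assumes "walk G u p w" and "P w []"
    and "\<And>u e i p. e \<in> edges G \<Longrightarrow> ordinary_edge G e \<Longrightarrow> i < 2 \<Longrightarrow> ends G e ! i = u \<Longrightarrow>
      walk G (ends G e ! (1 - i)) p w \<Longrightarrow> P (ends G e ! (1 - i)) p \<Longrightarrow> P u ((e, i) # p)"
  shows "P u p"
  using assms(1)
proof (induction p arbitrary: u)
  case Nil
  then show ?case using assms(2) by simp
next
  case (Cons a p)
  then show ?case by (cases a) (auto intro: assms(3))
qed

lemma walk_append: "walk G u (p @ q) w \<longleftrightarrow> (\<exists>v. walk G u p v \<and> walk G v q w)"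
  by (induction p arbitrary: u) auto

lemma walk_snoc:
  "walk G u (p @ [(e, i)]) w \<longleftrightarrow>
     walk G u p (ends G e ! i) \<and> e \<in> edges G \<and> ordinary_edge G e \<and> i < 2 \<and> w = ends G e ! (1 - i)"
  by (auto simp: walk_append)

lemma last_walk_verts: "walk G u p w \<Longrightarrow> last (walk_verts G u p) = w"
  by (induction p arbitrary: u) auto

lemma end_in_walk_verts: "walk G u p w \<Longrightarrow> w \<in> set (walk_verts G u p)"
  using last_walk_verts last_in_set walk_verts_nonempty by metis

lemma walk_verts_append:
  "walk G u p v \<Longrightarrow> walk_verts G u (p @ q) = walk_verts G u p @ tl (walk_verts G v q)"
  by (induction p arbitrary: u) (auto simp: walk_verts_def)

lemma walk_reverse: "walk G u p w \<Longrightarrow> walk G w (reverse_walk p) u"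
  by (induction p arbitrary: u) (auto simp: walk_append)

lemma walk_verts_reverse:
  "walk G u p w \<Longrightarrow> walk_verts G w (reverse_walk p) = rev (walk_verts G u p)"
proof (induction rule: walk_induct)
  case Nil
  then show ?case by simp
next
  case (Cons u e i p)
  note w = Cons.hyps(5) and i = Cons.hyps(3,4)
  have "1 - (1 - i) = i" using i by auto
  then show ?case using Cons.IH walk_reverse[OF w] i
    by (simp add: walk_verts_append)
qed

lemma walk_edges_ordinary:
  "walk G u p w \<Longrightarrow> e \<in> walk_edges p \<Longrightarrow> e \<in> edges G \<and> ordinary_edge G e"
  by (induction p arbitrary: u) auto

lemma ends_subset_walk_verts:
  "walk G u p w \<Longrightarrow> e \<in> walk_edges p \<Longrightarrow> set (ends G e) \<subseteq> set (walk_verts G u p)"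
proof (induction rule: walk_induct)
  case Nil
  then show ?case by simp
next
  case (Cons u f i p)
  note w = Cons.hyps(5) and i = Cons.hyps(3,4,2)
  show ?case
    using Cons.IH Cons.prems(1) set_ends_step[OF i(3,1)] i(2) start_in_walk_verts[of "ends G f ! (1 - i)" G p]
    by auto
qed

lemma walk_verts_subset_cover:
  "walk G u p w \<Longrightarrow> p \<noteq> [] \<Longrightarrow> set (walk_verts G u p) \<subseteq> cover G (walk_edges p)"
proof (induction rule: walk_induct)
  case Nil
  then show ?case by simp
next
  case (Cons u f i p)
  note w = Cons.hyps(5) and i = Cons.hyps(3,4,2)
  have *: "{u, ends G f ! (1 - i)} \<subseteq> cover G {f}"
    using set_ends_step[OF i(3,1)] i(2) by (auto simp: cover_def)
  show ?case
  proof (cases "p = []")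
    case True
    then show ?thesis using * by (auto simp: cover_def)
  next
    case False
    then show ?thesis using Cons.IH[OF False] * by (auto simp: cover_def)
  qed
qed

lemma cover_walk_edges:
  assumes "walk G u p w" "p \<noteq> []"
  shows "cover G (walk_edges p) = set (walk_verts G u p)"
  using walk_verts_subset_cover[OF assms] ends_subset_walk_verts[OF assms(1)]
  by (auto simp: cover_def)

lemma path_distinct_edges:
  "walk G u p w \<Longrightarrow> distinct (walk_verts G u p) \<Longrightarrow> distinct (map fst p)"
proof (induction rule: walk_induct)
  case Nil
  then show ?case by simp
next
  case (Cons u e i p)
  note w = Cons.hyps(5) and i = Cons.hyps(3,4,2)
  have "e \<notin> walk_edges p"
    using ends_subset_walk_verts[OF w] set_ends_step[OF i(3,1)] i(2) Cons.prems(1) by auto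
  then show ?case using Cons.IH Cons.prems(1) by (auto simp: walk_edges_def)
qed

lemma path_no_loops:
  "walk G u p w \<Longrightarrow> distinct (walk_verts G u p) \<Longrightarrow> e \<in> walk_edges p \<Longrightarrow> ends G e ! 0 \<noteq> ends G e ! 1"
proof (induction rule: walk_induct)
  case Nil
  then show ?case by simp
next
  case (Cons u f i p)
  note w = Cons.hyps(5) and i = Cons.hyps(3,4,2)
  have "ends G f ! i \<noteq> ends G f ! (1 - i)" using Cons.prems(1) i(2) by auto
  moreover have "i = 0 \<or> i = 1" using i by auto
  ultimately have "ends G f ! 0 \<noteq> ends G f ! 1" by auto
  then show ?case using Cons.IH Cons.prems by auto
qed

text \<open>Along a trail an inner visit of \<open>v\<close> uses two edge ends, the visits at the start and at the end only one.\<close>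

lemma trail_degree:
  "walk G u p w \<Longrightarrow> distinct (map fst p) \<Longrightarrow>
   (\<Sum>e\<in>walk_edges p. count_list (ends G e) v) + of_bool (v = u) + of_bool (v = w)
     = 2 * count_list (walk_verts G u p) v"
proof (induction rule: walk_induct)
  case Nil
  then show ?case by auto
next
  case (Cons u e i p)
  note w = Cons.hyps(5) and i = Cons.hyps(3,4,2)
  have "e \<notin> walk_edges p" using Cons.prems(1) by (auto simp: walk_edges_def)
  moreover have "finite (walk_edges p)" by (simp add: walk_edges_def)
  moreover have "distinct (map fst p)" using Cons.prems(1) by simp
  ultimately show ?case using Cons.IH count_ends_step[OF i(3,1), of v] i(2)
    by auto
qed

lemma finite_walk_edges [simp]: "finite (walk_edges p)"
  by (simp add: walk_edges_def)

section \<open>Connectivity expressed by walks and paths\<close>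

lemma linked_mono: "S \<subseteq> T \<Longrightarrow> linked G S \<subseteq> linked G T"
  unfolding linked_def by (intro rtrancl_mono) auto

lemma linked_refl [simp]: "(u, u) \<in> linked G S"
  by (simp add: linked_def)

lemma linked_trans: "(u, v) \<in> linked G S \<Longrightarrow> (v, w) \<in> linked G S \<Longrightarrow> (u, w) \<in> linked G S"
  by (simp add: linked_def)

lemma linked_sym: "(u, w) \<in> linked G S \<Longrightarrow> (w, u) \<in> linked G S"
proof -
  have "sym {(u, w). \<exists>e\<in>S. ends G e = [u, w] \<or> ends G e = [w, u]}" by (auto simp: sym_def)
  then show "(u, w) \<in> linked G S \<Longrightarrow> (w, u) \<in> linked G S"
    unfolding linked_def by (rule symD[OF sym_rtrancl])
qed

lemma linked_edge: "e \<in> S \<Longrightarrow> x \<in> set (ends G e) \<Longrightarrow> y \<in> set (ends G e) \<Longrightarrow> length (ends G e) \<le> 2 \<Longrightarrow> (x, y) \<in> linked G S"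
proof -
  assume e: "e \<in> S" "x \<in> set (ends G e)" "y \<in> set (ends G e)" "length (ends G e) \<le> 2"
  have "x = y \<or> ends G e = [x, y] \<or> ends G e = [y, x]"
    using e(2-4) by (cases "ends G e"; cases "tl (ends G e)") auto
  then show ?thesis
  proof
    assume "ends G e = [x, y] \<or> ends G e = [y, x]"
    then have "(x, y) \<in> {(u, w). \<exists>e\<in>S. ends G e = [u, w] \<or> ends G e = [w, u]}" using e(1) by blast
    then show ?thesis unfolding linked_def by (rule r_into_rtrancl)
  qed simp
qed

lemma linked_invariant:
  assumes "(u, w) \<in> linked G S" "u \<in> Y"
    and "\<And>e x y. e \<in> S \<Longrightarrow> set (ends G e) = {x, y} \<Longrightarrow> x \<in> Y \<Longrightarrow> y \<in> Y"
  shows "w \<in> Y"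
  using assms(1) unfolding linked_def
proof (induction rule: rtrancl_induct)
  case base
  then show ?case using assms by simp
next
  case (step y z)
  then obtain e where "e \<in> S" "ends G e = [y, z] \<or> ends G e = [z, y]" by auto
  then have "set (ends G e) = {y, z}" by auto
  then show ?case using assms(3)[of e y z] step.IH \<open>e \<in> S\<close> by blast
qed

lemma walk_linked: "walk G u p w \<Longrightarrow> walk_edges p \<subseteq> S \<Longrightarrow> (u, w) \<in> linked G S"
proof (induction rule: walk_induct)
  case Nil
  then show ?case by simp
next
  case (Cons u e i p)
  note w = Cons.hyps(5) and i = Cons.hyps(3,4,2)
  have "(u, ends G e ! (1 - i)) \<in> linked G S"
    using linked_edge[of e S u G "ends G e ! (1 - i)"] set_ends_step[OF i(3,1)] i Cons.prems(1)
    by (auto simp: ordinary_edge_def)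
  moreover have "(ends G e ! (1 - i), w) \<in> linked G S"
    using Cons.IH Cons.prems(1) by simp
  ultimately show ?case by (rule linked_trans)
qed

lemma linked_walk:
  assumes "(u, w) \<in> linked G S" "S \<subseteq> edges G"
  shows "\<exists>p. walk G u p w \<and> walk_edges p \<subseteq> S"
  using assms(1) unfolding linked_def
proof (induction rule: rtrancl_induct)
  case base
  have "walk G u [] u \<and> walk_edges [] \<subseteq> S" by simp
  then show ?case by blast
next
  case (step y z)
  then obtain e p where e: "e \<in> S" "ends G e = [y, z] \<or> ends G e = [z, y]"
    and p: "walk G u p y" "walk_edges p \<subseteq> S" by auto
  have "\<exists>i. walk G y [(e, i)] z"
  proof (cases "ends G e = [y, z]")
    case True
    then have "walk G y [(e, 0)] z" using e assms(2) by (auto simp: ordinary_edge_def)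
    then show ?thesis by blast
  next
    case False
    then have "walk G y [(e, 1)] z" using e assms(2) by (auto simp: ordinary_edge_def)
    then show ?thesis by blast
  qed
  then obtain i where "walk G y [(e, i)] z" by blast
  then have "walk G u (p @ [(e, i)]) z \<and> walk_edges (p @ [(e, i)]) \<subseteq> S"
    using p e(1) unfolding walk_append by auto
  then show ?case by blast
qed

lemma walk_take_drop:
  assumes "walk G u p w" "j \<le> length p"
  shows "walk G u (take j p) (walk_verts G u p ! j)" "walk G (walk_verts G u p ! j) (drop j p) w"
  using assms
proof (induction p arbitrary: u j)
  case Nil
  {
    case 1
    then show ?case by simp
  next
    case 2
    then show ?case by simp
  }
next
  case (Cons a p)
  {
    case 1
    then show ?case using Cons.IH(1) by (cases j; cases a) auto
  next
    case 2
    then show ?case using Cons.IH(2) by (cases j; cases a) auto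
  }
qed

lemma walk_verts_take: "walk_verts G u (take j p) = take (Suc j) (walk_verts G u p)"
  by (simp add: walk_verts_def take_map)

lemma walk_verts_drop:
  "j \<le> length p \<Longrightarrow> walk_verts G (walk_verts G u p ! j) (drop j p) = drop j (walk_verts G u p)"
proof (induction p arbitrary: u j)
  case Nil
  then show ?case by simp
next
  case (Cons a p)
  then show ?case by (cases j; cases a) auto
qed

lemma length_walk_verts [simp]: "length (walk_verts G u p) = Suc (length p)"
  by (simp add: walk_verts_def)

text \<open>Loop erasure from the front: if the first step starts at a vertex that the path for the
  rest visits again, the step is dropped and that path is cut off at this vertex.\<close>

lemma walk_path:
  assumes "walk G u p w"
  shows "\<exists>q. walk G u q w \<and> distinct (walk_verts G u q) \<and> walk_edges q \<subseteq> walk_edges p"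
  using assms
proof (induction p arbitrary: u)
  case Nil
  then show ?case by (intro exI[of _ "[]"]) simp
next
  case (Cons a p)
  obtain e i where a: "a = (e, i)" by force
  let ?v = "ends G e ! (1 - i)"
  have "walk G ?v p w" using Cons.prems by (simp add: a)
  from Cons.IH[OF this] obtain q where q: "walk G ?v q w"
    "distinct (walk_verts G ?v q)" "walk_edges q \<subseteq> walk_edges p" by blast
  show ?case
  proof (cases "u \<in> set (walk_verts G ?v q)")
    case False
    then have "walk G u (a # q) w \<and> distinct (walk_verts G u (a # q)) \<and> walk_edges (a # q) \<subseteq> walk_edges (a # p)"
      using q Cons.prems unfolding a by auto
    then show ?thesis by blast
  next
    case True
    then obtain j where "j < length (walk_verts G ?v q)" and j: "walk_verts G ?v q ! j = u"
      unfolding in_set_conv_nth by blast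
    then have j: "j \<le> length q" "walk_verts G ?v q ! j = u" by simp_all
    have "walk G u (drop j q) w" using walk_take_drop(2)[OF q(1) j(1)] unfolding j(2) .
    moreover have "distinct (walk_verts G u (drop j q))"
      using walk_verts_drop[OF j(1), of G ?v] q(2) unfolding j(2) by simp
    moreover have "walk_edges (drop j q) \<subseteq> walk_edges q"
      unfolding walk_edges_def by (rule image_mono[OF set_drop_subset])
    moreover have "walk_edges p \<subseteq> walk_edges (a # p)" by (auto simp: a)
    ultimately show ?thesis using q(3) by blast
  qed
qed

lemma linked_path:
  assumes "(u, w) \<in> linked G S" "S \<subseteq> edges G"
  shows "\<exists>p. walk G u p w \<and> distinct (walk_verts G u p) \<and> walk_edges p \<subseteq> S"
proof -
  obtain p where p: "walk G u p w" "walk_edges p \<subseteq> S" using linked_walk[OF assms] by blast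
  obtain q where "walk G u q w" "distinct (walk_verts G u q)" "walk_edges q \<subseteq> walk_edges p"
    using walk_path[OF p(1)] by blast
  then show ?thesis using p(2) by (intro exI[of _ q]) simp
qed

section \<open>Circles\<close>

abbreviation degree :: "('v, 'e, 'z) graph_scheme \<Rightarrow> 'e set \<Rightarrow> 'v \<Rightarrow> nat" where
  "degree G S v \<equiv> \<Sum>e\<in>S. count_list (ends G e) v"

lemma count_list_distinct_eq_1: "distinct xs \<Longrightarrow> x \<in> set xs \<Longrightarrow> count_list xs x = 1"
  by (induction xs) auto

lemma walk_verts_linked:
  assumes "walk G u p w" "walk_edges p \<subseteq> S" "x \<in> set (walk_verts G u p)"
  shows "(u, x) \<in> linked G S"
proof -
  obtain j where "j < length (walk_verts G u p)" and x: "walk_verts G u p ! j = x"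
    using assms(3) unfolding in_set_conv_nth by blast
  then have "walk G u (take j p) x" using walk_take_drop(1)[OF assms(1), of j] by simp
  moreover have "walk_edges (take j p) \<subseteq> S"
    using assms(2) set_take_subset[of j p] unfolding walk_edges_def by blast
  ultimately show ?thesis by (rule walk_linked)
qed

text \<open>Distinctness is asked of the tail only, since the start reappears as the last vertex.
  Every vertex then occurs once, the start twice, and \<open>trail_degree\<close> turns these counts
  into degree 2. A single loop is included.\<close>

lemma closed_walk_circle:
  assumes w: "walk G u p u" and ne: "p \<noteq> []" and de: "distinct (map fst p)"
    and dv: "distinct (tl (walk_verts G u p))"
  shows "circle G (walk_edges p)"
proof -
  have cov: "cover G (walk_edges p) = set (walk_verts G u p)" by (rule cover_walk_edges[OF w ne])
  have tl: "walk_verts G u p = u # tl (walk_verts G u p)" by (simp add: walk_verts_def)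
  have "tl (walk_verts G u p) \<noteq> []" using ne by (simp add: walk_verts_def)
  then have u: "u \<in> set (tl (walk_verts G u p))"
    using last_walk_verts[OF w] tl by (metis last_ConsR last_in_set)
  have "degree G (walk_edges p) v = 2" if "v \<in> cover G (walk_edges p)" for v
  proof -
    have "v \<in> set (tl (walk_verts G u p))" using that cov tl u by (metis set_ConsD)
    then have "count_list (tl (walk_verts G u p)) v = 1" using dv
      by (simp add: count_list_distinct_eq_1)
    then have "count_list (walk_verts G u p) v = of_bool (u = v) + 1" by (subst tl) auto
    then show ?thesis using trail_degree[OF w de, of v] by (cases "u = v") auto
  qed
  moreover have "(x, y) \<in> linked G (walk_edges p)"
    if "x \<in> cover G (walk_edges p)" "y \<in> cover G (walk_edges p)" for x y
    using walk_verts_linked[OF w subset_refl] that unfolding cov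
    by (meson linked_sym linked_trans)
  moreover have "\<forall>e\<in>walk_edges p. e \<in> edges G \<and> ordinary_edge G e"
    using walk_edges_ordinary[OF w] by blast
  moreover have "walk_edges p \<noteq> {}" using ne by (simp add: walk_edges_def)
  ultimately show ?thesis unfolding circle_def by blast
qed

lemma path_close_circle:
  assumes w: "walk G u p w" and dv: "distinct (walk_verts G u p)"
    and g: "walk G w [(g, i)] u" "g \<notin> walk_edges p"
  shows "circle G (insert g (walk_edges p))"
proof -
  have "walk G u (p @ [(g, i)]) u" using w g by (auto simp: walk_append)
  moreover have "distinct (map fst (p @ [(g, i)]))"
    using path_distinct_edges[OF w dv] g(2) by (auto simp: walk_edges_def)
  moreover have "distinct (tl (walk_verts G u (p @ [(g, i)])))"
    using walk_verts_append[OF w, of "[(g, i)]"] dv g(1) by (auto simp: walk_verts_def)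
  ultimately have "circle G (walk_edges (p @ [(g, i)]))" by (intro closed_walk_circle) auto
  then show ?thesis by simp
qed

text \<open>All degrees in \<open>C\<close> are 2 and \<open>T\<close> uses them up at its vertices,
  so no edge of \<open>C - T\<close> touches \<open>T\<close>. Connectedness of \<open>C\<close>
  then leaves nothing outside \<open>T\<close>.\<close>

lemma circle_saturated:
  assumes gr: "is_graph G" and C: "circle G C" and T: "T \<subseteq> C" "T \<noteq> {}"
    and deg: "\<And>v. v \<in> cover G T \<Longrightarrow> 2 \<le> degree G T v"
  shows "T = C"
proof (rule ccontr)
  assume "T \<noteq> C"
  then obtain e where e: "e \<in> C" "e \<notin> T" using T by blast
  have finC: "finite C" using C gr unfolding circle_def is_graph_def by (meson finite_subset)
  have no: "set (ends G f) \<inter> cover G T = {}" if f: "f \<in> C" "f \<notin> T" for f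
  proof (rule ccontr)
    assume "set (ends G f) \<inter> cover G T \<noteq> {}"
    then obtain v where v: "v \<in> set (ends G f)" "v \<in> cover G T" by blast
    have "v \<in> cover G C" using v(1) f(1) by (auto simp: cover_def)
    then have "degree G C v = 2" using C unfolding circle_def by blast
    moreover have "degree G C v = degree G T v + degree G (C - T) v"
      using sum.subset_diff[OF T(1) finC] by (simp add: add.commute)
    moreover have "count_list (ends G f) v \<le> degree G (C - T) v"
      using f finC by (intro member_le_sum) auto
    moreover have "count_list (ends G f) v > 0"
      using v(1) by (simp add: count_list_0_iff zero_less_iff_neq_zero)
    ultimately show False using deg[OF v(2)] by linarith
  qed
  have ord: "ordinary_edge G f" if "f \<in> C" for f using C that unfolding circle_def by blast
  obtain t where t: "t \<in> T" using T by blast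
  obtain x where x: "x \<in> set (ends G t)" using ord[of t] t T set_ends_step[of G t 0] by auto
  obtain y where y: "y \<in> set (ends G e)" using ord[of e] e set_ends_step[of G e 0] by auto
  have "(x, y) \<in> linked G C" using C x y t T e unfolding circle_def cover_def by blast
  moreover have "x \<in> cover G T" using x t by (auto simp: cover_def)
  ultimately have "y \<in> cover G T"
  proof (rule linked_invariant)
    fix f a b assume f: "f \<in> C" "set (ends G f) = {a, b}" "a \<in> cover G T"
    then have "f \<in> T" using no[of f] by auto
    then show "b \<in> cover G T" using f(2) by (auto simp: cover_def)
  qed
  then show False using no[OF e] y by blast
qed

text \<open>Take a longest trail in \<open>C\<close> from \<open>u\<close>. At its last vertex all
  edge ends of \<open>C\<close> are used, parity forces this vertex to be \<open>u\<close>, and then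
  every visited vertex has degree at least 2 in the trail, so \<open>circle_saturated\<close>
  applies.\<close>

lemma circle_once_around:
  assumes gr: "is_graph G" and C: "circle G C" and u: "u \<in> cover G C"
  shows "\<exists>p. once_around G C u p"
proof -
  have finC: "finite C" using C gr unfolding circle_def is_graph_def by (meson finite_subset)
  have CE: "\<And>e. e \<in> C \<Longrightarrow> e \<in> edges G \<and> ordinary_edge G e" using C unfolding circle_def by blast
  define P where "P q \<longleftrightarrow> (\<exists>w. walk G u q w \<and> distinct (map fst q) \<and> walk_edges q \<subseteq> C)" for q
  have "P []" by (simp add: P_def)
  moreover have "\<forall>q. P q \<longrightarrow> length q < Suc (card C)"
  proof (intro allI impI)
    fix q assume "P q"
    then have "distinct (map fst q)" "walk_edges q \<subseteq> C" unfolding P_def by auto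
    then show "length q < Suc (card C)"
      using distinct_card[of "map fst q"] card_mono[OF finC, of "walk_edges q"] by (simp add: walk_edges_def)
  qed
  ultimately obtain p where "P p" and max: "\<And>q. P q \<Longrightarrow> length q \<le> length p"
    using ex_has_greatest_nat[of P "[]" length "Suc (card C)"] by blast
  then obtain w where w: "walk G u p w" and de: "distinct (map fst p)" and pC: "walk_edges p \<subseteq> C"
    unfolding P_def by blast
  have full: "degree G (walk_edges p) w = 2" if wC: "w \<in> cover G C"
  proof (rule ccontr)
    assume n2: "degree G (walk_edges p) w \<noteq> 2"
    have "degree G C w = 2" using C wC unfolding circle_def by blast
    moreover have "degree G C w = degree G (walk_edges p) w + degree G (C - walk_edges p) w"
      using sum.subset_diff[OF pC finC] by (simp add: add.commute)
    ultimately have "degree G (C - walk_edges p) w \<noteq> 0" using n2 by linarith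
    then obtain e where e: "e \<in> C" "e \<notin> walk_edges p" "count_list (ends G e) w \<noteq> 0"
      by (elim sum.not_neutral_contains_not_neutral) auto
    then have "w \<in> set (ends G e)" by (simp add: count_list_0_iff)
    then obtain i where i: "i < 2" "ends G e ! i = w"
      using CE[OF e(1)] unfolding in_set_conv_nth ordinary_edge_def by auto
    then have "walk G u (p @ [(e, i)]) (ends G e ! (1 - i))"
      using w CE[OF e(1)] by (auto simp: walk_append)
    then have "P (p @ [(e, i)])" unfolding P_def using e de pC
      by (intro exI[of _ "ends G e ! (1 - i)"]) (auto simp: walk_edges_def)
    then show False using max by fastforce
  qed
  have wC: "w \<in> cover G C"
  proof (cases "p = []")
    case True
    then show ?thesis using w u by simp
  next
    case False
    then show ?thesis using cover_walk_edges[OF w False] end_in_walk_verts[OF w] pC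
      by (auto simp: cover_def)
  qed
  \<comment> \<open>With degree 2 at \<open>w\<close>, the left side is odd unless
    \<open>w = u\<close>.\<close>
  have parity: "degree G (walk_edges p) w + of_bool (w = u) + 1 = 2 * count_list (walk_verts G u p) w"
    using trail_degree[OF w de, of w] by simp
  have wu: "w = u"
  proof (rule ccontr)
    assume "w \<noteq> u"
    then have "3 = 2 * count_list (walk_verts G u p) w" using parity full[OF wC] by simp
    then show False by presburger
  qed
  have ne: "p \<noteq> []" using full[OF wC] by auto
  have tl: "walk_verts G u p = u # tl (walk_verts G u p)" by (simp add: walk_verts_def)
  have "2 \<le> degree G (walk_edges p) v" if "v \<in> cover G (walk_edges p)" for v
  proof (cases "v = u")
    case True
    then show ?thesis using full[OF wC] wu by simp
  next
    case False
    have "v \<in> set (walk_verts G u p)" using that cover_walk_edges[OF w ne] by simp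
    then have "count_list (walk_verts G u p) v > 0"
      by (simp add: count_list_0_iff zero_less_iff_neq_zero)
    then show ?thesis using trail_degree[OF w de, of v] False wu by simp
  qed
  then have "walk_edges p = C"
    using ne by (intro circle_saturated[OF gr C pC]) (auto simp: walk_edges_def)
  then show ?thesis using w wu de unfolding once_around_def by blast
qed

lemma circle_subset_eq:
  assumes "is_graph G" "circle G C" "circle G T" "T \<subseteq> C"
  shows "T = C"
proof (rule circle_saturated[OF assms(1,2,4)])
  show "T \<noteq> {}" using assms(3) unfolding circle_def by blast
  show "\<And>v. v \<in> cover G T \<Longrightarrow> 2 \<le> degree G T v" using assms(3) unfolding circle_def by simp
qed

lemma walk_sign_prod:
  assumes "distinct (map fst p)"
  shows "walk_sign G p = (\<Prod>e\<in>walk_edges p. esign G e)"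
proof -
  have "walk_sign G p = prod_list (map (esign G) (map fst p))"
    by (simp add: walk_sign_def comp_def case_prod_unfold)
  also have "\<dots> = (\<Prod>e\<in>set (map fst p). esign G e)"
    by (rule prod.distinct_set_conv_list[OF assms, symmetric])
  finally show ?thesis by (simp add: walk_edges_def)
qed

lemma loop_circle:
  assumes "e \<in> edges G" "ends G e = [u, u]"
  shows "circle G {e}"
proof -
  have "walk G u [(e, 0)] u" using assms by (simp add: ordinary_edge_def)
  then have "circle G (walk_edges [(e, 0)])"
    by (rule closed_walk_circle) (auto simp: walk_verts_def)
  then show ?thesis by simp
qed

section \<open>Gains as linear forms\<close>

definition inc :: "('v, 'e, 'k::field) gain_signed_graph \<Rightarrow> ('v \<Rightarrow> 'k) \<Rightarrow> 'e \<Rightarrow> 'k" where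
  "inc G \<theta> e = (\<Sum>i<length (ends G e). of_int (end_sign G e i) * \<theta> (ends G e ! i))"

text \<open>The walk gain with the edge gains replaced by an arbitrary edge function, so that one
  and the same functional can be evaluated at \<open>gain G\<close> and at
  \<open>inc G \<theta>\<close>.\<close>

fun walk_form :: "('v, 'e, 'k::field) gain_signed_graph \<Rightarrow> ('e \<Rightarrow> 'k) \<Rightarrow> ('e \<times> nat) list \<Rightarrow> 'k" where
  "walk_form G \<psi> [] = 0"
| "walk_form G \<psi> ((e, i) # p) = - (\<psi> e * of_int (end_sign G e i)) + of_int (esign G e) * walk_form G \<psi> p"

lemma walk_gain_eq_form: "walk_gain G p = walk_form G (gain G) p"
proof (induction p)
  case Nil
  then show ?case by (simp add: walk_gain_def)
next
  case (Cons a p)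
  obtain e i where a: "a = (e, i)" by force
  show ?case
    unfolding walk_gain_def a length_Cons sum.lessThan_Suc_shift
    by (simp add: Cons.IH[symmetric] walk_gain_def sum_negf sum_distrib_left algebra_simps case_prod_unfold)
qed

lemma walk_form_append:
  "walk_form G \<psi> (p @ q) = walk_form G \<psi> p + of_int (walk_sign G p) * walk_form G \<psi> q"
  by (induction p) (auto simp: algebra_simps)

text \<open>On a trail each edge occurs once, so its coefficient is a single product of signs. The
  coefficients are chosen before \<open>\<psi>\<close>: they have to serve all edge functions at
  once.\<close>

lemma walk_form_sum:
  assumes "distinct (map fst p)"
    and "\<And>e. e \<in> walk_edges p \<Longrightarrow> esign G e \<in> {1, -1} \<and> end_sign G e 0 \<in> {1, -1} \<and> end_sign G e 1 \<in> {1, -1}"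
    and "\<And>e i. (e, i) \<in> set p \<Longrightarrow> i < 2"
  shows "\<exists>a. (\<forall>e\<in>walk_edges p. a e \<in> {1, -1}) \<and> (\<forall>\<psi>. walk_form G \<psi> p = (\<Sum>e\<in>walk_edges p. a e * \<psi> e))"
  using assms
proof (induction p)
  case Nil
  then show ?case by simp
next
  case (Cons b p)
  obtain e i where b: "b = (e, i)" by force
  obtain a where a: "\<forall>e\<in>walk_edges p. a e \<in> {1, -1}"
    "\<And>\<psi>. walk_form G \<psi> p = (\<Sum>e\<in>walk_edges p. a e * \<psi> e)"
    using Cons.IH Cons.prems by (force simp: b)
  have e: "e \<notin> walk_edges p" using Cons.prems(1) by (auto simp: b walk_edges_def)
  have "i = 0 \<or> i = 1" using Cons.prems(3)[of e i] by (auto simp: b)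
  then have s: "esign G e \<in> {1, -1}" "end_sign G e i \<in> {1, -1}"
    using Cons.prems(2)[of e] by (auto simp: b)
  define c where "c f = (if f = e then - of_int (end_sign G e i) else of_int (esign G e) * a f)" for f
  have "c f \<in> {1, -1}" if "f \<in> walk_edges (b # p)" for f
    using that s a(1) by (auto simp: c_def b)
  moreover have "walk_form G \<psi> (b # p) = (\<Sum>f\<in>walk_edges (b # p). c f * \<psi> f)" for \<psi>
  proof -
    have "(\<Sum>f\<in>walk_edges p. c f * \<psi> f) = of_int (esign G e) * walk_form G \<psi> p"
      unfolding a(2) sum_distrib_left using e by (intro sum.cong) (auto simp: c_def)
    then show ?thesis using e by (simp add: b c_def)
  qed
  ultimately show ?case by blast
qed

locale gain_graph =
  fixes G :: "('v, 'e, 'k::field) gain_signed_graph"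
  assumes char_not_2: "(2::'k) \<noteq> 0"
    and gsg: "is_gain_signed_graph G"
begin

abbreviation "V \<equiv> verts G"
abbreviation "E \<equiv> edges G"
abbreviation "\<rho> \<equiv> rk (frame_matroid G)"

lemma graph: "is_graph G"
  using gsg unfolding is_gain_signed_graph_def is_signed_graph_def by blast

lemma finite_verts [simp]: "finite V"
  and finite_edges [simp]: "finite E"
  using graph unfolding is_graph_def by auto

lemma ends_verts: "e \<in> E \<Longrightarrow> set (ends G e) \<subseteq> V"
  and length_ends: "e \<in> E \<Longrightarrow> length (ends G e) \<le> 2"
  using graph unfolding is_graph_def by auto

lemma esign_cases: "e \<in> E \<Longrightarrow> esign G e = 1 \<or> esign G e = -1"
  using gsg unfolding is_gain_signed_graph_def is_signed_graph_def by auto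

lemma end_sign_cases: "e \<in> E \<Longrightarrow> i < length (ends G e) \<Longrightarrow> end_sign G e i = 1 \<or> end_sign G e i = -1"
  using gsg unfolding is_gain_signed_graph_def by auto

lemma end_sign_mult: "e \<in> E \<Longrightarrow> ordinary_edge G e \<Longrightarrow> end_sign G e 0 * end_sign G e 1 = - esign G e"
  using gsg unfolding is_gain_signed_graph_def by auto

lemma end_sign_other:
  assumes "e \<in> E" "ordinary_edge G e" "i < 2"
  shows "end_sign G e (1 - i) = - esign G e * end_sign G e i"
proof -
  have "end_sign G e 0 = 1 \<or> end_sign G e 0 = -1" "end_sign G e 1 = 1 \<or> end_sign G e 1 = -1"
    using end_sign_cases[OF assms(1), of 0] end_sign_cases[OF assms(1), of 1] assms(2)
    unfolding ordinary_edge_def by auto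
  moreover have "i = 0 \<or> i = 1" using assms(3) by auto
  ultimately show ?thesis using end_sign_mult[OF assms(1,2)] by auto
qed

lemma edge_kinds:
  assumes "e \<in> E"
  obtains (loose) "loose_edge G e" | (half) v where "half_edge G e" "ends G e = [v]"
  | (ordinary) "ordinary_edge G e"
proof -
  have "length (ends G e) = 0 \<or> length (ends G e) = 1 \<or> length (ends G e) = 2"
    using length_ends[OF assms] by linarith
  then show ?thesis using that
    unfolding loose_edge_def half_edge_def ordinary_edge_def by (auto simp: length_Suc_conv)
qed

lemma inc_loose: "loose_edge G e \<Longrightarrow> inc G \<theta> e = 0"
  by (simp add: inc_def loose_edge_def)

lemma inc_half: "ends G e = [v] \<Longrightarrow> inc G \<theta> e = of_int (end_sign G e 0) * \<theta> v"
  by (simp add: inc_def)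

lemma of_int_sign_square [simp]:
  "e \<in> E \<Longrightarrow> (of_int (esign G e) * of_int (esign G e) :: 'k) = 1"
  using esign_cases[of e] by auto

lemma inc_step:
  assumes "e \<in> E" "ordinary_edge G e" "i < 2"
  shows "inc G \<theta> e = of_int (end_sign G e i) *
    (\<theta> (ends G e ! i) - of_int (esign G e) * \<theta> (ends G e ! (1 - i)))"
proof -
  have "i = 0 \<or> i = 1" using assms(3) by auto
  then have "inc G \<theta> e = of_int (end_sign G e i) * \<theta> (ends G e ! i) +
      of_int (end_sign G e (1 - i)) * \<theta> (ends G e ! (1 - i))"
    using assms(2) by (auto simp: inc_def ordinary_edge_def numeral_2_eq_2)
  then show ?thesis unfolding end_sign_other[OF assms] by (simp add: algebra_simps)
qed

lemma of_int_end_sign_nonzero: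
  "e \<in> E \<Longrightarrow> i < length (ends G e) \<Longrightarrow> of_int (end_sign G e i) \<noteq> (0::'k)"
  using end_sign_cases[of e i] by auto

lemma inc_step_eq_0:
  assumes "e \<in> E" "ordinary_edge G e" "i < 2"
  shows "inc G \<theta> e = 0 \<longleftrightarrow> \<theta> (ends G e ! i) = of_int (esign G e) * \<theta> (ends G e ! (1 - i))"
  using of_int_end_sign_nonzero[of e i] assms unfolding inc_step[OF assms] ordinary_edge_def by simp

lemma walk_sign_cases:
  "walk G u p w \<Longrightarrow> walk_sign G p = 1 \<or> walk_sign G p = -1"
proof (induction p arbitrary: u)
  case (Cons a p)
  then show ?case using esign_cases[of "fst a"] by (cases a) fastforce
qed simp

lemma walk_sign_square:
  "walk G u p w \<Longrightarrow> (of_int (walk_sign G p) * of_int (walk_sign G p) :: 'k) = 1"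
  using walk_sign_cases[of u p w] by auto

text \<open>The sum telescopes: since end signs square to 1, the step from \<open>u\<close> to
  \<open>v\<close> along \<open>e\<close> contributes the sign of \<open>e\<close> times
  \<open>\<theta> v\<close>, minus \<open>\<theta> u\<close>.\<close>

lemma walk_form_inc:
  "walk G u p w \<Longrightarrow> walk_form G (inc G \<theta>) p = of_int (walk_sign G p) * \<theta> w - \<theta> u"
proof (induction rule: walk_induct)
  case Nil
  then show ?case by simp
next
  case (Cons u e i p)
  let ?v = "ends G e ! (1 - i)"
  note w = Cons.hyps(5) and i = Cons.hyps(3,4,2,1)
  have t: "(of_int (end_sign G e i) * of_int (end_sign G e i) :: 'k) = 1"
    using end_sign_cases[OF i(4), of i] i(1,3) by (auto simp: ordinary_edge_def)
  have "inc G \<theta> e * of_int (end_sign G e i)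
      = (of_int (end_sign G e i) * of_int (end_sign G e i)) * (\<theta> u - of_int (esign G e) * \<theta> ?v)"
    unfolding inc_step[OF i(4,3,1)] i(2) by (simp add: algebra_simps)
  then have "inc G \<theta> e * of_int (end_sign G e i) = \<theta> u - of_int (esign G e) * \<theta> ?v"
    unfolding t by simp
  then show ?case
    unfolding walk_form.simps walk_sign_simps Cons.IH by (simp only:) (simp add: algebra_simps)
qed

lemma walk_form_reverse:
  "walk G u p w \<Longrightarrow> walk_form G \<psi> (reverse_walk p) = - of_int (walk_sign G p) * walk_form G \<psi> p"
proof (induction rule: walk_induct)
  case Nil
  then show ?case by simp
next
  case (Cons u e i p)
  let ?v = "ends G e ! (1 - i)"
  note w = Cons.hyps(5) and i = Cons.hyps(3,4,2,1)
  have s: "of_int (esign G e) * (of_int (esign G e) * x) = (x::'k)" for x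
    using esign_cases[OF i(4)] by auto
  show ?case using Cons.IH end_sign_other[OF i(4,3,1)]
    by (simp add: walk_form_append algebra_simps s)
qed

lemma walk_form_trail:
  assumes "walk G u p w" "distinct (map fst p)"
  obtains a where "\<And>e. e \<in> walk_edges p \<Longrightarrow> a e = 1 \<or> a e = -1"
    "\<And>\<psi>. walk_form G \<psi> p = (\<Sum>e\<in>walk_edges p. a e * \<psi> e)"
proof -
  have 1: "esign G e \<in> {1, -1} \<and> end_sign G e 0 \<in> {1, -1} \<and> end_sign G e 1 \<in> {1, -1}"
    if "e \<in> walk_edges p" for e
    using walk_edges_ordinary[OF assms(1) that] esign_cases[of e] end_sign_cases[of e 0] end_sign_cases[of e 1]
    by (auto simp: ordinary_edge_def)
  have 2: "i < 2" if "(e, i) \<in> set p" for e i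
    using assms(1) that by (induction p arbitrary: u) auto
  have "\<exists>a. (\<forall>e\<in>walk_edges p. a e \<in> {1, -1}) \<and> (\<forall>\<psi>. walk_form G \<psi> p = (\<Sum>e\<in>walk_edges p. a e * \<psi> e))"
    using 1 2 by (intro walk_form_sum[OF assms(2)]) blast+
  then show ?thesis using that by auto
qed

end

section \<open>Gains of sign circuits\<close>

text \<open>A linear functional of edge functions with support exactly \<open>C\<close>. The nonzero
  coefficients are what allows solving a relation on a circuit for any one of its edges.\<close>

definition full_form :: "(('e \<Rightarrow> 'k::field) \<Rightarrow> 'k) \<Rightarrow> 'e set \<Rightarrow> bool" where
  "full_form L C \<longleftrightarrow> (\<exists>a. (\<forall>e\<in>C. a e \<noteq> 0) \<and> (\<forall>\<psi>. L \<psi> = (\<Sum>e\<in>C. a e * \<psi> e)))"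

lemma full_form_add:
  assumes "full_form L A" "full_form M B" "A \<inter> B = {}" "finite A" "finite B"
  shows "full_form (\<lambda>\<psi>. L \<psi> + M \<psi>) (A \<union> B)"
proof -
  obtain a where a: "\<And>e. e \<in> A \<Longrightarrow> a e \<noteq> 0" "\<And>\<psi>. L \<psi> = (\<Sum>e\<in>A. a e * \<psi> e)"
    using assms(1) unfolding full_form_def by blast
  obtain b where b: "\<And>e. e \<in> B \<Longrightarrow> b e \<noteq> 0" "\<And>\<psi>. M \<psi> = (\<Sum>e\<in>B. b e * \<psi> e)"
    using assms(2) unfolding full_form_def by blast
  let ?c = "\<lambda>e. if e \<in> A then a e else b e"
  have "L \<psi> + M \<psi> = (\<Sum>e\<in>A \<union> B. ?c e * \<psi> e)" for \<psi>
  proof -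
    have "(\<Sum>e\<in>B. ?c e * \<psi> e) = M \<psi>" unfolding b(2) using assms(3) by (intro sum.cong) auto
    moreover have "(\<Sum>e\<in>A. ?c e * \<psi> e) = L \<psi>" unfolding a(2) by (intro sum.cong) auto
    ultimately show ?thesis by (simp add: sum.union_disjoint[OF assms(4,5,3)])
  qed
  then show ?thesis unfolding full_form_def using a(1) b(1) by (intro exI[of _ ?c]) auto
qed

lemma full_form_scale:
  assumes "full_form L A" "c \<noteq> 0"
  shows "full_form (\<lambda>\<psi>. c * L \<psi>) A"
proof -
  obtain a where a: "\<And>e. e \<in> A \<Longrightarrow> a e \<noteq> 0" "\<And>\<psi>. L \<psi> = (\<Sum>e\<in>A. a e * \<psi> e)"
    using assms(1) unfolding full_form_def by blast
  then show ?thesis unfolding full_form_def using assms(2)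
    by (intro exI[of _ "\<lambda>e. c * a e"]) (simp add: sum_distrib_left mult.assoc)
qed

lemma full_form_single: "c \<noteq> 0 \<Longrightarrow> full_form (\<lambda>\<psi>. c * \<psi> e) {e}"
  unfolding full_form_def by (intro exI[of _ "\<lambda>_. c"]) simp

definition nullv :: "('v, 'e, 'k::field) gain_signed_graph \<Rightarrow> 'e set \<Rightarrow> ('v \<Rightarrow> 'k) \<Rightarrow> bool" where
  "nullv G S \<theta> \<longleftrightarrow> (\<forall>e\<in>S. inc G \<theta> e = 0)"

definition potential :: "('v, 'e, 'k::field) gain_signed_graph \<Rightarrow> 'e set \<Rightarrow> ('v \<Rightarrow> 'k) \<Rightarrow> bool" where
  "potential G S \<theta> \<longleftrightarrow> (\<forall>e\<in>S. gain G e = inc G \<theta> e)"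

context gain_graph
begin

lemma full_form_trail:
  assumes "walk G u p w" "distinct (map fst p)"
  shows "full_form (\<lambda>\<psi>. walk_form G \<psi> p) (walk_edges p)"
proof -
  obtain a where "\<And>e. e \<in> walk_edges p \<Longrightarrow> a e = 1 \<or> a e = -1"
    "\<And>\<psi>. walk_form G \<psi> p = (\<Sum>e\<in>walk_edges p. a e * \<psi> e)"
    using walk_form_trail[OF assms] by blast
  then show ?thesis unfolding full_form_def by (intro exI[of _ a]) fastforce
qed

lemma negative_figure_cases:
  assumes "negative_figure G C"
  obtains (circle) "negative_circle G C" | (half) h v where "h \<in> E" "half_edge G h" "ends G h = [v]" "C = {h}"
  using assms unfolding negative_figure_def half_edge_def by (auto simp: length_Suc_conv)

lemma negative_figure_edge:
  assumes "negative_figure G C" "f \<in> C"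
  shows "f \<in> E" "ends G f \<noteq> []" "ordinary_edge G f \<and> negative_circle G C \<or> half_edge G f \<and> C = {f}"
proof -
  have "f \<in> E \<and> ends G f \<noteq> [] \<and>
    (ordinary_edge G f \<and> negative_circle G C \<or> half_edge G f \<and> C = {f})"
    using assms(1)
  proof (cases rule: negative_figure_cases)
    case circle
    then have "f \<in> E" "ordinary_edge G f"
      using assms(2) unfolding negative_circle_def circle_def by blast+
    then show ?thesis using circle by (auto simp: ordinary_edge_def)
  next
    case (half h v)
    then show ?thesis using assms(2) by simp
  qed
  then show "f \<in> E" "ends G f \<noteq> []"
    "ordinary_edge G f \<and> negative_circle G C \<or> half_edge G f \<and> C = {f}" by blast+
qed

text \<open>A shared edge would have both ends at the single common vertex, but a path contains no
  loops.\<close>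

lemma negative_figure_disjoint_path:
  assumes "negative_figure G C" "walk G u p w" "distinct (walk_verts G u p)"
    and "cover G C \<inter> set (walk_verts G u p) = {x}"
  shows "C \<inter> walk_edges p = {}"
proof (rule ccontr)
  assume "C \<inter> walk_edges p \<noteq> {}"
  then obtain f where f: "f \<in> C" "f \<in> walk_edges p" by blast
  have "ordinary_edge G f" using walk_edges_ordinary[OF assms(2) f(2)] by blast
  then have "set (ends G f) = {ends G f ! 0, ends G f ! 1}" using set_ends_step[of G f 0] by simp
  moreover have "set (ends G f) \<subseteq> {x}"
    using ends_subset_walk_verts[OF assms(2) f(2)] f(1) assms(4) unfolding cover_def by blast
  ultimately show False using path_no_loops[OF assms(2,3) f(2)] by auto
qed

text \<open>Disjointness lets the coefficient functions of the three pieces be glued. An edge in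
  both figures has all its ends at the one common vertex. If it is a loop, it is a circle by itself
  and equals both figures by \<open>circle_subset_eq\<close>; if it is a half edge, it is each of
  the figures already.\<close>

lemma handcuff_disjoint:
  assumes fig: "negative_figure G C1" "negative_figure G C2" "C1 \<noteq> C2"
    and con: "connecting_path G C1 C2 u p w"
  shows "C1 \<inter> walk_edges p = {}" "C2 \<inter> walk_edges p = {}" "C1 \<inter> C2 = {}"
proof -
  show "C1 \<inter> walk_edges p = {}" "C2 \<inter> walk_edges p = {}"
    using con negative_figure_disjoint_path[OF fig(1)] negative_figure_disjoint_path[OF fig(2)]
    unfolding connecting_path_def by blast+
  show "C1 \<inter> C2 = {}"
  proof (rule ccontr)
    assume "C1 \<inter> C2 \<noteq> {}"
    then obtain f where f: "f \<in> C1" "f \<in> C2" by blast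
    have "set (ends G f) \<subseteq> cover G C1 \<inter> cover G C2" using f by (auto simp: cover_def)
    then have sub: "set (ends G f) \<subseteq> {u}"
      using con negative_figure_edge(2)[OF fig(1) f(1)] unfolding connecting_path_def by (auto split: if_splits)
    have "ordinary_edge G f" "negative_circle G C1" "negative_circle G C2"
      using negative_figure_edge(3)[OF fig(1) f(1)] negative_figure_edge(3)[OF fig(2) f(2)] fig(3)
      by (auto simp: ordinary_edge_def half_edge_def)
    moreover have "ends G f = [u, u]"
      using ends_ordinary[OF \<open>ordinary_edge G f\<close>] sub by (metis empty_set insert_subset list.simps(15) singletonD)
    then have "circle G {f}" using loop_circle negative_figure_edge(1)[OF fig(1) f(1)] by metis
    ultimately have "{f} = C1" "{f} = C2"
      using circle_subset_eq[OF graph, of C1 "{f}"] circle_subset_eq[OF graph, of C2 "{f}"] f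
      unfolding negative_circle_def by auto
    then show False using fig(3) by simp
  qed
qed

lemma once_around_sign:
  "once_around G C u p \<Longrightarrow> walk_sign G p = (\<Prod>e\<in>C. esign G e)"
  unfolding once_around_def using walk_sign_prod by metis

text \<open>Each circuit walk defines a functional supported on the whole circuit. It vanishes on
  all \<open>inc G \<theta>\<close> because the walk is closed with sign 1 or because the half edge
  terms cancel what telescoping leaves over.\<close>

lemma circuit_gain_form:
  assumes "circuit_gain G C g"
  shows "\<exists>L. full_form L C \<and> (\<forall>\<theta>. L (inc G \<theta>) = 0) \<and> g = L (gain G)"
  using assms
proof cases
  case (loose e)
  have "full_form (\<lambda>\<psi>. 1 * \<psi> e) {e}" by (rule full_form_single) simp
  then show ?thesis using loose inc_loose by (intro exI[of _ "\<lambda>\<psi>. 1 * \<psi> e"]) simp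
next
  case (circle u p)
  have p: "walk G u p u" "distinct (map fst p)" "walk_edges p = C" "walk_sign G p = 1"
    using circle once_around_sign[OF circle(3)] unfolding once_around_def positive_circle_def by auto
  then show ?thesis using full_form_trail[OF p(1,2)] walk_form_inc[OF p(1)] circle(1)
    by (intro exI[of _ "\<lambda>\<psi>. walk_form G \<psi> p"]) (simp add: walk_gain_eq_form)
next
  case (circle_circle C1 C2 u p w p1 p2)
  have fig: "negative_figure G C1" "negative_figure G C2"
    using circle_circle unfolding negative_figure_def by auto
  note dis = handcuff_disjoint[OF fig circle_circle(5,6)]
  have p: "walk G u p w" "distinct (walk_verts G u p)"
    using circle_circle(6) unfolding connecting_path_def by auto
  have p1: "walk G u p1 u" "distinct (map fst p1)" "walk_edges p1 = C1" "walk_sign G p1 = -1"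
    using circle_circle(3,7) once_around_sign[OF circle_circle(7)] unfolding once_around_def negative_circle_def by auto
  have p2: "walk G w p2 w" "distinct (map fst p2)" "walk_edges p2 = C2" "walk_sign G p2 = -1"
    using circle_circle(4,8) once_around_sign[OF circle_circle(8)] unfolding once_around_def negative_circle_def by auto
  let ?s = "of_int (walk_sign G p) :: 'k"
  let ?q = "p1 @ p @ p2 @ reverse_walk p"
  \<comment> \<open>Both figures have sign -1, so the forward and the backward pass along
    \<open>p\<close> each contribute minus its form and add up instead of cancelling.\<close>
  have "walk_form G \<psi> ?q = walk_form G \<psi> p1 + (- 2) * walk_form G \<psi> p + (- ?s) * walk_form G \<psi> p2" for \<psi>
  proof -
    have "?s * (?s * walk_form G \<psi> p) = walk_form G \<psi> p"
      using walk_sign_square[OF p(1)] by (metis mult.assoc mult_1)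
    then show ?thesis by (simp add: walk_form_append walk_form_reverse[OF p(1)] p1(4) p2(4) algebra_simps)
  qed
  moreover have "full_form (\<lambda>\<psi>. walk_form G \<psi> p1 + (- 2) * walk_form G \<psi> p + (- ?s) * walk_form G \<psi> p2) (C1 \<union> walk_edges p \<union> C2)"
    using dis full_form_trail[OF p1(1,2)] full_form_trail[OF p(1) path_distinct_edges[OF p]]
      full_form_trail[OF p2(1,2)] walk_sign_cases[OF p(1)] p1(3) p2(3) char_not_2
      finite_walk_edges[of p1] finite_walk_edges[of p2]
    by (intro full_form_add full_form_scale) auto
  ultimately have "full_form (\<lambda>\<psi>. walk_form G \<psi> ?q) C" using circle_circle(1) by simp
  moreover have "walk G u ?q u"
    using p1(1) p(1) p2(1) walk_reverse[OF p(1)] unfolding walk_append by blast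
  then have "walk_form G (inc G \<theta>) ?q = 0" for \<theta>
    using walk_sign_square[OF p(1)] by (simp add: walk_form_inc p1(4) p2(4))
  ultimately show ?thesis using circle_circle(2)
    by (intro exI[of _ "\<lambda>\<psi>. walk_form G \<psi> ?q"]) (simp add: walk_gain_eq_form)
next
  case (half_circle h C2 u p w p2 q)
  have fig: "negative_figure G {h}" "negative_figure G C2"
    using half_circle unfolding negative_figure_def by auto
  have ne: "{h} \<noteq> C2" using half_circle(4,5) 
    by (auto simp: negative_circle_def circle_def half_edge_def ordinary_edge_def)
  note dis = handcuff_disjoint[OF fig ne half_circle(6)]
  have p: "walk G u p w" "distinct (walk_verts G u p)"
    using half_circle(6) unfolding connecting_path_def by auto
  have "u \<in> cover G {h}" using half_circle(6) unfolding connecting_path_def by blast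
  then have h: "ends G h = [u]" using half_circle(4) unfolding half_edge_def cover_def
    by (auto simp: length_Suc_conv)
  have p2: "walk G w p2 w" "distinct (map fst p2)" "walk_edges p2 = C2" "walk_sign G p2 = -1"
    using half_circle(5,7) once_around_sign[OF half_circle(7)] unfolding once_around_def negative_circle_def by auto
  let ?s = "of_int (walk_sign G p) :: 'k"
  let ?t = "of_int (end_sign G h 0) :: 'k"
  \<comment> \<open>The walk \<open>q\<close> has sign -1, which makes its initial and final half
    edge terms equal; likewise the two passes along \<open>p\<close> agree.\<close>
  let ?L = "\<lambda>\<psi>. (2 * ?t) * \<psi> h + 2 * walk_form G \<psi> p + ?s * walk_form G \<psi> p2"
  have t: "?t \<noteq> 0" using of_int_end_sign_nonzero[OF half_circle(3)] h by simp
  have sq: "?s * ?s = 1" by (rule walk_sign_square[OF p(1)])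
  have q_sign: "of_int (walk_sign G q) = (-1 :: 'k)" unfolding half_circle(8)
    using sq by (simp add: p2(4))
  have L: "?t * \<psi> h + walk_form G \<psi> q - \<psi> h * of_int (walk_sign G q) * ?t = ?L \<psi>" for \<psi>
  proof -
    have "?s * (?s * walk_form G \<psi> p) = walk_form G \<psi> p"
      using sq by (metis mult.assoc mult_1)
    then show ?thesis unfolding q_sign
      by (simp add: half_circle(8) walk_form_append walk_form_reverse[OF p(1)] p2(4) algebra_simps)
  qed
  have "full_form ?L ({h} \<union> walk_edges p \<union> C2)"
    using dis full_form_trail[OF p(1) path_distinct_edges[OF p]] t
      full_form_trail[OF p2(1,2)] walk_sign_cases[OF p(1)] p2(3) char_not_2
      finite_walk_edges[of p2]
    by (intro full_form_add full_form_scale full_form_single) auto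
  moreover have "walk G u q u"
    using p(1) p2(1) walk_reverse[OF p(1)] unfolding half_circle(8) walk_append by blast
  then have "?L (inc G \<theta>) = 0" for \<theta>
  proof -
    have tt: "?t * ?t = 1" using end_sign_cases[OF half_circle(3), of 0] h by auto
    have "?L (inc G \<theta>) = ?t * inc G \<theta> h + walk_form G (inc G \<theta>) q - inc G \<theta> h * of_int (walk_sign G q) * ?t"
      by (rule L[symmetric])
    also have "\<dots> = 2 * (?t * ?t) * \<theta> u - 2 * \<theta> u"
      unfolding walk_form_inc[OF \<open>walk G u q u\<close>] q_sign inc_half[OF h] by (simp add: algebra_simps)
    finally show ?thesis using tt by simp
  qed
  moreover have "g = ?L (gain G)"
    using half_circle(2) unfolding L[symmetric] walk_gain_eq_form initial_gain_def final_gain_def by simp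
  ultimately show ?thesis using half_circle(1) by blast
next
  case (half_half h1 h2 u p w)
  have fig: "negative_figure G {h1}" "negative_figure G {h2}"
    using half_half unfolding negative_figure_def by auto
  have ne: "{h1} \<noteq> {h2}" using half_half by simp
  note dis = handcuff_disjoint[OF fig ne half_half(8)]
  have p: "walk G u p w" "distinct (walk_verts G u p)"
    using half_half(8) unfolding connecting_path_def by auto
  have "u \<in> cover G {h1}" "w \<in> cover G {h2}" using half_half(8) unfolding connecting_path_def by blast+
  then have h: "ends G h1 = [u]" "ends G h2 = [w]" using half_half(4,6) unfolding half_edge_def cover_def
    by (auto simp: length_Suc_conv)
  let ?s = "of_int (walk_sign G p) :: 'k"
  let ?t1 = "of_int (end_sign G h1 0) :: 'k"
  let ?t2 = "of_int (end_sign G h2 0) :: 'k"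
  let ?L = "\<lambda>\<psi>. ?t1 * \<psi> h1 + walk_form G \<psi> p + (- (?s * ?t2)) * \<psi> h2"
  have t: "?t1 \<noteq> 0" "?t2 \<noteq> 0"
    using of_int_end_sign_nonzero[OF half_half(3), of 0] of_int_end_sign_nonzero[OF half_half(5), of 0] h by auto
  have "full_form ?L ({h1} \<union> walk_edges p \<union> {h2})"
    using dis full_form_trail[OF p(1) path_distinct_edges[OF p]] t walk_sign_cases[OF p(1)]
    by (intro full_form_add full_form_single) auto
  moreover have "?L (inc G \<theta>) = 0" for \<theta>
  proof -
    have tt: "?t1 * ?t1 = 1" "?t2 * ?t2 = 1"
      using end_sign_cases[OF half_half(3), of 0] end_sign_cases[OF half_half(5), of 0] h by auto
    have "?L (inc G \<theta>) = (?t1 * ?t1) * \<theta> u + (?s * \<theta> w - \<theta> u) - ?s * (?t2 * ?t2) * \<theta> w"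
      unfolding walk_form_inc[OF p(1)] inc_half[OF h(1)] inc_half[OF h(2)] by (simp add: algebra_simps)
    then show ?thesis unfolding tt by simp
  qed
  moreover have "g = ?L (gain G)"
    using half_half(2) unfolding walk_gain_eq_form initial_gain_def final_gain_def by simp
  ultimately show ?thesis using half_half(1) by blast
qed

lemma connecting_path_reverse:
  assumes "connecting_path G C1 C2 u p w"
  shows "connecting_path G C2 C1 w (reverse_walk p) u"
proof -
  have "walk G u p w" using assms unfolding connecting_path_def by blast
  then show ?thesis using assms walk_reverse[of G u p w] walk_verts_reverse[of G u p w]
    unfolding connecting_path_def by (auto split: if_splits)
qed

lemma connecting_path_cover:
  assumes "connecting_path G C1 C2 u p w" shows "u \<in> cover G C1" "w \<in> cover G C2"
  using assms unfolding connecting_path_def by blast+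

text \<open>Without a circuit walk \<open>neutral\<close> would hold vacuously, so this existence is
  what makes neutrality of a sign circuit usable.\<close>

lemma sign_circuit_gain:
  assumes "sign_circuit G C"
  shows "\<exists>g. circuit_gain G C g"
  using assms unfolding sign_circuit_def
proof (elim disjE)
  assume C: "positive_circle G C"
  then have c: "circle G C" unfolding positive_circle_def by blast
  then obtain e where "e \<in> C" "ordinary_edge G e" unfolding circle_def by blast
  then have "ends G e ! 0 \<in> cover G C" using set_ends_step[of G e 0] by (auto simp: cover_def)
  then obtain p where "once_around G C (ends G e ! 0) p" using circle_once_around[OF graph c] by blast
  then show ?thesis using circuit_gain.circle[OF C] by blast
next
  assume "\<exists>e\<in>E. loose_edge G e \<and> C = {e}"
  then obtain e where "e \<in> E" "loose_edge G e" "C = {e}" by blast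
  then show ?thesis using circuit_gain.loose[of e G] by blast
next
  assume "handcuff G C"
  then obtain C1 C2 u p w where fig: "negative_figure G C1" "negative_figure G C2" "C1 \<noteq> C2"
    and con: "connecting_path G C1 C2 u p w" and C: "C = C1 \<union> walk_edges p \<union> C2"
    unfolding handcuff_def by blast
  have around: "\<exists>q. once_around G D x q" if "negative_circle G D" "x \<in> cover G D" for D x
    using circle_once_around[OF graph] that unfolding negative_circle_def by blast
  show ?thesis
  proof (cases rule: negative_figure_cases[OF fig(1)])
    case 1: 1
    obtain p1 where p1: "once_around G C1 u p1" using around[OF 1 connecting_path_cover(1)[OF con]] by blast
    show ?thesis
    proof (cases rule: negative_figure_cases[OF fig(2)])
      case 2: 1
      obtain p2 where p2: "once_around G C2 w p2" using around[OF 2 connecting_path_cover(2)[OF con]] by blast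
      show ?thesis using circuit_gain.circle_circle[OF 1 2 fig(3) con p1 p2] C by blast
    next
      case 2: (2 h v)
      \<comment> \<open>\<open>half_circle\<close> expects the half edge as the first figure, so the
        handcuff is read from its other end.\<close>
      have "connecting_path G {h} C1 w (reverse_walk p) u"
        using connecting_path_reverse[OF con] 2(4) by simp
      from circuit_gain.half_circle[OF 2(1,2) 1 this p1 refl] show ?thesis
        using C 2(4) by (metis Un_commute Un_left_commute walk_edges_reverse)
    qed
  next
    case 1: (2 h v)
    show ?thesis
    proof (cases rule: negative_figure_cases[OF fig(2)])
      case 2: 1
      obtain p2 where p2: "once_around G C2 w p2" using around[OF 2 connecting_path_cover(2)[OF con]] by blast
      show ?thesis using circuit_gain.half_circle[OF 1(1,2) 2 _ p2 refl, of u p] con C 1(4) by blast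
    next
      case 2: (2 h' v')
      show ?thesis using circuit_gain.half_half[OF 1(1,2) 2(1,2), of u p w] con C 1(4) 2(4) fig(3) by blast
    qed
  qed
qed

lemma sign_circuit_form:
  assumes "sign_circuit G C"
  obtains L where "full_form L C" "\<And>\<theta>. L (inc G \<theta>) = 0" "neutral G C \<Longrightarrow> L (gain G) = 0"
proof -
  obtain g where g: "circuit_gain G C g" using sign_circuit_gain[OF assms] by blast
  obtain L where L: "full_form L C" "\<And>\<theta>. L (inc G \<theta>) = 0" "g = L (gain G)"
    using circuit_gain_form[OF g] by blast
  show ?thesis using that[OF L(1,2)] g L(3) unfolding neutral_def by blast
qed

lemma potential_neutral:
  assumes "potential G C \<theta>"
  shows "neutral G C"
  unfolding neutral_def
proof (intro allI impI)
  fix g assume "circuit_gain G C g"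
  then obtain L where L: "full_form L C" "L (inc G \<theta>) = 0" "g = L (gain G)"
    using circuit_gain_form by blast
  obtain a where a: "\<And>\<psi>. L \<psi> = (\<Sum>e\<in>C. a e * \<psi> e)" using L(1) unfolding full_form_def by blast
  have "L (gain G) = L (inc G \<theta>)"
    unfolding a using assms by (intro sum.cong) (auto simp: potential_def)
  then show "g = 0" using L by simp
qed

lemma sign_circuit_subset: "sign_circuit G C \<Longrightarrow> C \<subseteq> E"
proof -
  assume C: "sign_circuit G C"
  have fig: "negative_figure G D \<Longrightarrow> D \<subseteq> E" for D using negative_figure_edge(1)[of D] by blast
  from C show ?thesis unfolding sign_circuit_def
  proof (elim disjE)
    assume "positive_circle G C"
    then show ?thesis unfolding positive_circle_def circle_def by blast
  next
    assume "handcuff G C"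
    then obtain C1 C2 u p w where "negative_figure G C1" "negative_figure G C2"
      "connecting_path G C1 C2 u p w" "C = C1 \<union> walk_edges p \<union> C2" unfolding handcuff_def by blast
    moreover have "walk_edges p \<subseteq> E"
      using calculation(3) walk_edges_ordinary[of G u p w] unfolding connecting_path_def by blast
    ultimately show ?thesis using fig by blast
  qed blast
qed

lemma full_form_eq_0:
  assumes "full_form L C" "finite C" "e \<in> C" "L \<psi> = 0" "\<And>f. f \<in> C - {e} \<Longrightarrow> \<psi> f = 0"
  shows "\<psi> e = 0"
proof -
  obtain a where a: "a e \<noteq> 0" "L \<psi> = (\<Sum>e\<in>C. a e * \<psi> e)"
    using assms(1,3) unfolding full_form_def by blast
  have "L \<psi> = a e * \<psi> e + (\<Sum>f\<in>C - {e}. a f * \<psi> f)" unfolding a(2) by (rule sum.remove[OF assms(2,3)])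
  also have "(\<Sum>f\<in>C - {e}. a f * \<psi> f) = 0" using assms(5) by (intro sum.neutral) auto
  finally show ?thesis using assms(4) a(1) by simp
qed

lemma full_form_diff: "full_form L C \<Longrightarrow> L (\<lambda>e. \<psi> e - \<phi> e) = L \<psi> - L \<phi>"
  unfolding full_form_def by (auto simp: sum_subtractf right_diff_distrib)

lemma sign_circuit_dependent:
  assumes C: "sign_circuit G C" "e \<in> C" and "nullv G (C - {e}) \<theta>"
  shows "inc G \<theta> e = 0"
proof -
  obtain L where L: "full_form L C" "\<And>\<theta>. L (inc G \<theta>) = 0" using sign_circuit_form[OF C(1)] by blast
  have "finite C" using sign_circuit_subset[OF C(1)] finite_edges finite_subset by blast
  then show ?thesis using assms(3) by (intro full_form_eq_0[OF L(1) _ C(2) L(2)]) (auto simp: nullv_def)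
qed

lemma neutral_circuit_potential:
  assumes C: "sign_circuit G C" "neutral G C" "e \<in> C" and "potential G (C - {e}) \<theta>"
  shows "gain G e = inc G \<theta> e"
proof -
  obtain L where L: "full_form L C" "\<And>\<theta>. L (inc G \<theta>) = 0" "L (gain G) = 0"
    using sign_circuit_form[OF C(1)] C(2) by blast
  have "finite C" using sign_circuit_subset[OF C(1)] finite_edges finite_subset by blast
  moreover have "L (\<lambda>e. gain G e - inc G \<theta> e) = 0" using full_form_diff[OF L(1)] L(2,3) by simp
  ultimately have "gain G e - inc G \<theta> e = 0"
    using assms(4) full_form_eq_0[OF L(1) _ C(3), of "\<lambda>e. gain G e - inc G \<theta> e"]
    by (simp add: potential_def)
  then show ?thesis by simp
qed

end

section \<open>Paths closed up at both ends\<close>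

lemma in_set_slice:
  "x \<in> set (drop a (take b xs)) \<longleftrightarrow> (\<exists>j. a \<le> j \<and> j < b \<and> j < length xs \<and> x = xs ! j)"
proof
  assume "x \<in> set (drop a (take b xs))"
  then obtain i where i: "i < length (drop a (take b xs))" "x = drop a (take b xs) ! i"
    unfolding in_set_conv_nth by metis
  have "x = take b xs ! (a + i)" unfolding i(2) by (rule nth_drop) (use i(1) in auto)
  with i(1) show "\<exists>j. a \<le> j \<and> j < b \<and> j < length xs \<and> x = xs ! j" by (intro exI[of _ "a + i"]) auto
next
  assume "\<exists>j. a \<le> j \<and> j < b \<and> j < length xs \<and> x = xs ! j"
  then obtain j where "a \<le> j" "j < b" "j < length xs" "x = xs ! j" by blast
  then show "x \<in> set (drop a (take b xs))"
    unfolding in_set_conv_nth by (intro exI[of _ "j - a"]) auto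
qed

context gain_graph
begin

lemma other_end:
  assumes "ordinary_edge G e" "v \<in> set (ends G e)"
  obtains i where "i < 2" "ends G e ! i = v" "set (ends G e) = {v, ends G e ! (1 - i)}"
proof -
  have "v = ends G e ! 0 \<or> v = ends G e ! 1" using set_ends_step[OF assms(1), of 0] assms(2) by auto
  then show ?thesis using that[of 0] that[of 1] set_ends_step[OF assms(1), of 0] set_ends_step[OF assms(1), of 1]
    by auto
qed

text \<open>The index \<open>k\<close> is the position where \<open>g\<close> returns to the path,
  so \<open>g\<close> and the segment of \<open>p\<close> from \<open>k\<close> on form the figure.
  A half edge or a loop at \<open>w\<close> gives \<open>k = length p\<close> with an empty
  segment.\<close>

lemma end_figure:
  assumes p: "walk G u p w" "distinct (walk_verts G u p)"
    and g: "g \<in> E" "g \<notin> walk_edges p" "w \<in> set (ends G g)" "set (ends G g) \<subseteq> set (walk_verts G u p)"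
  obtains k where "k \<le> length p"
    "cover G (insert g (walk_edges (drop k p))) = set (drop k (walk_verts G u p))"
    "half_edge G g \<and> k = length p \<or>
      circle G (insert g (walk_edges (drop k p))) \<and> (\<exists>i. walk G w [(g, i)] (walk_verts G u p ! k))"
proof (cases rule: edge_kinds[OF g(1)])
  case 1
  then show ?thesis using g(3) by (simp add: loose_edge_def)
next
  case (2 v)
  have "drop (length p) (walk_verts G u p) = [walk_verts G u p ! length p]"
    by (simp add: Cons_nth_drop_Suc[symmetric])
  moreover have "walk_verts G u p ! length p = w"
    using last_walk_verts[OF p(1)] by (simp add: last_conv_nth)
  ultimately show ?thesis using 2 g(3) by (intro that[of "length p"]) (auto simp: cover_def)
next
  case 3
  obtain i where i: "i < 2" "ends G g ! i = w" "set (ends G g) = {w, ends G g ! (1 - i)}"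
    using other_end[OF 3 g(3)] by blast
  let ?x = "ends G g ! (1 - i)"
  have "?x \<in> set (walk_verts G u p)" using i(3) g(4) by blast
  then obtain k where "k < length (walk_verts G u p)" and k: "walk_verts G u p ! k = ?x"
    unfolding in_set_conv_nth by blast
  then have kl: "k \<le> length p" by simp
  let ?q = "drop k p"
  have q: "walk G ?x ?q w" using walk_take_drop(2)[OF p(1) kl] k by simp
  have qv: "walk_verts G ?x ?q = drop k (walk_verts G u p)" using walk_verts_drop[OF kl, of G u] k by simp
  have cl: "walk G w [(g, i)] ?x" using i g(1) 3 by simp
  have "g \<notin> walk_edges ?q" using g(2) set_drop_subset[of k p] unfolding walk_edges_def by blast
  then have C: "circle G (insert g (walk_edges ?q))"
    using path_close_circle[OF q _ cl] p(2) unfolding qv by simp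
  have "cover G (insert g (walk_edges ?q)) = set (ends G g) \<union> cover G (walk_edges ?q)"
    by (auto simp: cover_def)
  also have "\<dots> = set (walk_verts G ?x ?q)"
  proof (cases "?q = []")
    case True
    then show ?thesis using q i(3) unfolding True by (auto simp: cover_def)
  next
    case False
    then show ?thesis using cover_walk_edges[OF q False] end_in_walk_verts[OF q] i(3) by auto
  qed
  finally show ?thesis using that[OF kl] C cl k qv by metis
qed

text \<open>The mirror image of \<open>end_figure\<close>, obtained from the reversed path; position
  \<open>k\<close> there is position \<open>length p - k\<close> here.\<close>

lemma start_figure:
  assumes p: "walk G u p w" "distinct (walk_verts G u p)"
    and g: "g \<in> E" "g \<notin> walk_edges p" "u \<in> set (ends G g)" "set (ends G g) \<subseteq> set (walk_verts G u p)"
  obtains m where "m \<le> length p"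
    "cover G (insert g (walk_edges (take m p))) = set (take (Suc m) (walk_verts G u p))"
    "half_edge G g \<and> m = 0 \<or>
      circle G (insert g (walk_edges (take m p))) \<and> (\<exists>i. walk G u [(g, i)] (walk_verts G u p ! m))"
proof -
  have r: "walk G w (reverse_walk p) u" "walk_verts G w (reverse_walk p) = rev (walk_verts G u p)"
    using walk_reverse[OF p(1)] walk_verts_reverse[OF p(1)] by auto
  have "distinct (walk_verts G w (reverse_walk p))" "g \<notin> walk_edges (reverse_walk p)"
    "set (ends G g) \<subseteq> set (walk_verts G w (reverse_walk p))"
    using p(2) g(2,4) r(2) by auto
  then obtain k where k: "k \<le> length p"
    "cover G (insert g (walk_edges (drop k (reverse_walk p)))) = set (drop k (rev (walk_verts G u p)))"
    "half_edge G g \<and> k = length p \<or>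
      circle G (insert g (walk_edges (drop k (reverse_walk p)))) \<and> (\<exists>i. walk G u [(g, i)] (rev (walk_verts G u p) ! k))"
    using end_figure[OF r(1) _ g(1) _ g(3)] unfolding r(2) by auto
  let ?m = "length p - k"
  have "walk_edges (drop k (reverse_walk p)) = walk_edges (take ?m p)"
    unfolding reverse_walk_def walk_edges_def by (simp add: drop_rev take_map image_image case_prod_unfold)
  moreover have "set (drop k (rev (walk_verts G u p))) = set (take (Suc ?m) (walk_verts G u p))"
    using k(1) by (simp add: drop_rev Suc_diff_le)
  moreover have "rev (walk_verts G u p) ! k = walk_verts G u p ! ?m"
    using k(1) by (simp add: rev_nth)
  ultimately show ?thesis using k by (intro that[of ?m]) auto
qed

text \<open>The edge \<open>h\<close> closes the initial segment up to \<open>m\<close>, the edge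
  \<open>g\<close> the final segment from \<open>k\<close>. If a resulting circle is positive, it is
  the sign circuit. Otherwise both figures are negative. For \<open>m \<le> k\<close> they are
  joined by the segment from \<open>m\<close> to \<open>k\<close> to a handcuff. For
  \<open>k < m\<close> they are circles overlapping in a segment, and the third circle of this theta
  graph is positive.\<close>

lemma two_end_edges_circuit:
  assumes p: "walk G u p w" "distinct (walk_verts G u p)"
    and g: "g \<in> E" "g \<notin> walk_edges p" "w \<in> set (ends G g)" "set (ends G g) \<subseteq> set (walk_verts G u p)"
    and h: "h \<in> E" "h \<notin> walk_edges p" "u \<in> set (ends G h)" "set (ends G h) \<subseteq> set (walk_verts G u p)"
    and gh: "g \<noteq> h"
  shows "\<exists>C. sign_circuit G C \<and> C \<subseteq> insert g (insert h (walk_edges p))"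
proof -
  let ?V = "walk_verts G u p"
  obtain k where k: "k \<le> length p"
    "cover G (insert g (walk_edges (drop k p))) = set (drop k ?V)"
    "half_edge G g \<and> k = length p \<or>
      circle G (insert g (walk_edges (drop k p))) \<and> (\<exists>i. walk G w [(g, i)] (?V ! k))"
    by (rule end_figure[OF p g])
  obtain m where m: "m \<le> length p"
    "cover G (insert h (walk_edges (take m p))) = set (take (Suc m) ?V)"
    "half_edge G h \<and> m = 0 \<or>
      circle G (insert h (walk_edges (take m p))) \<and> (\<exists>i. walk G u [(h, i)] (?V ! m))"
    by (rule start_figure[OF p h])
  let ?C1 = "insert h (walk_edges (take m p))" and ?C2 = "insert g (walk_edges (drop k p))"
  have sub: "walk_edges (take j p) \<subseteq> walk_edges p" "walk_edges (drop j p) \<subseteq> walk_edges p" for j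
    using set_take_subset[of j p] set_drop_subset[of j p] unfolding walk_edges_def by blast+
  have de: "distinct (map fst p)" by (rule path_distinct_edges[OF p])
  have sign: "circle G C \<Longrightarrow> (\<Prod>e\<in>C. esign G e) = 1 \<or> (\<Prod>e\<in>C. esign G e) = -1" for C
  proof -
    have "(\<Prod>e\<in>A. esign G e) = 1 \<or> (\<Prod>e\<in>A. esign G e) = -1" if "A \<subseteq> E" for A
      using finite_subset[OF that finite_edges] that
      by (induction A rule: finite_induct) (use esign_cases in fastforce)+
    then show "circle G C \<Longrightarrow> (\<Prod>e\<in>C. esign G e) = 1 \<or> (\<Prod>e\<in>C. esign G e) = -1"
      unfolding circle_def by blast
  qed
  show ?thesis
  proof (cases "positive_circle G ?C1 \<or> positive_circle G ?C2")
    case True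
    then show ?thesis using sub unfolding sign_circuit_def by blast
  next
    case False
    have neg1: "circle G ?C1 \<Longrightarrow> negative_circle G ?C1" and neg2: "circle G ?C2 \<Longrightarrow> negative_circle G ?C2"
      using False sign[of ?C1] sign[of ?C2] unfolding positive_circle_def negative_circle_def by blast+
    show ?thesis
    proof (cases "m \<le> k")
      case True
      have fig: "negative_figure G ?C1" "negative_figure G ?C2"
        using m(3) k(3) neg1 neg2 g(1) h(1) unfolding negative_figure_def by auto
      let ?r = "drop m (take k p)"
      have r: "walk G (?V ! m) ?r (?V ! k)"
        using walk_take_drop(2)[OF walk_take_drop(1)[OF p(1) k(1)], of m] True k(1)
        by (simp add: walk_verts_take)
      have rv: "walk_verts G (?V ! m) ?r = drop m (take (Suc k) ?V)"
        using walk_verts_drop[of m "take k p" G u] True k(1) by (simp add: walk_verts_take)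
      have idx: "x \<in> set (take (Suc m) ?V) \<longleftrightarrow> (\<exists>j\<le>m. x = ?V ! j)"
        "x \<in> set (drop k ?V) \<longleftrightarrow> (\<exists>j. k \<le> j \<and> j \<le> length p \<and> x = ?V ! j)"
        "x \<in> set (drop m (take (Suc k) ?V)) \<longleftrightarrow> (\<exists>j. m \<le> j \<and> j \<le> k \<and> x = ?V ! j)" for x
      proof -
        show "x \<in> set (take (Suc m) ?V) \<longleftrightarrow> (\<exists>j\<le>m. x = ?V ! j)"
          using in_set_slice[of x 0 "Suc m" ?V] m(1) by (auto simp: less_Suc_eq_le)
        show "x \<in> set (drop k ?V) \<longleftrightarrow> (\<exists>j. k \<le> j \<and> j \<le> length p \<and> x = ?V ! j)"
          using in_set_slice[of x k "Suc (length p)" ?V] by (auto simp: less_Suc_eq_le)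
        show "x \<in> set (drop m (take (Suc k) ?V)) \<longleftrightarrow> (\<exists>j. m \<le> j \<and> j \<le> k \<and> x = ?V ! j)"
          using in_set_slice[of x m "Suc k" ?V] k(1) by (auto simp: less_Suc_eq_le)
      qed
      have inj: "?V ! i = ?V ! j \<longleftrightarrow> i = j" if "i \<le> length p" "j \<le> length p" for i j
        using nth_eq_iff_index_eq[OF p(2), of i j] that by simp
      have "connecting_path G ?C1 ?C2 (?V ! m) ?r (?V ! k)"
        unfolding connecting_path_def rv m(2) k(2)
      proof (intro conjI)
        show "walk G (?V ! m) ?r (?V ! k)" by (rule r)
        show "distinct (drop m (take (Suc k) ?V))" using p(2) by simp
        show "set (take (Suc m) ?V) \<inter> set (drop m (take (Suc k) ?V)) = {?V ! m}"
        proof (intro set_eqI iffI)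
          fix x assume "x \<in> set (take (Suc m) ?V) \<inter> set (drop m (take (Suc k) ?V))"
          then obtain i j where "i \<le> m" "x = ?V ! i" "m \<le> j" "j \<le> k" "x = ?V ! j" unfolding Int_iff idx by blast
          then show "x \<in> {?V ! m}" using inj[of i j] k(1) m(1) by auto
        next
          fix x assume "x \<in> {?V ! m}"
          then show "x \<in> set (take (Suc m) ?V) \<inter> set (drop m (take (Suc k) ?V))"
            unfolding Int_iff idx using True by blast
        qed
        show "set (drop k ?V) \<inter> set (drop m (take (Suc k) ?V)) = {?V ! k}"
        proof (intro set_eqI iffI)
          fix x assume "x \<in> set (drop k ?V) \<inter> set (drop m (take (Suc k) ?V))"
          then obtain i j where "k \<le> i" "i \<le> length p" "x = ?V ! i" "m \<le> j" "j \<le> k" "x = ?V ! j"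
            unfolding Int_iff idx by blast
          then show "x \<in> {?V ! k}" using inj[of i j] k(1) m(1) by auto
        next
          fix x assume "x \<in> {?V ! k}"
          then show "x \<in> set (drop k ?V) \<inter> set (drop m (take (Suc k) ?V))"
            unfolding Int_iff idx using True k(1) by blast
        qed
        have rn: "?r = [] \<longleftrightarrow> m = k" using True k(1) by auto
        show "set (take (Suc m) ?V) \<inter> set (drop k ?V) = (if ?r = [] then {?V ! m} else {})"
        proof (intro set_eqI iffI)
          fix x assume "x \<in> set (take (Suc m) ?V) \<inter> set (drop k ?V)"
          then obtain i j where ij: "k \<le> i" "i \<le> length p" "x = ?V ! i" "j \<le> m" "x = ?V ! j"
            unfolding Int_iff idx by blast
          then have "i = j" using inj[of i j] m(1) by auto
          then have "i = m" "m = k" using ij True by auto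
          then show "x \<in> (if ?r = [] then {?V ! m} else {})" using ij rn by simp
        next
          fix x assume "x \<in> (if ?r = [] then {?V ! m} else {})"
          then have "m = k" "x = ?V ! m" using rn by (auto split: if_splits)
          then show "x \<in> set (take (Suc m) ?V) \<inter> set (drop k ?V)"
            unfolding Int_iff idx using m(1) by blast
        qed
      qed
      moreover have "?C1 \<noteq> ?C2" using gh g(2) sub by blast
      ultimately have "handcuff G (?C1 \<union> walk_edges ?r \<union> ?C2)"
        unfolding handcuff_def using fig by blast
      moreover have "walk_edges ?r \<subseteq> walk_edges p"
        using set_take_subset[of k p] set_drop_subset[of m "take k p"] unfolding walk_edges_def by blast
      ultimately show ?thesis using sub unfolding sign_circuit_def by blast
    next
      case False
      then have km: "k < m" by simp
      obtain i j where c1: "circle G ?C1" and j: "walk G u [(h, j)] (?V ! m)"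
        and c2: "circle G ?C2" and i: "walk G w [(g, i)] (?V ! k)"
        using m k km by auto
      \<comment> \<open>From position \<open>k\<close> back to \<open>u\<close>, across
        \<open>h\<close> to position \<open>m\<close>, and on to \<open>w\<close>: all of
        \<open>p\<close> except the overlap, to be closed by \<open>g\<close>.\<close>
      let ?P = "reverse_walk (take k p) @ [(h, j)] @ drop m p"
      have t: "walk G u (take k p) (?V ! k)" by (rule walk_take_drop(1)[OF p(1) k(1)])
      have d: "walk G (?V ! m) (drop m p) w" by (rule walk_take_drop(2)[OF p(1) m(1)])
      have P: "walk G (?V ! k) ?P w"
        using walk_reverse[OF t] j d unfolding walk_append by blast
      have "walk_verts G (?V ! k) ?P = rev (take (Suc k) ?V) @ drop m ?V"
      proof -
        have "walk_verts G u ([(h, j)] @ drop m p) = [u, ?V ! m] @ tl (drop m ?V)"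
          using walk_verts_append[OF j, of "drop m p"] walk_verts_drop[OF m(1), of G u] j by auto
        moreover have "drop m ?V = ?V ! m # tl (drop m ?V)"
          using m(1) by (simp add: Cons_nth_drop_Suc[symmetric])
        ultimately have "tl (walk_verts G u ([(h, j)] @ drop m p)) = drop m ?V" by simp
        then show ?thesis
          using walk_verts_append[OF walk_reverse[OF t], of "[(h, j)] @ drop m p"] walk_verts_reverse[OF t]
          by (simp add: walk_verts_take)
      qed
      moreover have "set (take (Suc k) ?V) \<inter> set (drop m ?V) = {}"
        using p(2) km by (simp add: set_take_disj_set_drop_if_distinct)
      ultimately have dP: "distinct (walk_verts G (?V ! k) ?P)" using p(2) by simp
      have gP: "g \<notin> walk_edges ?P" using gh g(2) sub by auto
      have C: "circle G (insert g (walk_edges ?P))" by (rule path_close_circle[OF P dP i gP])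
      let ?mid = "drop k (take m p)"
      have split1: "take m p = take k p @ ?mid" using km
        by (metis append_take_drop_id less_imp_le min.absorb1 take_take)
      have split2: "drop k p = ?mid @ drop m p" using km
        by (metis append_take_drop_id drop_append drop_take length_take min.absorb2 m(1) diff_is_0_eq' drop_0 less_imp_le)
      have s1: "walk_sign G (take m p) = walk_sign G (take k p) * walk_sign G ?mid"
        by (metis split1 walk_sign_simps(3))
      have s2: "walk_sign G (drop k p) = walk_sign G ?mid * walk_sign G (drop m p)"
        by (metis split2 walk_sign_simps(3))
      have prodC: "(\<Prod>e\<in>insert f (walk_edges q). esign G e) = esign G f * walk_sign G q"
        if "f \<notin> walk_edges q" "distinct (map fst q)" for f q
        using walk_sign_prod[OF that(2), of G] that(1) by simp
      have dt: "distinct (map fst (take m p))" "distinct (map fst (drop k p))"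
        using de by (simp_all flip: take_map drop_map)
      have 1: "esign G h * walk_sign G (take m p) = -1"
        using neg1[OF c1] prodC[OF _ dt(1), of h] sub(1)[of m] h(2) unfolding negative_circle_def
        by (metis subsetD)
      have 2: "esign G g * walk_sign G (drop k p) = -1"
        using neg2[OF c2] prodC[OF _ dt(2), of g] sub(2)[of k] g(2) unfolding negative_circle_def
        by (metis subsetD)
      have "walk G (?V ! k) ?mid (?V ! m)"
        using walk_take_drop(2)[OF walk_take_drop(1)[OF p(1) m(1)], of k] km m(1)
        by (simp add: walk_verts_take)
      then have mid: "walk_sign G ?mid * walk_sign G ?mid = 1" using walk_sign_cases by fastforce
      \<comment> \<open>In the product of the two negative signs the overlap \<open>?mid\<close>
        occurs twice and cancels.\<close>
      have "1 = (esign G h * walk_sign G (take m p)) * (esign G g * walk_sign G (drop k p))"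
        unfolding 1 2 by simp
      also have "\<dots> = (esign G g * (walk_sign G (take k p) * (esign G h * walk_sign G (drop m p)))) * (walk_sign G ?mid * walk_sign G ?mid)"
        unfolding s1 s2 by (simp add: mult_ac)
      also have "\<dots> = esign G g * walk_sign G ?P" unfolding mid by simp
      also have "\<dots> = (\<Prod>e\<in>insert g (walk_edges ?P). esign G e)"
        by (rule prodC[symmetric, OF gP path_distinct_edges[OF P dP]])
      finally have "positive_circle G (insert g (walk_edges ?P))" using C unfolding positive_circle_def by simp
      moreover have "insert g (walk_edges ?P) \<subseteq> insert g (insert h (walk_edges p))"
        using sub by auto
      ultimately show ?thesis unfolding sign_circuit_def by blast
    qed
  qed
qed

end

section \<open>Potentials\<close>

lemma path_closed_empty:
  assumes "walk G u p u" "distinct (walk_verts G u p)"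
  shows "p = []"
proof -
  have "walk_verts G u p ! 0 = u" by (simp add: walk_verts_def)
  moreover have "walk_verts G u p ! length p = u"
    using last_walk_verts[OF assms(1)] by (simp add: last_conv_nth)
  ultimately have "0 = length p" using nth_eq_iff_index_eq[OF assms(2), of 0 "length p"] by simp
  then show ?thesis by simp
qed

context gain_graph
begin

lemma one_neq_minus_one: "(1::'k) \<noteq> - 1"
  using char_not_2 by (metis add.right_inverse one_add_one)

lemma inc_cong: "(\<And>v. v \<in> set (ends G e) \<Longrightarrow> \<theta> v = \<theta>' v) \<Longrightarrow> inc G \<theta> e = inc G \<theta>' e"
  unfolding inc_def by (intro sum.cong) auto

lemma inc_zero: "(\<And>v. v \<in> set (ends G e) \<Longrightarrow> \<theta> v = 0) \<Longrightarrow> inc G \<theta> e = 0"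
  unfolding inc_def by (intro sum.neutral) auto

lemma inc_linear: "inc G (\<lambda>v. a * \<theta> v + b * \<theta>' v) e = a * inc G \<theta> e + b * inc G \<theta>' e"
  unfolding inc_def by (simp add: sum.distrib sum_distrib_left algebra_simps)

lemma inc_scale: "inc G (\<lambda>v. a * \<theta> v) e = a * inc G \<theta> e"
  using inc_linear[of a \<theta> 0 \<theta> e] by simp

lemma inc_add: "inc G (\<lambda>v. \<theta> v + \<theta>' v) e = inc G \<theta> e + inc G \<theta>' e"
  using inc_linear[of 1 \<theta> 1 \<theta>' e] by simp

lemma inc_diff: "inc G (\<lambda>v. \<theta> v - \<theta>' v) e = inc G \<theta> e - inc G \<theta>' e"
  using inc_linear[of 1 \<theta> "-1" \<theta>' e] by simp

text \<open>Propagate the value 1 from \<open>u\<close> along the path. In the induction the vector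
  of the remaining path is scaled by the sign of the first edge, which satisfies that edge and
  preserves the others because \<open>u\<close> is not revisited.\<close>

lemma path_null_vector:
  assumes "walk G u p w" "distinct (walk_verts G u p)"
  shows "\<exists>\<theta>. \<theta> u = 1 \<and> \<theta> w = of_int (walk_sign G p) \<and> (\<forall>x. x \<notin> set (walk_verts G u p) \<longrightarrow> \<theta> x = 0) \<and>
    nullv G (walk_edges p) \<theta>"
  using assms
proof (induction rule: walk_induct)
  case Nil
  then show ?case by (intro exI[of _ "\<lambda>x. if x = w then 1 else 0"]) (simp add: nullv_def)
next
  case (Cons u e i p)
  let ?v = "ends G e ! (1 - i)"
  note w = Cons.hyps(5) and i = Cons.hyps(3,4,2,1)
  have nu: "u \<notin> set (walk_verts G ?v p)" and dv: "distinct (walk_verts G ?v p)"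
    using Cons.prems(1) by auto
  obtain \<theta> where th: "\<theta> ?v = 1" "\<theta> w = of_int (walk_sign G p)"
    "\<And>x. x \<notin> set (walk_verts G ?v p) \<Longrightarrow> \<theta> x = 0" "nullv G (walk_edges p) \<theta>"
    using Cons.IH[OF dv] by blast
  define s where "s = (of_int (esign G e) :: 'k)"
  let ?t = "\<lambda>x. if x = u then 1 else s * \<theta> x"
  have "inc G ?t f = 0" if f: "f \<in> walk_edges p" for f
  proof -
    have "inc G ?t f = inc G (\<lambda>x. s * \<theta> x) f"
      using ends_subset_walk_verts[OF w f] nu by (intro inc_cong) auto
    then show ?thesis using th(4) f unfolding inc_scale nullv_def by simp
  qed
  moreover have "inc G ?t e = 0"
    using nu th(1) i(4) start_in_walk_verts[of ?v G p] unfolding inc_step_eq_0[OF i(4,3,1)] i(2) s_def by auto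
  ultimately have "nullv G (walk_edges ((e, i) # p)) ?t" unfolding nullv_def by auto
  moreover have "w \<noteq> u" using nu end_in_walk_verts[OF w] by auto
  ultimately show ?case using th(2,3) by (intro exI[of _ ?t]) (auto simp: s_def)
qed

text \<open>The end \<open>w\<close> of the path meets no other edge of \<open>S\<close>, so the last edge of the path is not in the
  span of the others: test with the indicator of \<open>w\<close>.\<close>

lemma path_end_coloop:
  assumes p: "walk G u p w" "distinct (walk_verts G u p)" "walk_edges p \<subseteq> S"
    and S: "S \<subseteq> E" "w \<in> cover G S"
    and no: "\<And>g. g \<in> S \<Longrightarrow> w \<in> set (ends G g) \<Longrightarrow> g \<in> walk_edges p"
  shows "\<exists>f\<in>S. \<exists>\<theta>. nullv G (S - {f}) \<theta> \<and> inc G \<theta> f \<noteq> 0"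
proof -
  have "p \<noteq> []" using S(2) no by (auto simp: cover_def)
  then obtain q f i where q: "p = q @ [(f, i)]" by (metis rev_exhaust surj_pair)
  let ?x = "ends G f ! i"
  have w: "walk G u q ?x" and f: "f \<in> E" "ordinary_edge G f" "i < 2" "w = ends G f ! (1 - i)"
    using p(1) unfolding q walk_snoc by blast+
  have "walk G ?x [(f, i)] w" using f by simp
  then have "walk_verts G u p = walk_verts G u q @ [w]"
    unfolding q walk_verts_append[OF w] by (auto simp: f(4))
  then have wq: "w \<notin> set (walk_verts G u q)" using p(2) by auto
  let ?t = "\<lambda>v. if v = w then 1 else 0 :: 'k"
  have "nullv G (S - {f}) ?t" unfolding nullv_def
  proof
    fix e assume e: "e \<in> S - {f}"
    have "w \<notin> set (ends G e)"
    proof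
      assume we: "w \<in> set (ends G e)"
      then have "e \<in> walk_edges q" using no[of e] e unfolding q by auto
      then show False using ends_subset_walk_verts[OF w] we wq by blast
    qed
    then show "inc G ?t e = 0" by (intro inc_zero) auto
  qed
  moreover have "?x \<noteq> w" using wq end_in_walk_verts[OF w] by auto
  then have "inc G ?t f \<noteq> 0" unfolding inc_step_eq_0[OF f(1-3)] f(4)[symmetric] using esign_cases[OF f(1)] by auto
  moreover have "f \<in> S" using p(3) unfolding q by simp
  ultimately show ?thesis by blast
qed

text \<open>A longest path in \<open>S\<close> has a further edge of \<open>S\<close> at either end. If two different such edges can be
  chosen, they close up to a sign circuit. Otherwise a single edge closes the path to a negative circle
  (or is a half edge at a one-vertex path), and either this circle is isolated in \<open>S\<close>, or
  the path can be rotated so that another edge appears at its end.\<close>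

lemma circuit_free_coloop:
  assumes S: "S \<subseteq> E" "S \<noteq> {}" and free: "\<And>C. C \<subseteq> S \<Longrightarrow> \<not> sign_circuit G C"
  shows "\<exists>f\<in>S. \<exists>\<theta>. nullv G (S - {f}) \<theta> \<and> inc G \<theta> f \<noteq> 0"
proof (rule ccontr)
  assume nocoloop: "\<not> ?thesis"
  have finS: "finite S" using S(1) finite_edges finite_subset by blast
  \<comment> \<open>Maximality ranges over paths with arbitrary ends, hence the triples. The
    \<open>cover\<close> condition constrains only one-vertex paths, where it provides an edge of
    \<open>S\<close> at the vertex.\<close>
  define Q where "Q x \<longleftrightarrow> (case x of (u, p, w) \<Rightarrow> walk G u p w \<and> distinct (walk_verts G u p) \<and>
     walk_edges p \<subseteq> S \<and> set (walk_verts G u p) \<subseteq> cover G S)" for x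
  obtain e where e: "e \<in> S" using S(2) by blast
  have "\<not> loose_edge G e" using free[of "{e}"] e S(1) unfolding sign_circuit_def by blast
  then obtain v where "v \<in> set (ends G e)" unfolding loose_edge_def by (cases "ends G e") auto
  then have "Q (v, [], v)" using e unfolding Q_def cover_def by auto
  moreover have "\<forall>x. Q x \<longrightarrow> length (fst (snd x)) < Suc (card S)"
  proof (intro allI impI)
    fix x assume "Q x"
    then obtain u p w where x: "x = (u, p, w)" and p: "walk G u p w" "distinct (walk_verts G u p)" "walk_edges p \<subseteq> S"
      unfolding Q_def by (cases x) auto
    show "length (fst (snd x)) < Suc (card S)"
      using distinct_card[OF path_distinct_edges[OF p(1,2)]] card_mono[OF finS p(3)]
      by (simp add: x walk_edges_def)
  qed
  ultimately obtain x where "Q x" and max: "\<And>y. Q y \<Longrightarrow> length (fst (snd y)) \<le> length (fst (snd x))"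
    using ex_has_greatest_nat[of Q _ "\<lambda>x. length (fst (snd x))" "Suc (card S)"] by blast
  then obtain u p w where x: "x = (u, p, w)" and Qp: "Q (u, p, w)" by (cases x) auto
  have max: "length q \<le> length p" if "Q (a, q, b)" for a q b using max[OF that] by (simp add: x)
  \<comment> \<open>Stated for every path of maximal length, since the rotated path below needs it
    too: an edge of \<open>S\<close> leaving the path at its end would extend it.\<close>
  have stay: "set (ends G g) \<subseteq> set (walk_verts G a q)"
    if q: "Q (a, q, b)" "length q = length p" and g: "g \<in> S" "b \<in> set (ends G g)" for a q b g
  proof (rule ccontr)
    assume nsub: "\<not> set (ends G g) \<subseteq> set (walk_verts G a q)"
    have q': "walk G a q b" "distinct (walk_verts G a q)" "walk_edges q \<subseteq> S" "set (walk_verts G a q) \<subseteq> cover G S"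
      using q(1) unfolding Q_def by auto
    have b: "b \<in> set (walk_verts G a q)" by (rule end_in_walk_verts[OF q'(1)])
    have "ordinary_edge G g"
    proof (cases rule: edge_kinds[OF subsetD[OF S(1) g(1)]])
      case 1
      then show ?thesis using g(2) by (simp add: loose_edge_def)
    next
      case (2 v)
      then show ?thesis using g(2) b nsub by simp
    qed
    then obtain i where i: "i < 2" "ends G g ! i = b" "set (ends G g) = {b, ends G g ! (1 - i)}"
      using other_end g(2) by blast
    let ?y = "ends G g ! (1 - i)"
    have y: "?y \<notin> set (walk_verts G a q)" using i(3) nsub b by auto
    have w1: "walk G b [(g, i)] ?y" using i g(1) S(1) \<open>ordinary_edge G g\<close> by auto
    have "walk G a (q @ [(g, i)]) ?y" using q'(1) w1 unfolding walk_append by blast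
    moreover have "walk_verts G a (q @ [(g, i)]) = walk_verts G a q @ [?y]"
      unfolding walk_verts_append[OF q'(1)] by (simp add: i(2))
    moreover have "?y \<in> cover G S" using g(1) i(3) unfolding cover_def by blast
    ultimately have "Q (a, q @ [(g, i)], ?y)" unfolding Q_def using q' y g(1) by auto
    then show False using max q(2) by fastforce
  qed
  have rev: "Q (b, reverse_walk q, a)" if "Q (a, q, b)" for a q b
    using that walk_reverse[of G a q b] walk_verts_reverse[of G a q b] unfolding Q_def by auto
  have stay': "set (ends G g) \<subseteq> set (walk_verts G a q)"
    if q: "Q (a, q, b)" "length q = length p" and g: "g \<in> S" "a \<in> set (ends G g)" for a q b g
  proof -
    have "set (ends G g) \<subseteq> set (walk_verts G b (reverse_walk q))"
      using stay[OF rev[OF q(1)]] q(2) g by simp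
    moreover have "walk_verts G b (reverse_walk q) = rev (walk_verts G a q)"
      using q(1) walk_verts_reverse[of G a q b] unfolding Q_def by auto
    ultimately show ?thesis by simp
  qed
  have no_two: "g = h"
    if q: "Q (a, q, b)" "length q = length p" and g: "g \<in> S" "g \<notin> walk_edges q" "b \<in> set (ends G g)"
      and h: "h \<in> S" "h \<notin> walk_edges q" "a \<in> set (ends G h)" for a q b g h
  proof (rule ccontr)
    assume "g \<noteq> h"
    have q': "walk G a q b" "distinct (walk_verts G a q)" "walk_edges q \<subseteq> S" using q(1) unfolding Q_def by auto
    have "\<exists>C. sign_circuit G C \<and> C \<subseteq> insert g (insert h (walk_edges q))"
      using \<open>g \<noteq> h\<close> g h S(1) stay[OF q g(1,3)] stay'[OF q h(1,3)]
      by (intro two_end_edges_circuit[OF q'(1,2)]) auto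
    then show False using free g(1) h(1) q'(3) by blast
  qed
  have p: "walk G u p w" "distinct (walk_verts G u p)" "walk_edges p \<subseteq> S" "set (walk_verts G u p) \<subseteq> cover G S"
    using Qp unfolding Q_def by auto
  have end_edge: "\<exists>g\<in>S. g \<notin> walk_edges q \<and> b \<in> set (ends G g)" if q: "Q (a, q, b)" for a q b
  proof -
    have q': "walk G a q b" "distinct (walk_verts G a q)" "walk_edges q \<subseteq> S" "set (walk_verts G a q) \<subseteq> cover G S"
      using q(1) unfolding Q_def by auto
    show ?thesis using path_end_coloop[OF q'(1-3) S(1)] nocoloop q'(4) end_in_walk_verts[OF q'(1)] by blast
  qed
  obtain g where g: "g \<in> S" "g \<notin> walk_edges p" "w \<in> set (ends G g)" using end_edge[OF Qp] by blast
  obtain g' where g': "g' \<in> S" "g' \<notin> walk_edges p" "u \<in> set (ends G g')"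
    using end_edge[OF rev[OF Qp]] by auto
  have "g' = g" using no_two[OF Qp refl g g'] by simp
  then have gu: "u \<in> set (ends G g)" using g' by simp
  have only_w: "h = g" if "h \<in> S" "h \<notin> walk_edges p" "w \<in> set (ends G h)" for h
    using no_two[OF Qp refl that] g gu by blast
  have gE: "g \<in> E" using g S(1) by blast
  \<comment> \<open>The same edge \<open>g\<close> lies at both ends of the path, so it leads from
    \<open>w\<close> back to \<open>u\<close> or is a half edge at a single vertex.\<close>
  have close: "half_edge G g \<and> u = w \<or> (\<exists>j. walk G w [(g, j)] u)"
  proof (cases rule: edge_kinds[OF gE])
    case 1
    then show ?thesis using gu by (simp add: loose_edge_def)
  next
    case (2 v)
    then show ?thesis using g gu by simp
  next
    case 3
    obtain i where i: "i < 2" "ends G g ! i = w" "set (ends G g) = {w, ends G g ! (1 - i)}"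
      using other_end[OF 3 g(3)] by blast
    show ?thesis
    proof (cases "ends G g ! (1 - i) = u")
      case True
      then have "walk G w [(g, i)] u" using i 3 gE by simp
      then show ?thesis by blast
    next
      case False
      then have "u = w" using gu i(3) by auto
      then have "p = []" using path_closed_empty p(1,2) by metis
      then have "set (ends G g) \<subseteq> {w}" using stay[OF Qp refl g(1,3)] \<open>u = w\<close> by simp
      then show ?thesis using i(3) False \<open>u = w\<close> by auto
    qed
  qed
  show False
  proof (cases "\<exists>h\<in>S. h \<noteq> g \<and> h \<notin> walk_edges p \<and> set (ends G h) \<inter> set (walk_verts G u p) \<noteq> {}")
    case False
    \<comment> \<open>The isolated case. The vector of the path, zero elsewhere, is annihilated by
      \<open>S - {g}\<close>; it would be annihilated by \<open>g\<close> only if the closed circle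
      were positive.\<close>
    obtain \<theta> where th: "\<theta> u = 1" "\<theta> w = of_int (walk_sign G p)"
      "\<And>x. x \<notin> set (walk_verts G u p) \<Longrightarrow> \<theta> x = 0" "nullv G (walk_edges p) \<theta>"
      using path_null_vector[OF p(1,2)] by blast
    have "nullv G (S - {g}) \<theta>" unfolding nullv_def
    proof
      fix e assume e: "e \<in> S - {g}"
      show "inc G \<theta> e = 0"
      proof (cases "e \<in> walk_edges p")
        case True
        then show ?thesis using th(4) unfolding nullv_def by blast
      next
        case ne: False
        then show ?thesis using False e th(3) by (intro inc_zero) blast
      qed
    qed
    moreover have "inc G \<theta> g \<noteq> 0" using close
    proof
      assume "half_edge G g \<and> u = w"
      then have "ends G g = [u]" using gu by (auto simp: half_edge_def length_Suc_conv)
      then show ?thesis using th(1) of_int_end_sign_nonzero[OF gE, of 0] by (simp add: inc_half)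
    next
      assume "\<exists>j. walk G w [(g, j)] u"
      then obtain j where j: "walk G w [(g, j)] u" by blast
      then have o: "ordinary_edge G g" "j < 2" "ends G g ! j = w" "ends G g ! (1 - j) = u" by auto
      have C: "circle G (insert g (walk_edges p))" by (rule path_close_circle[OF p(1,2) j g(2)])
      have "\<not> positive_circle G (insert g (walk_edges p))"
        using free[of "insert g (walk_edges p)"] g(1) p(3) unfolding sign_circuit_def by blast
      then have "esign G g * walk_sign G p \<noteq> 1"
        using C g(2) walk_sign_prod[OF path_distinct_edges[OF p(1,2)], of G] unfolding positive_circle_def by simp
      then have "of_int (walk_sign G p) \<noteq> (of_int (esign G g) :: 'k)"
        using esign_cases[OF gE] walk_sign_cases[OF p(1)] one_neq_minus_one
          one_neq_minus_one[symmetric]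
        by (elim disjE) simp_all
      then show ?thesis unfolding inc_step_eq_0[OF gE o(1,2)] o(3,4) th(1,2) by simp
    qed
    ultimately show False using nocoloop g(1) by blast
  next
    case True
    then obtain h y where h: "h \<in> S" "h \<noteq> g" "h \<notin> walk_edges p" and y: "y \<in> set (ends G h)" "y \<in> set (walk_verts G u p)"
      by blast
    obtain i where "i < length (walk_verts G u p)" and i: "walk_verts G u p ! i = y"
      using y(2) unfolding in_set_conv_nth by blast
    then have il: "i \<le> length p" by simp
    have "i \<noteq> length p"
    proof
      assume "i = length p"
      then have "y = w" using i last_walk_verts[OF p(1)] by (simp add: last_conv_nth)
      then show False using only_w[OF h(1,3)] y(1) h(2) by blast
    qed
    then have il': "Suc i \<le> length p" using il by simp
    let ?z = "walk_verts G u p ! Suc i"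
    have uw: "u \<noteq> w"
    proof
      assume "u = w"
      then have "p = []" using path_closed_empty p(1,2) by metis
      then show False using il' by simp
    qed
    then obtain j where j: "walk G w [(g, j)] u" using close by blast
    obtain e k where ek: "p ! i = (e, k)" by force
    have split: "p = take i p @ (e, k) # drop (Suc i) p" using il' ek by (metis Suc_le_lessD id_take_nth_drop)
    \<comment> \<open>Open the circle at the edge \<open>e\<close> from \<open>y\<close> to
      \<open>?z\<close> instead of at \<open>g\<close>. The new path is equally long, has
      \<open>h\<close> at its end \<open>y\<close> and \<open>e\<close> at its start
      \<open>?z\<close>, and \<open>no_two\<close> forces these two edges to coincide.\<close>
    let ?q = "drop (Suc i) p @ [(g, j)] @ take i p"
    have d: "walk G ?z (drop (Suc i) p) w" by (rule walk_take_drop(2)[OF p(1) il'])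
    have t: "walk G u (take i p) y" using walk_take_drop(1)[OF p(1) il] i by simp
    have q: "walk G ?z ?q y" using d j t unfolding walk_append by blast
    have qv: "walk_verts G ?z ?q = drop (Suc i) (walk_verts G u p) @ take (Suc i) (walk_verts G u p)"
    proof -
      have "walk_verts G w ([(g, j)] @ take i p) = [w, u] @ tl (take (Suc i) (walk_verts G u p))"
        using walk_verts_append[OF j, of "take i p"] j by (simp add: walk_verts_take)
      moreover have "take (Suc i) (walk_verts G u p) = u # tl (take (Suc i) (walk_verts G u p))"
        by (simp add: walk_verts_def)
      ultimately have "tl (walk_verts G w ([(g, j)] @ take i p)) = take (Suc i) (walk_verts G u p)" by simp
      then show ?thesis using walk_verts_append[OF d, of "[(g, j)] @ take i p"] walk_verts_drop[OF il', of G u] by simp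
    qed
    have dis: "set (take (Suc i) (walk_verts G u p)) \<inter> set (drop (Suc i) (walk_verts G u p)) = {}"
      using p(2) by (simp add: set_take_disj_set_drop_if_distinct)
    then have dq: "distinct (walk_verts G ?z ?q)" unfolding qv using p(2) by auto
    have "set (walk_verts G ?z ?q) = set (walk_verts G u p)"
      unfolding qv by (metis append_take_drop_id set_append Un_commute)
    moreover have qe: "walk_edges ?q = insert g (walk_edges p - {e})"
    proof -
      have "walk_edges p = walk_edges (take i p) \<union> insert e (walk_edges (drop (Suc i) p))"
        by (subst split) simp
      moreover have "distinct (map fst (take i p @ (e, k) # drop (Suc i) p))"
        using path_distinct_edges[OF p(1,2)] split by simp
      then have "e \<notin> walk_edges (take i p)" "e \<notin> walk_edges (drop (Suc i) p)"
        by (auto simp: walk_edges_def)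
      ultimately show ?thesis by auto
    qed
    ultimately have Qq: "Q (?z, ?q, y)" unfolding Q_def using q dq p(3,4) g(1) by auto
    have lq: "length ?q = length p" using il' by simp
    have ep: "e \<in> walk_edges p" using ek il' unfolding walk_edges_def by (metis Suc_le_lessD fst_conv image_eqI nth_mem)
    have "walk G y ((e, k) # drop (Suc i) p) w"
      using walk_take_drop(2)[OF p(1) il] i ek il' by (metis Cons_nth_drop_Suc Suc_le_lessD)
    then have "walk G (ends G e ! (1 - k)) (drop (Suc i) p) w" "k < 2" "ordinary_edge G e" by auto
    moreover have "walk_verts G u p ! Suc i = ends G e ! (1 - k)" using il' ek by (simp add: walk_verts_def)
    ultimately have ze: "?z \<in> set (ends G e)" using set_ends_step[of G e k] by auto
    have "h = e"
    proof (rule no_two[OF Qq lq h(1) _ y(1) _ _ ze])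
      show "h \<notin> walk_edges ?q" using h(2,3) unfolding qe by blast
      show "e \<in> S" using ep p(3) by blast
      show "e \<notin> walk_edges ?q" using ep g(2) unfolding qe by auto
    qed
    then show False using h(3) ep by simp
  qed
qed

text \<open>If \<open>T \<subseteq> S\<close> is minimal such that \<open>e\<close> is in the span of \<open>T\<close>, then \<open>insert e T\<close> has no coloop, and a
  sign circuit in it must contain \<open>e\<close>.\<close>

lemma span_circuit:
  assumes S: "S \<subseteq> E" and e: "e \<in> E" "e \<notin> S"
    and span: "\<And>\<theta>. nullv G S \<theta> \<Longrightarrow> inc G \<theta> e = 0"
  shows "\<exists>C. sign_circuit G C \<and> e \<in> C \<and> C \<subseteq> insert e S"
proof -
  define P where "P T \<longleftrightarrow> T \<subseteq> S \<and> (\<forall>\<theta>. nullv G T \<theta> \<longrightarrow> inc G \<theta> e = 0)" for T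
  have "finite S" using S finite_edges finite_subset by blast
  then have "finite {T. P T}" unfolding P_def by simp
  moreover have "P S" using span unfolding P_def by blast
  ultimately obtain T where T: "P T" and min: "\<And>T'. P T' \<Longrightarrow> T' \<subseteq> T \<Longrightarrow> T' = T"
    using finite_has_minimal2[of "{T. P T}" S] by blast
  have TS: "T \<subseteq> S" and Te: "\<And>\<theta>. nullv G T \<theta> \<Longrightarrow> inc G \<theta> e = 0" using T unfolding P_def by auto
  have nocoloop: "inc G \<theta> f = 0" if f: "f \<in> insert e T" and th: "nullv G (insert e T - {f}) \<theta>" for f \<theta>
  proof (cases "f = e")
    case True
    then show ?thesis using Te[of \<theta>] th e(2) TS unfolding nullv_def by auto
  next
    case False
    then have fT: "f \<in> T" using f by blast
    show ?thesis
    proof (rule ccontr)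
      assume nz: "inc G \<theta> f \<noteq> 0"
      have "\<not> P (T - {f})" using min[of "T - {f}"] fT by blast
      then obtain \<eta> where eta: "nullv G (T - {f}) \<eta>" "inc G \<eta> e \<noteq> 0" using TS unfolding P_def by blast
      \<comment> \<open>Chosen to cancel the value of \<open>\<eta>\<close> at \<open>f\<close>; the
        correction does not change the value at \<open>e\<close>, where \<open>\<theta>\<close>
        gives 0.\<close>
      let ?c = "- inc G \<eta> f / inc G \<theta> f"
      have "nullv G T (\<lambda>v. 1 * \<eta> v + ?c * \<theta> v)" unfolding nullv_def inc_linear
      proof
        fix e' assume e': "e' \<in> T"
        show "1 * inc G \<eta> e' + ?c * inc G \<theta> e' = 0"
        proof (cases "e' = f")
          case True
          then show ?thesis using nz by simp
        next
          case False
          then have "inc G \<eta> e' = 0" "inc G \<theta> e' = 0" using e' eta(1) th unfolding nullv_def by auto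
          then show ?thesis by simp
        qed
      qed
      then have "1 * inc G \<eta> e + ?c * inc G \<theta> e = 0" using Te unfolding inc_linear[symmetric] by blast
      moreover have "inc G \<theta> e = 0" using th False unfolding nullv_def by blast
      ultimately show False using eta(2) by simp
    qed
  qed
  obtain C where C: "C \<subseteq> insert e T" "sign_circuit G C"
    using circuit_free_coloop[of "insert e T"] nocoloop e(1) TS S by blast
  have "e \<in> C"
  proof (rule ccontr)
    assume "e \<notin> C"
    then have CT: "C \<subseteq> T" using C(1) by blast
    have "C \<noteq> {}" using C(2) sign_circuit_def positive_circle_def circle_def handcuff_def negative_figure_def negative_circle_def
      by (metis Un_empty empty_not_insert)
    then obtain f where f: "f \<in> C" by blast
    \<comment> \<open>A circuit inside \<open>T\<close> makes its edge \<open>f\<close> redundant,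
      so \<open>T - {f}\<close> would still span \<open>e\<close>, against the minimality of
      \<open>T\<close>.\<close>
    have "nullv G T \<theta>" if th: "nullv G (T - {f}) \<theta>" for \<theta>
    proof -
      have "nullv G (C - {f}) \<theta>" using th CT unfolding nullv_def by blast
      then have "inc G \<theta> f = 0" by (rule sign_circuit_dependent[OF C(2) f])
      then show ?thesis using th unfolding nullv_def by blast
    qed
    then have "P (T - {f})" using Te TS unfolding P_def by blast
    then show False using min[of "T - {f}"] f CT by blast
  qed
  then show ?thesis using C TS by blast
qed

text \<open>To build a potential, edges are added one at a time. If some null vector of
  \<open>S\<close> is nonzero on the new edge, a multiple of it corrects the old potential there.
  Otherwise the edge lies on a sign circuit with edges of \<open>S\<close>, and neutrality of that
  circuit forces the right value already.\<close>

theorem hyperbalanced_iff_potential: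
  assumes "S \<subseteq> E"
  shows "hyperbalanced G S \<longleftrightarrow> (\<exists>\<theta>. potential G S \<theta>)"
proof
  assume "\<exists>\<theta>. potential G S \<theta>"
  then obtain \<theta> where th: "potential G S \<theta>" by blast
  show "hyperbalanced G S" unfolding hyperbalanced_def
    using potential_neutral[of _ \<theta>] th unfolding potential_def by blast
next
  have "finite S" using assms finite_edges finite_subset by blast
  then show "hyperbalanced G S \<Longrightarrow> \<exists>\<theta>. potential G S \<theta>" using assms
  proof (induction S rule: finite_induct)
    case empty
    then show ?case by (simp add: potential_def)
  next
    case (insert e S)
    have "hyperbalanced G S" using insert.prems(1) unfolding hyperbalanced_def by blast
    then obtain \<theta> where th: "potential G S \<theta>" using insert by blast
    show ?case
    proof (cases "\<exists>\<eta>. nullv G S \<eta> \<and> inc G \<eta> e \<noteq> 0")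
      case True
      then obtain \<eta> where eta: "nullv G S \<eta>" "inc G \<eta> e \<noteq> 0" by blast
      let ?c = "(gain G e - inc G \<theta> e) / inc G \<eta> e"
      have "potential G (insert e S) (\<lambda>v. 1 * \<theta> v + ?c * \<eta> v)"
        using th eta unfolding potential_def nullv_def inc_linear by simp
      then show ?thesis by blast
    next
      case False
      then obtain C where C: "sign_circuit G C" "e \<in> C" "C \<subseteq> insert e S"
        using span_circuit[of S e] insert.prems(2) insert.hyps(2) by blast
      have "neutral G C" using C insert.prems(1) unfolding hyperbalanced_def by blast
      moreover have "potential G (C - {e}) \<theta>" using th C(3) unfolding potential_def by blast
      ultimately have "gain G e = inc G \<theta> e" using neutral_circuit_potential C by blast
      then have "potential G (insert e S) \<theta>" using th unfolding potential_def by blast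
      then show ?thesis by blast
    qed
  qed
qed

end

section \<open>Balanced components and the annihilator\<close>

text \<open>Harary's balance criterion in multiplicative form: \<open>s\<close> marks the two sides
  of a bipartition that negative edges cross and positive edges do not. Half edges are left
  unconstrained here and are excluded separately in
  \<open>sign_balanced_iff_switching\<close>.\<close>

definition switching :: "('v, 'e, 'z) signed_graph_scheme \<Rightarrow> 'e set \<Rightarrow> ('v \<Rightarrow> int) \<Rightarrow> bool" where
  "switching G S s \<longleftrightarrow> (\<forall>v. s v = 1 \<or> s v = -1) \<and>
     (\<forall>e\<in>S. ordinary_edge G e \<longrightarrow> esign G e = s (ends G e ! 0) * s (ends G e ! 1))"

definition component_of :: "('v, 'e, 'z) graph_scheme \<Rightarrow> 'e set \<Rightarrow> 'v \<Rightarrow> 'v set" where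
  "component_of G S v = {w \<in> verts G. (v, w) \<in> linked G S}"

lemma components_eq: "components G S = component_of G S ` verts G"
  unfolding components_def quotient_def component_of_def by auto

lemma fun_vector_space: "vector_space (\<lambda>(c::'k::field) (f::'v \<Rightarrow> 'k) v. c * f v)"
  by unfold_locales (auto simp: fun_eq_iff plus_fun_def algebra_simps)

lemma sum_fun_apply: "(\<Sum>x\<in>A. f x :: 'v \<Rightarrow> 'k::field) v = (\<Sum>x\<in>A. f x v)"
  by (induction A rule: infinite_finite_induct) (auto simp: zero_fun_def plus_fun_def)

context gain_graph
begin

lemma walk_sign_switching:
  "walk G u p w \<Longrightarrow> walk_edges p \<subseteq> S \<Longrightarrow> switching G S s \<Longrightarrow> walk_sign G p = s u * s w"
proof (induction rule: walk_induct)
  case Nil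
  have "s w = 1 \<or> s w = -1" using Nil.prems(2) unfolding switching_def by blast
  then show ?case by auto
next
  case (Cons u e i p)
  let ?v = "ends G e ! (1 - i)"
  note i = Cons.hyps(3,4,2)
  have "i = 0 \<or> i = 1" using i(1) by auto
  then have "esign G e = s u * s ?v" using Cons.prems i unfolding switching_def by auto
  moreover have "walk_sign G p = s ?v * s w" using Cons.IH[OF _ Cons.prems(2)] Cons.prems(1) by simp
  moreover have "s ?v = 1 \<or> s ?v = -1" using Cons.prems(2) unfolding switching_def by blast
  ultimately show ?case by auto
qed

text \<open>The sign of a walk in \<open>S\<close> is the product of the values of \<open>s\<close>
  at its ends, hence a square for a closed walk.\<close>

lemma switching_no_negative_circle:
  assumes "switching G S s" "C \<subseteq> S"
  shows "\<not> negative_circle G C"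
proof
  assume C: "negative_circle G C"
  then have c: "circle G C" unfolding negative_circle_def by blast
  then obtain e where "e \<in> C" "ordinary_edge G e" unfolding circle_def by blast
  then have "ends G e ! 0 \<in> cover G C" using set_ends_step[of G e 0] by (auto simp: cover_def)
  then obtain u p where p: "once_around G C u p" using circle_once_around[OF graph c] by blast
  then have "walk_sign G p = s u * s u"
    using assms(2) by (intro walk_sign_switching[OF _ _ assms(1)]) (auto simp: once_around_def)
  moreover have "s u = 1 \<or> s u = -1" using assms(1) unfolding switching_def by blast
  ultimately have "walk_sign G p = 1" by auto
  then show False using C once_around_sign[OF p] unfolding negative_circle_def by simp
qed

text \<open>As \<open>e\<close> joins different components of \<open>S\<close>, a wrong sign is
  repaired by flipping \<open>s\<close> on the component of one end.\<close>

lemma switching_insert: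
  assumes S: "S \<subseteq> E" and s: "switching G S s" and e: "e \<in> E"
    and nl: "(ends G e ! 0, ends G e ! 1) \<notin> linked G S"
  shows "\<exists>s. switching G (insert e S) s"
proof -
  let ?x = "ends G e ! 0" and ?y = "ends G e ! 1"
  have sv: "s v = 1 \<or> s v = -1" for v using s unfolding switching_def by blast
  define t where "t v = (if esign G e \<noteq> s ?x * s ?y \<and> (?x, v) \<in> linked G S then - s v else s v)" for v
  have "t v = 1 \<or> t v = -1" for v using sv[of v] unfolding t_def by auto
  moreover have "esign G f = t (ends G f ! 0) * t (ends G f ! 1)"
    if f: "f \<in> S" "ordinary_edge G f" for f
  proof -
    have "(ends G f ! 0, ends G f ! 1) \<in> linked G S" "(ends G f ! 1, ends G f ! 0) \<in> linked G S"
      using f set_ends_step[of G f 0] by (auto intro!: linked_edge[OF f(1)] simp: ordinary_edge_def)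
    then have "(?x, ends G f ! 0) \<in> linked G S \<longleftrightarrow> (?x, ends G f ! 1) \<in> linked G S"
      using linked_trans by metis
    then show ?thesis using s f unfolding switching_def t_def by auto
  qed
  moreover have "esign G e = t ?x * t ?y"
    using esign_cases[OF e] sv[of ?x] sv[of ?y] nl unfolding t_def by auto
  ultimately have "switching G (insert e S) t" unfolding switching_def by auto
  then show ?thesis by blast
qed

text \<open>Insert the edges one by one. An edge contradicting the current switching cannot have
  linked ends, since a linking path would close with it to a negative circle; so
  \<open>switching_insert\<close> applies.\<close>

lemma balanced_switching:
  assumes "S \<subseteq> E" "sign_balanced G S"
  shows "\<exists>s. switching G S s"
proof -
  have "finite S" using assms(1) finite_edges finite_subset by blast
  then show ?thesis using assms
  proof (induction S rule: finite_induct)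
    case empty
    show ?case by (intro exI[of _ "\<lambda>_. 1"]) (simp add: switching_def)
  next
    case (insert e S)
    have "sign_balanced G S" using insert.prems(2) unfolding sign_balanced_def by blast
    then obtain s where s: "switching G S s" using insert by blast
    have sv: "s v = 1 \<or> s v = -1" for v using s unfolding switching_def by blast
    have eE: "e \<in> E" and SE: "S \<subseteq> E" using insert.prems(1) by auto
    let ?x = "ends G e ! 0" and ?y = "ends G e ! 1"
    show ?case
    proof (cases "ordinary_edge G e \<longrightarrow> esign G e = s ?x * s ?y")
      case True
      then have "switching G (insert e S) s" using s unfolding switching_def by auto
      then show ?thesis by blast
    next
      case False
      then have o: "ordinary_edge G e" and ne: "esign G e \<noteq> s ?x * s ?y" by auto
      have "(?x, ?y) \<notin> linked G S"
      proof
        assume "(?x, ?y) \<in> linked G S"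
        then obtain p where p: "walk G ?x p ?y" "distinct (walk_verts G ?x p)" "walk_edges p \<subseteq> S"
          using linked_path SE by metis
        have "walk G ?y [(e, 1)] ?x" using o eE by simp
        moreover have ep: "e \<notin> walk_edges p" using p(3) insert.hyps(2) by blast
        ultimately have C: "circle G (insert e (walk_edges p))" by (rule path_close_circle[OF p(1,2)])
        have "(\<Prod>f\<in>insert e (walk_edges p). esign G f) = esign G e * walk_sign G p"
          using walk_sign_prod[OF path_distinct_edges[OF p(1,2)], of G] ep by simp
        also have "\<dots> = esign G e * (s ?x * s ?y)" using walk_sign_switching[OF p(1,3) s] by simp
        also have "\<dots> = -1" using ne esign_cases[OF eE] sv[of ?x] sv[of ?y] by auto
        finally have "negative_circle G (insert e (walk_edges p))" using C unfolding negative_circle_def by blast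
        moreover have "insert e (walk_edges p) \<subseteq> insert e S" using p(3) by blast
        ultimately show False using insert.prems(2) unfolding sign_balanced_def by blast
      qed
      then show ?thesis using switching_insert[OF SE s eE] by blast
    qed
  qed
qed

lemma sign_balanced_iff_switching:
  assumes "S \<subseteq> E"
  shows "sign_balanced G S \<longleftrightarrow> (\<forall>h\<in>S. \<not> half_edge G h) \<and> (\<exists>s. switching G S s)"
  using balanced_switching[OF assms] switching_no_negative_circle unfolding sign_balanced_def by metis

section \<open>Null vectors on connected components\<close>

lemma edge_linked:
  assumes "S \<subseteq> E" "e \<in> S" "x \<in> set (ends G e)" "y \<in> set (ends G e)"
  shows "(x, y) \<in> linked G S"
  using assms length_ends by (intro linked_edge[of e]) auto

lemma component_of_ends:
  assumes S: "S \<subseteq> E" and e: "e \<in> S" "set (ends G e) \<inter> component_of G S v \<noteq> {}"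
  shows "set (ends G e) \<subseteq> component_of G S v"
proof
  fix y assume y: "y \<in> set (ends G e)"
  obtain x where x: "x \<in> set (ends G e)" "(v, x) \<in> linked G S" using e(2) unfolding component_of_def by blast
  have "(v, y) \<in> linked G S" using x(2) edge_linked[OF S e(1) x(1) y] by (rule linked_trans)
  then show "y \<in> component_of G S v" using y ends_verts[of e] S e(1) unfolding component_of_def by blast
qed

lemma component_of_eq:
  assumes "x \<in> component_of G S v"
  shows "component_of G S v = component_of G S x"
  using assms linked_sym linked_trans unfolding component_of_def by (metis (lifting) mem_Collect_eq)

lemma component_of_self: "v \<in> V \<Longrightarrow> v \<in> component_of G S v"
  unfolding component_of_def by simp

lemma component_verts: "X \<in> components G S \<Longrightarrow> X \<subseteq> V"
  and component_nonempty: "X \<in> components G S \<Longrightarrow> X \<noteq> {}"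
  unfolding components_eq component_of_def by auto

lemma component_eq: "X \<in> components G S \<Longrightarrow> x \<in> X \<Longrightarrow> X = component_of G S x"
  unfolding components_eq using component_of_eq by blast

lemma component_ends:
  assumes "S \<subseteq> E" "X \<in> components G S" "e \<in> S" "set (ends G e) \<inter> X \<noteq> {}"
  shows "set (ends G e) \<subseteq> X"
  using assms component_of_ends unfolding components_eq by blast

lemma null_step:
  assumes "e \<in> E" "inc G \<theta> e = 0" "x \<in> set (ends G e)" "y \<in> set (ends G e)"
  shows "\<theta> y = \<theta> x \<or> \<theta> y = - \<theta> x"
proof (cases rule: edge_kinds[OF assms(1)])
  case 1
  then show ?thesis using assms by (simp add: loose_edge_def)
next
  case (2 v)
  then show ?thesis using assms by simp
next
  case 3
  obtain i where i: "i < 2" "ends G e ! i = x" "set (ends G e) = {x, ends G e ! (1 - i)}"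
    using other_end[OF 3 assms(3)] by blast
  have "\<theta> x = of_int (esign G e) * \<theta> (ends G e ! (1 - i))"
    using assms(2) inc_step_eq_0[OF assms(1) 3 i(1)] i(2) by simp
  then show ?thesis using i(3) assms(4) esign_cases[OF assms(1)] by auto
qed

lemma null_linked:
  assumes "S \<subseteq> E" "nullv G S \<theta>" "(u, v) \<in> linked G S"
  shows "\<theta> v = \<theta> u \<or> \<theta> v = - \<theta> u"
proof -
  have "v \<in> {x. \<theta> x = \<theta> u \<or> \<theta> x = - \<theta> u}"
  proof (rule linked_invariant[OF assms(3)])
    fix e x y assume e: "e \<in> S" "set (ends G e) = {x, y}" "x \<in> {x. \<theta> x = \<theta> u \<or> \<theta> x = - \<theta> u}"
    have "\<theta> y = \<theta> x \<or> \<theta> y = - \<theta> x"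
      using e assms by (intro null_step[of e]) (auto simp: nullv_def)
    then show "y \<in> {x. \<theta> x = \<theta> u \<or> \<theta> x = - \<theta> u}" using e(3) by auto
  qed simp
  then show ?thesis by simp
qed

lemma of_int_sign_cong: "(of_int a :: 'k) = of_int b \<Longrightarrow> a = 1 \<or> a = -1 \<Longrightarrow> b = 1 \<or> b = -1 \<Longrightarrow> a = b"
  using one_neq_minus_one one_neq_minus_one[symmetric] by auto

text \<open>Dividing by \<open>c\<close> turns \<theta> into a switching function on the ends of
  \<open>S\<close>, and a half edge would force the value 0. Recovering integer signs from field
  elements uses that 1 and -1 differ in the field.\<close>

lemma null_balanced:
  assumes S: "S \<subseteq> E" and th: "nullv G S \<theta>" "\<And>e x. e \<in> S \<Longrightarrow> x \<in> set (ends G e) \<Longrightarrow> \<theta> x = c \<or> \<theta> x = - c"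
    and c: "c \<noteq> 0"
  shows "sign_balanced G S"
proof -
  define s where "s x = (if \<theta> x = c then 1 else -1 :: int)" for x
  have ths: "\<theta> x = of_int (s x) * c" if "e \<in> S" "x \<in> set (ends G e)" for e x
    using th(2)[OF that] unfolding s_def by auto
  have "\<not> half_edge G h" if h: "h \<in> S" for h
  proof
    assume "half_edge G h"
    then obtain v where v: "ends G h = [v]" by (auto simp: half_edge_def length_Suc_conv)
    have "inc G \<theta> h \<noteq> 0"
      using th(2)[OF h, of v] c of_int_end_sign_nonzero[of h 0] S h unfolding inc_half[OF v] by (auto simp: v)
    then show False using th(1) h unfolding nullv_def by blast
  qed
  moreover have "switching G S s" unfolding switching_def
  proof (intro conjI ballI impI)
    fix e assume e: "e \<in> S" "ordinary_edge G e"
    let ?x = "ends G e ! 0" and ?y = "ends G e ! 1"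
    have eE: "e \<in> E" using e S by blast
    have xy: "?x \<in> set (ends G e)" "?y \<in> set (ends G e)" using set_ends_step[OF e(2), of 0] by auto
    have "\<theta> ?x = of_int (esign G e) * \<theta> ?y"
      using th(1) e inc_step_eq_0[OF eE e(2), of 0] unfolding nullv_def by auto
    then have "of_int (s ?x) * c = of_int (esign G e * s ?y) * c"
      using ths[OF e(1) xy(1)] ths[OF e(1) xy(2)] by simp
    then have "(of_int (s ?x) :: 'k) = of_int (esign G e * s ?y)" using c by simp
    moreover have "s ?x = 1 \<or> s ?x = -1" "s ?y = 1 \<or> s ?y = -1" by (auto simp: s_def)
    ultimately have "s ?x = esign G e * s ?y" using esign_cases[OF eE] by (intro of_int_sign_cong) auto
    then show "esign G e = s ?x * s ?y" by (auto simp: s_def split: if_splits)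
  qed (simp add: s_def)
  ultimately show ?thesis unfolding sign_balanced_iff_switching[OF S] by blast
qed

lemma induced_edges:
  "e \<in> edges (induced G X) \<longleftrightarrow> e \<in> E \<and> ends G e \<noteq> [] \<and> set (ends G e) \<subseteq> X"
  by (simp add: induced_def)

text \<open>The witness is the switching function on \<open>X\<close>, extended by zero. This is
  harmless because edges of \<open>S\<close> meeting \<open>X\<close> stay inside
  \<open>X\<close>.\<close>

lemma switching_null:
  assumes S: "S \<subseteq> E" and X: "\<And>e. e \<in> S \<Longrightarrow> set (ends G e) \<inter> X \<noteq> {} \<Longrightarrow> set (ends G e) \<subseteq> X"
    and bal: "sign_balanced G (S \<inter> edges (induced G X))"
  shows "\<exists>\<theta>. nullv G S \<theta> \<and> (\<forall>v. v \<notin> X \<longrightarrow> \<theta> v = 0) \<and> (\<forall>v\<in>X. \<theta> v = 1 \<or> \<theta> v = -1)"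
proof -
  let ?T = "S \<inter> edges (induced G X)"
  have T: "?T \<subseteq> E" using S by blast
  obtain s where s: "switching G ?T s" and nh: "\<And>h. h \<in> ?T \<Longrightarrow> \<not> half_edge G h"
    using bal unfolding sign_balanced_iff_switching[OF T] by blast
  have sv: "s v = 1 \<or> s v = -1" for v using s unfolding switching_def by blast
  let ?t = "\<lambda>v. if v \<in> X then of_int (s v) else 0 :: 'k"
  have "nullv G S ?t" unfolding nullv_def
  proof
    fix e assume e: "e \<in> S"
    then have eE: "e \<in> E" using S by blast
    show "inc G ?t e = 0"
    proof (cases "set (ends G e) \<inter> X = {}")
      case True
      then show ?thesis by (intro inc_zero) auto
    next
      case False
      then have sub: "set (ends G e) \<subseteq> X" using X[OF e] by blast
      moreover have "ends G e \<noteq> []" using False by auto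
      ultimately have eT: "e \<in> ?T" using e eE induced_edges by blast
      show ?thesis
      proof (cases rule: edge_kinds[OF eE])
        case 1
        then show ?thesis by (rule inc_loose)
      next
        case (2 v)
        then show ?thesis using nh[OF eT] by blast
      next
        case 3
        have "esign G e = s (ends G e ! 0) * s (ends G e ! 1)"
          using s eT 3 unfolding switching_def by blast
        moreover have "set (ends G e) = {ends G e ! 0, ends G e ! 1}" using set_ends_step[OF 3, of 0] by simp
        ultimately show ?thesis
          using sub sv[of "ends G e ! 0"] sv[of "ends G e ! 1"] inc_step_eq_0[OF eE 3, of 0 ?t] by auto
      qed
    qed
  qed
  moreover have "?t v = 1 \<or> ?t v = -1" if "v \<in> X" for v using that sv[of v] by auto
  ultimately show ?thesis by (intro exI[of _ ?t]) auto
qed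

text \<open>On a component a null vector is constant up to sign, so one nonzero value already makes
  it a switching function there.\<close>

lemma component_balanced_iff:
  assumes S: "S \<subseteq> E" and X: "X \<in> components G S"
  shows "sign_balanced G (S \<inter> edges (induced G X)) \<longleftrightarrow> (\<exists>\<theta>. nullv G S \<theta> \<and> (\<exists>v\<in>X. \<theta> v \<noteq> 0))"
proof
  assume "sign_balanced G (S \<inter> edges (induced G X))"
  then obtain \<theta> where th: "nullv G S \<theta>" "\<forall>v\<in>X. \<theta> v = 1 \<or> \<theta> v = -1"
    using switching_null[OF S component_ends[OF S X]] by blast
  obtain v where v: "v \<in> X" using component_nonempty[OF X] by blast
  then have "\<theta> v \<noteq> 0" using th(2) by auto
  then show "\<exists>\<theta>. nullv G S \<theta> \<and> (\<exists>v\<in>X. \<theta> v \<noteq> 0)" using th(1) v by blast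
next
  assume "\<exists>\<theta>. nullv G S \<theta> \<and> (\<exists>v\<in>X. \<theta> v \<noteq> 0)"
  then obtain \<theta> v where th: "nullv G S \<theta>" "v \<in> X" "\<theta> v \<noteq> 0" by blast
  have Xv: "X = component_of G S v" by (rule component_eq[OF X th(2)])
  show "sign_balanced G (S \<inter> edges (induced G X))"
  proof (rule null_balanced[OF _ _ _ th(3)])
    show "nullv G (S \<inter> edges (induced G X)) \<theta>" using th(1) unfolding nullv_def by blast
    show "\<theta> x = \<theta> v \<or> \<theta> x = - \<theta> v" if "e \<in> S \<inter> edges (induced G X)" "x \<in> set (ends G e)" for e x
    proof -
      have "x \<in> X" using that by (auto simp: induced_edges)
      then show ?thesis using null_linked[OF S th(1), of v x] unfolding Xv component_of_def by blast
    qed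
  qed (use S in blast)
qed

section \<open>The dimension of the annihilator\<close>

lemma finite_components [simp]: "finite (components G S)"
  unfolding components_eq by simp

lemma balanced_components_le: "card (balanced_components G S) \<le> card V"
proof -
  have "card (balanced_components G S) \<le> card (components G S)"
    unfolding balanced_components_def by (intro card_mono) auto
  also have "\<dots> \<le> card V" unfolding components_eq by (rule card_image_le) simp
  finally show ?thesis .
qed

text \<open>Functions are total on the vertex type; requiring 0 outside \<open>V\<close> keeps
  values at non-vertices from adding to the dimension.\<close>

definition null_space :: "'e set \<Rightarrow> ('v \<Rightarrow> 'k) set" where
  "null_space S = {\<theta>. nullv G S \<theta> \<and> (\<forall>v. v \<notin> V \<longrightarrow> \<theta> v = 0)}"

sublocale fs: vector_space "\<lambda>(c::'k) (f::'v \<Rightarrow> 'k) v. c * f v"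
  by (rule fun_vector_space)

lemma subspace_null_space: "fs.subspace (null_space S)"
  by (rule fs.subspaceI)
    (auto simp: null_space_def nullv_def inc_add[unfolded plus_fun_def] inc_scale plus_fun_def zero_fun_def
      inc_add intro: inc_zero)

text \<open>The basis consists of the signed indicators \<open>\<chi> X\<close> of the balanced
  components. Evaluation at a representative \<open>r X\<close> separates them, which gives
  independence, and also reads off the coefficients of a given null vector.\<close>

lemma null_space_basis:
  assumes S: "S \<subseteq> E"
  shows "\<exists>B. finite B \<and> card B = card (balanced_components G S) \<and> fs.independent B \<and> fs.span B = null_space S"
proof -
  let ?BC = "balanced_components G S"
  have BC: "X \<in> components G S" if "X \<in> ?BC" for X using that unfolding balanced_components_def by blast
  have fin: "finite ?BC" unfolding balanced_components_def by simp
  have "\<forall>X\<in>?BC. \<exists>\<theta>. nullv G S \<theta> \<and> (\<forall>v. v \<notin> X \<longrightarrow> \<theta> v = 0) \<and> (\<forall>v\<in>X. \<theta> v = 1 \<or> \<theta> v = -1)"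
    using switching_null[OF S component_ends[OF S]] unfolding balanced_components_def by blast
  then obtain \<chi> where "\<forall>X\<in>?BC. nullv G S (\<chi> X) \<and> (\<forall>v. v \<notin> X \<longrightarrow> \<chi> X v = 0) \<and> (\<forall>v\<in>X. \<chi> X v = 1 \<or> \<chi> X v = -1)"
    by (metis (no_types, lifting) bchoice)
  then have chi: "nullv G S (\<chi> X)" "v \<notin> X \<Longrightarrow> \<chi> X v = 0" "v \<in> X \<Longrightarrow> \<chi> X v = 1 \<or> \<chi> X v = -1"
    if "X \<in> ?BC" for X v using that by blast+
  have "\<forall>X\<in>?BC. \<exists>v. v \<in> X" using component_nonempty BC by blast
  then obtain r where r: "\<And>X. X \<in> ?BC \<Longrightarrow> r X \<in> X" by metis
  have same: "X = Y" if "X \<in> ?BC" "Y \<in> components G S" "v \<in> X" "v \<in> Y" for X Y v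
    using component_eq[OF BC[OF that(1)] that(3)] component_eq[OF that(2,4)] by simp
  let ?B = "\<chi> ` ?BC"
  have inj: "inj_on \<chi> ?BC"
  proof (rule inj_onI)
    fix X Y assume XY: "X \<in> ?BC" "Y \<in> ?BC" "\<chi> X = \<chi> Y"
    have "\<chi> Y (r X) \<noteq> 0" using chi(3)[OF XY(1) r[OF XY(1)]] XY(3) by auto
    then have "r X \<in> Y" using chi(2)[OF XY(2)] by blast
    then show "X = Y" using same[OF XY(1) BC[OF XY(2)] r[OF XY(1)]] by blast
  qed
  have "fs.independent ?B" unfolding fs.dependent_def
  proof
    assume "\<exists>a\<in>?B. a \<in> fs.span (?B - {a})"
    then obtain X where X: "X \<in> ?BC" "\<chi> X \<in> fs.span (?B - {\<chi> X})" by blast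
    have "fs.span (?B - {\<chi> X}) \<subseteq> {\<theta>. \<theta> (r X) = 0}"
    proof (rule fs.span_minimal)
      show "?B - {\<chi> X} \<subseteq> {\<theta>. \<theta> (r X) = 0}"
      proof
        fix t assume "t \<in> ?B - {\<chi> X}"
        then obtain Y where Y: "Y \<in> ?BC" "t = \<chi> Y" "X \<noteq> Y" by blast
        then have "r X \<notin> Y" using same[OF X(1) BC[OF Y(1)] r[OF X(1)]] by blast
        then show "t \<in> {\<theta>. \<theta> (r X) = 0}" using chi(2)[OF Y(1)] Y(2) by blast
      qed
      show "fs.subspace {\<theta>. \<theta> (r X) = 0}"
        by (rule fs.subspaceI) (auto simp: plus_fun_def zero_fun_def)
    qed
    then have "\<chi> X (r X) = 0" using X(2) by blast
    then show False using chi(3)[OF X(1) r[OF X(1)]] by auto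
  qed
  moreover have "fs.span ?B = null_space S"
  proof
    show "fs.span ?B \<subseteq> null_space S"
    proof (rule fs.span_minimal[OF _ subspace_null_space])
      show "?B \<subseteq> null_space S"
        unfolding null_space_def using chi(1,2) component_verts[OF BC] by blast
    qed
    show "null_space S \<subseteq> fs.span ?B"
    proof
      fix \<theta> assume "\<theta> \<in> null_space S"
      then have th: "nullv G S \<theta>" "\<And>v. v \<notin> V \<Longrightarrow> \<theta> v = 0" unfolding null_space_def by auto
      \<comment> \<open>Division by \<open>\<chi> X (r X)\<close> would be expected; it is 1 or -1,
        hence its own inverse.\<close>
      define c where "c X = \<theta> (r X) * \<chi> X (r X)" for X
      have "\<theta> v = (\<Sum>X\<in>?BC. c X * \<chi> X v)" for v
      proof (cases "v \<in> V")
        case False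
        then have "\<chi> X v = 0" if "X \<in> ?BC" for X using chi(2)[OF that] component_verts[OF BC[OF that]] by blast
        then show ?thesis using th(2)[OF False] by simp
      next
        case True
        define X where "X = component_of G S v"
        have X: "X \<in> components G S" "v \<in> X" using True component_of_self unfolding X_def components_eq by auto
        have others: "\<chi> Y v = 0" if "Y \<in> ?BC" "Y \<noteq> X" for Y
          using same[OF that(1) X(1) _ X(2)] chi(2)[OF that(1)] that(2) by blast
        show ?thesis
        proof (cases "X \<in> ?BC")
          case False
          then have "\<theta> v = 0" using component_balanced_iff[OF S X(1)] th(1) X unfolding balanced_components_def by blast
          moreover have "(\<Sum>X\<in>?BC. c X * \<chi> X v) = 0" using others False by (intro sum.neutral) auto
          ultimately show ?thesis by simp
        next
          case XB: True
          have "(\<Sum>Y\<in>?BC. c Y * \<chi> Y v) = c X * \<chi> X v + (\<Sum>Y\<in>?BC - {X}. c Y * \<chi> Y v)"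
            by (rule sum.remove[OF fin XB])
          also have "(\<Sum>Y\<in>?BC - {X}. c Y * \<chi> Y v) = 0" using others by (intro sum.neutral) auto
          finally have sm: "(\<Sum>Y\<in>?BC. c Y * \<chi> Y v) = c X * \<chi> X v" by simp
          \<comment> \<open>This null vector vanishes at the representative, hence on the whole
            component.\<close>
          let ?d = "\<lambda>x. \<theta> x - c X * \<chi> X x"
          have "nullv G S ?d" using th(1) chi(1)[OF XB] unfolding nullv_def inc_diff inc_scale by simp
          moreover have "(r X, v) \<in> linked G S"
            using r[OF XB] component_eq[OF X(1) r[OF XB]] X(2) unfolding component_of_def by blast
          ultimately have "?d v = ?d (r X) \<or> ?d v = - ?d (r X)" by (rule null_linked[OF S])
          moreover have "?d (r X) = 0" using chi(3)[OF XB r[OF XB]] unfolding c_def by auto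
          ultimately show ?thesis using sm by auto
        qed
      qed
      then have "\<theta> = (\<Sum>X\<in>?BC. (\<lambda>v. c X * \<chi> X v))" by (intro ext) (simp add: sum_fun_apply)
      also have "\<dots> \<in> fs.span ?B" by (intro fs.span_sum fs.span_scale fs.span_base) auto
      finally show "\<theta> \<in> fs.span ?B" .
    qed
  qed
  moreover have "card ?B = card ?BC" by (rule card_image[OF inj])
  ultimately show ?thesis using fin by (intro exI[of _ ?B]) auto
qed

lemma null_restrict:
  assumes "S \<subseteq> E"
  shows "nullv G S (\<lambda>v. if v \<in> V then \<theta> v else 0) \<longleftrightarrow> nullv G S \<theta>"
proof -
  have "inc G (\<lambda>v. if v \<in> V then \<theta> v else 0) e = inc G \<theta> e" if "e \<in> S" for e
    using ends_verts[of e] that assms by (intro inc_cong) auto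
  then show ?thesis unfolding nullv_def by simp
qed

lemma balanced_card_mono:
  assumes "S \<subseteq> T" "T \<subseteq> E"
  shows "card (balanced_components G T) \<le> card (balanced_components G S)"
proof -
  obtain B where B: "finite B" "card B = card (balanced_components G S)" "fs.span B = null_space S"
    using null_space_basis[of S] assms by blast
  obtain C where C: "finite C" "card C = card (balanced_components G T)" "fs.independent C" "fs.span C = null_space T"
    using null_space_basis[of T] assms by blast
  have "null_space T \<subseteq> null_space S" using assms(1) unfolding null_space_def nullv_def by blast
  then have "C \<subseteq> fs.span B" using B(3) C(4) fs.span_superset[of C] by blast
  then show ?thesis using fs.independent_span_bound[OF B(1) C(3)] B(2) C(2) by simp
qed

text \<open>The null space of \<open>T\<close> lies in that of \<open>S\<close>, so equal finite
  dimensions mean equal spaces. If a null vector of \<open>S\<close> were not null on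
  \<open>T\<close>, its restriction to \<open>V\<close> would extend a basis of the smaller space
  beyond the dimension of the larger one.\<close>

lemma balanced_card_eq_iff:
  assumes ST: "S \<subseteq> T" "T \<subseteq> E"
  shows "card (balanced_components G T) = card (balanced_components G S) \<longleftrightarrow>
    (\<forall>\<theta>. nullv G S \<theta> \<longrightarrow> nullv G T \<theta>)"
proof -
  have SE: "S \<subseteq> E" using ST by blast
  obtain B where B: "finite B" "card B = card (balanced_components G S)" "fs.independent B" "fs.span B = null_space S"
    using null_space_basis[OF SE] by blast
  obtain C where C: "finite C" "card C = card (balanced_components G T)" "fs.independent C" "fs.span C = null_space T"
    using null_space_basis[OF ST(2)] by blast
  show ?thesis
  proof
    assume R: "\<forall>\<theta>. nullv G S \<theta> \<longrightarrow> nullv G T \<theta>"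
    then have "B \<subseteq> fs.span C" using B(4) C(4) fs.span_superset[of B] unfolding null_space_def by blast
    then have "card (balanced_components G S) \<le> card (balanced_components G T)"
      using fs.independent_span_bound[OF C(1) B(3)] B(2) C(2) by simp
    then show "card (balanced_components G T) = card (balanced_components G S)"
      using balanced_card_mono[OF ST] by simp
  next
    assume eq: "card (balanced_components G T) = card (balanced_components G S)"
    show "\<forall>\<theta>. nullv G S \<theta> \<longrightarrow> nullv G T \<theta>"
    proof (intro allI impI, rule ccontr)
      fix \<theta> assume th: "nullv G S \<theta>" "\<not> nullv G T \<theta>"
      let ?t = "\<lambda>v. if v \<in> V then \<theta> v else 0"
      have t: "?t \<in> null_space S" "?t \<notin> null_space T"
        using th null_restrict[OF SE] null_restrict[OF ST(2)] unfolding null_space_def by auto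
      have "null_space T \<subseteq> null_space S" using ST(1) unfolding null_space_def nullv_def by blast
      then have "insert ?t C \<subseteq> fs.span B" using B(4) C(4) fs.span_superset[of C] t(1) by blast
      moreover have "fs.independent (insert ?t C)" using t(2) C(3,4) by (intro fs.independent_insertI) auto
      ultimately have "card (insert ?t C) \<le> card B" using fs.independent_span_bound[OF B(1)] by blast
      moreover have "?t \<notin> C" using t(2) C(4) fs.span_superset[of C] by blast
      ultimately show False using C(1,2) B(2) eq by simp
    qed
  qed
qed

text \<open>A single further linear condition lowers the dimension by at most one.\<close>

lemma balanced_card_insert:
  assumes SE: "insert e S \<subseteq> E"
  shows "card (balanced_components G S) \<le> card (balanced_components G (insert e S)) + 1"
proof (cases "\<forall>\<theta>. nullv G S \<theta> \<longrightarrow> nullv G (insert e S) \<theta>")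
  case True
  then have "card (balanced_components G (insert e S)) = card (balanced_components G S)"
    using balanced_card_eq_iff[OF subset_insertI SE] by blast
  then show ?thesis by simp
next
  case False
  then obtain \<theta> where th: "nullv G S \<theta>" "inc G \<theta> e \<noteq> 0" unfolding nullv_def by blast
  obtain B where B: "finite B" "card B = card (balanced_components G S)" "fs.independent B" "fs.span B = null_space S"
    using null_space_basis[of S] SE by blast
  obtain C where C: "finite C" "card C = card (balanced_components G (insert e S))" "fs.span C = null_space (insert e S)"
    using null_space_basis[OF SE] by blast
  define t where "t v = (if v \<in> V then \<theta> v else 0)" for v
  have te: "inc G t e = inc G \<theta> e" unfolding t_def using ends_verts[of e] SE by (intro inc_cong) auto
  have tS: "nullv G S t" unfolding t_def using null_restrict[of S \<theta>] th(1) SE by blast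
  have "B \<subseteq> fs.span (insert t C)"
  proof
    fix b assume "b \<in> B"
    then have b: "b \<in> null_space S" using B(4) fs.span_superset[of B] by blast
    \<comment> \<open>Subtracting \<open>k\<close> times \<open>t\<close> makes \<open>b\<close>
      vanish on \<open>e\<close>, so every null vector of \<open>S\<close> is spanned by those of
      \<open>insert e S\<close> together with \<open>t\<close>.\<close>
    define k where "k = inc G b e / inc G \<theta> e"
    have kk: "k * inc G \<theta> e = inc G b e" using th(2) by (simp add: k_def)
    have "t v = 0" if "v \<notin> V" for v using that by (simp add: t_def)
    then have "(\<lambda>v. b v - k * t v) \<in> null_space (insert e S)"
      using b tS te th(2) unfolding null_space_def nullv_def by (auto simp: inc_diff inc_scale kk)
    then have "b - (\<lambda>v. k * t v) \<in> fs.span C" unfolding C(3) fun_diff_def .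
    then show "b \<in> fs.span (insert t C)" unfolding fs.span_insert by blast
  qed
  then have "card B \<le> card (insert t C)" using fs.independent_span_bound[OF _ B(3)] C(1) by blast
  also have "\<dots> \<le> card C + 1" using C(1) card_insert_le_m1 by (simp add: card_insert_if)
  finally show ?thesis using B(2) C(2) by simp
qed

end

section \<open>Coatoms\<close>

lemma maximal_subset:
  assumes "finite U" "C \<subseteq> U" "P C"
  obtains A where "C \<subseteq> A" "A \<subseteq> U" "P A" "\<And>B. A \<subset> B \<Longrightarrow> B \<subseteq> U \<Longrightarrow> \<not> P B"
proof -
  have "finite {A. A \<subseteq> U \<and> P A}" "C \<in> {A. A \<subseteq> U \<and> P A}" using assms by auto
  from finite_has_maximal2[OF this] obtain A where "A \<in> {A. A \<subseteq> U \<and> P A}" "C \<subseteq> A"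
    and "\<forall>B\<in>{A. A \<subseteq> U \<and> P A}. A \<subseteq> B \<longrightarrow> A = B" by (elim bexE conjE)
  then show thesis by (intro that[of A]) auto
qed

context gain_graph
begin

section \<open>Ranks and bases in terms of null vectors\<close>

lemma ground_matroid [simp]: "ground (frame_matroid G) = E" "ground (gain_matroid G) = E"
  by (simp_all add: frame_matroid_def gain_matroid_def)

lemma gain_rank: "rk (gain_matroid G) S = \<rho> S + (if hyperbalanced G S then 0 else 1)"
  by (simp add: frame_matroid_def gain_matroid_def)

lemma frame_rank_mono: "S \<subseteq> T \<Longrightarrow> T \<subseteq> E \<Longrightarrow> \<rho> S \<le> \<rho> T"
  using balanced_card_mono[of S T] by (simp add: frame_matroid_def)

text \<open>The bridge from rank statements to null vectors. The bound
  \<open>balanced_components_le\<close> ensures that the truncated subtraction in the rank loses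
  nothing.\<close>

lemma frame_rank_eq_iff:
  assumes "S \<subseteq> T" "T \<subseteq> E"
  shows "\<rho> T = \<rho> S \<longleftrightarrow> (\<forall>\<theta>. nullv G S \<theta> \<longrightarrow> nullv G T \<theta>)"
  unfolding balanced_card_eq_iff[OF assms, symmetric]
  using balanced_components_le[of S] balanced_components_le[of T] by (auto simp: frame_matroid_def)

lemma frame_rank_insert:
  assumes "insert e S \<subseteq> E"
  shows "\<rho> (insert e S) \<le> \<rho> S + 1"
  using balanced_card_insert[OF assms] balanced_components_le[of S] by (simp add: frame_matroid_def)

lemma frame_rank_insert_null:
  assumes "insert e S \<subseteq> E" "\<rho> (insert e S) \<noteq> \<rho> S + 1" "nullv G S \<theta>"
  shows "inc G \<theta> e = 0"
proof -
  have "\<rho> (insert e S) = \<rho> S"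
    using frame_rank_insert[OF assms(1)] frame_rank_mono[OF subset_insertI assms(1)] assms(2) by simp
  then show ?thesis using assms(3) frame_rank_eq_iff[OF subset_insertI assms(1)] unfolding nullv_def by blast
qed

lemma frame_rank_empty: "\<rho> {} = 0"
proof -
  have "linked G {} = Id" by (simp add: linked_def)
  then have "component_of G {} v = {v}" if "v \<in> V" for v using that by (auto simp: component_of_def)
  then have "components G {} = (\<lambda>v. {v}) ` V" unfolding components_eq by (intro image_cong) auto
  moreover have "balanced_components G {} = components G {}"
    unfolding balanced_components_def by (auto simp: sign_balanced_def negative_circle_def circle_def)
  ultimately have "card (balanced_components G {}) = card V" by (simp add: card_image)
  then show ?thesis by (simp add: frame_matroid_def)
qed

lemma frame_rank_le_card: "S \<subseteq> E \<Longrightarrow> \<rho> S \<le> card S"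
proof (induction S rule: infinite_finite_induct)
  case (infinite S)
  then show ?case using finite_edges finite_subset by blast
next
  case empty
  then show ?case by (simp add: frame_rank_empty)
next
  case (insert e S)
  then show ?case using frame_rank_insert[of e S] by simp
qed

lemma hyperbalanced_mono: "hyperbalanced G T \<Longrightarrow> S \<subseteq> T \<Longrightarrow> hyperbalanced G S"
  unfolding hyperbalanced_def by blast

text \<open>Maximality among independent sets gives the spanning property, as an edge not
  annihilated would raise rank and size together. A sign circuit in \<open>B\<close> would contain
  an edge whose removal keeps the rank, contradicting that the rank of \<open>B\<close> is its
  size.\<close>

lemma frame_basis_props:
  assumes "basis (frame_matroid G) B"
  shows "B \<subseteq> E" "\<And>\<theta>. nullv G B \<theta> \<Longrightarrow> nullv G E \<theta>" "\<And>C. C \<subseteq> B \<Longrightarrow> \<not> sign_circuit G C"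
proof -
  have B: "B \<subseteq> E" "\<rho> B = card B"
    and max: "\<And>B'. B \<subset> B' \<Longrightarrow> B' \<subseteq> E \<Longrightarrow> \<rho> B' \<noteq> card B'"
    using assms unfolding basis_def maximal_set_def indep_def by auto
  show "B \<subseteq> E" by (rule B(1))
  have finB: "finite B" using B(1) finite_edges finite_subset by blast
  show "nullv G E \<theta>" if th: "nullv G B \<theta>" for \<theta> unfolding nullv_def
  proof
    fix e assume e: "e \<in> E"
    show "inc G \<theta> e = 0"
    proof (cases "e \<in> B")
      case True
      then show ?thesis using th unfolding nullv_def by blast
    next
      case False
      have sub: "insert e B \<subseteq> E" using e B(1) by blast
      have "\<rho> (insert e B) \<noteq> card B + 1" using max[of "insert e B"] sub False finB by auto
      then show ?thesis using frame_rank_insert_null[OF sub _ th] B(2) by simp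
    qed
  qed
  show "\<not> sign_circuit G C" if CB: "C \<subseteq> B" for C
  proof
    assume C: "sign_circuit G C"
    have "C \<noteq> {}" using sign_circuit_gain[OF C] by (auto elim: circuit_gain.cases
          simp: positive_circle_def negative_circle_def circle_def)
    then obtain e where e: "e \<in> C" by blast
    have "nullv G B \<theta>" if th: "nullv G (B - {e}) \<theta>" for \<theta>
    proof -
      have "nullv G (C - {e}) \<theta>" using th CB unfolding nullv_def by blast
      then have "inc G \<theta> e = 0" by (rule sign_circuit_dependent[OF C e])
      then show ?thesis using th unfolding nullv_def by blast
    qed
    then have "\<rho> B = \<rho> (B - {e})"
      using frame_rank_eq_iff[of "B - {e}" B] B(1) by blast
    also have "\<dots> \<le> card (B - {e})" using B(1) by (intro frame_rank_le_card) blast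
    also have "\<dots> < card B" using e CB finB by (intro card_Diff1_less) auto
    finally show False using B(2) by simp
  qed
qed

text \<open>A maximal independent subset of \<open>A\<close> spans \<open>A\<close> and therefore
  \<open>E\<close>, so it is maximal among all independent sets.\<close>

lemma spanning_contains_basis:
  assumes A: "A \<subseteq> E" and span: "\<And>\<theta>. nullv G A \<theta> \<Longrightarrow> nullv G E \<theta>"
  shows "\<exists>B\<subseteq>A. basis (frame_matroid G) B"
proof -
  have finA: "finite A" using A finite_edges finite_subset by blast
  have "indep (frame_matroid G) {}" by (simp add: indep_def frame_rank_empty)
  then obtain B where B: "B \<subseteq> A" "indep (frame_matroid G) B"
    and max: "\<And>B'. B \<subset> B' \<Longrightarrow> B' \<subseteq> A \<Longrightarrow> \<not> indep (frame_matroid G) B'"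
    using maximal_subset[OF finA empty_subsetI, of "indep (frame_matroid G)"] by metis
  have BE: "B \<subseteq> E" and rB: "\<rho> B = card B" using B unfolding indep_def by auto
  have finB: "finite B" using BE finite_edges finite_subset by blast
  have spanB: "nullv G E \<theta>" if th: "nullv G B \<theta>" for \<theta>
  proof (rule span, unfold nullv_def, rule ballI)
    fix e assume e: "e \<in> A"
    show "inc G \<theta> e = 0"
    proof (cases "e \<in> B")
      case True
      then show ?thesis using th unfolding nullv_def by blast
    next
      case False
      have sub: "insert e B \<subseteq> E" using e BE A by blast
      have "\<rho> (insert e B) \<noteq> card B + 1"
        using max[of "insert e B"] sub False finB e B(1) unfolding indep_def by auto
      then show ?thesis using frame_rank_insert_null[OF sub _ th] rB by simp
    qed
  qed
  have "\<not> indep (frame_matroid G) B'" if B': "B \<subset> B'" for B'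
  proof
    assume i: "indep (frame_matroid G) B'"
    then have B'E: "B' \<subseteq> E" "\<rho> B' = card B'" unfolding indep_def by auto
    have "\<rho> B' = \<rho> B"
      using frame_rank_eq_iff[of B B'] B' B'E(1) spanB unfolding nullv_def by blast
    then show False using B' B'E rB psubset_card_mono[of B' B] finite_subset[OF B'E(1) finite_edges] by simp
  qed
  then show ?thesis using B unfolding basis_def maximal_set_def by blast
qed

section \<open>Hyperbalanced coatoms\<close>

lemma circuit_free_potential:
  assumes "B \<subseteq> E" "\<And>C. C \<subseteq> B \<Longrightarrow> \<not> sign_circuit G C"
  shows "\<exists>\<theta>. potential G B \<theta>"
  using hyperbalanced_iff_potential[OF assms(1)] assms(2) unfolding hyperbalanced_def by blast

lemma spanning_potential_unique:
  assumes span: "\<And>\<theta>. nullv G B \<theta> \<Longrightarrow> nullv G E \<theta>"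
    and th: "potential G B \<theta>" "potential G B \<eta>" and e: "e \<in> E"
  shows "inc G \<theta> e = inc G \<eta> e"
proof -
  have "nullv G B (\<lambda>v. \<theta> v - \<eta> v)" using th unfolding nullv_def potential_def inc_diff by simp
  from span[OF this] show ?thesis using e unfolding nullv_def inc_diff by simp
qed

lemma hyperbalanced_insert_iff:
  assumes B: "B \<subseteq> E" and span: "\<And>\<theta>. nullv G B \<theta> \<Longrightarrow> nullv G E \<theta>"
    and th: "potential G B \<theta>" and e: "e \<in> E"
  shows "hyperbalanced G (insert e B) \<longleftrightarrow> gain G e = inc G \<theta> e"
proof -
  have sub: "insert e B \<subseteq> E" using B e by blast
  show ?thesis unfolding hyperbalanced_iff_potential[OF sub]
  proof
    assume "\<exists>\<eta>. potential G (insert e B) \<eta>"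
    then obtain \<eta> where eta: "potential G (insert e B) \<eta>" by blast
    then have "potential G B \<eta>" unfolding potential_def by blast
    then show "gain G e = inc G \<theta> e"
      using spanning_potential_unique[OF span th _ e, of \<eta>] eta unfolding potential_def by simp
  next
    assume "gain G e = inc G \<theta> e"
    then show "\<exists>\<eta>. potential G (insert e B) \<eta>" using th unfolding potential_def by blast
  qed
qed

text \<open>The frame rank of \<open>A\<close> is already full, so adding an edge can change the
  rank only through the hyperbalance term, which stays 0 exactly when the edge agrees with the
  potential.\<close>

lemma clos_spanning:
  assumes A: "A \<subseteq> E" and span: "\<And>\<eta>. nullv G A \<eta> \<Longrightarrow> nullv G E \<eta>" and th: "potential G A \<theta>"
  shows "clos (gain_matroid G) A = {e \<in> E. gain G e = inc G \<theta> e}"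
proof -
  have hb: "hyperbalanced G A" using th hyperbalanced_iff_potential[OF A] by blast
  have "rk (gain_matroid G) (insert e A) = rk (gain_matroid G) A \<longleftrightarrow> gain G e = inc G \<theta> e" if e: "e \<in> E" for e
  proof -
    have sub: "insert e A \<subseteq> E" using A e by blast
    have "\<rho> (insert e A) = \<rho> A"
      using frame_rank_eq_iff[OF subset_insertI sub] span sub unfolding nullv_def by blast
    then show ?thesis using hb hyperbalanced_insert_iff[OF A span th e] unfolding gain_rank by auto
  qed
  then show ?thesis unfolding clos_def by auto
qed

lemma clos_basis:
  assumes "basis (frame_matroid G) B" "potential G B \<theta>"
  shows "clos (gain_matroid G) B = {e \<in> E. gain G e = inc G \<theta> e}"
  using clos_spanning[OF frame_basis_props(1,2)[OF assms(1)] assms(2)] .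

text \<open>An edge outside \<open>B\<close> lies in the span of \<open>B\<close>, so some sign
  circuit in \<open>insert e B\<close> contains it. Such a circuit is neutral precisely if the edge
  agrees with \<theta>.\<close>

lemma bcl_basis:
  assumes B: "basis (frame_matroid G) B" and th: "potential G B \<theta>"
  shows "bcl G B = {e \<in> E. gain G e = inc G \<theta> e}"
proof -
  note p = frame_basis_props[OF B]
  have "(\<exists>C. sign_circuit G C \<and> neutral G C \<and> e \<in> C \<and> C \<subseteq> insert e B) \<longleftrightarrow> gain G e = inc G \<theta> e"
    if e: "e \<in> E" "e \<notin> B" for e
  proof
    assume "\<exists>C. sign_circuit G C \<and> neutral G C \<and> e \<in> C \<and> C \<subseteq> insert e B"
    then obtain C where C: "sign_circuit G C" "neutral G C" "e \<in> C" "C \<subseteq> insert e B" by blast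
    have "potential G (C - {e}) \<theta>" using th C(4) unfolding potential_def by blast
    then show "gain G e = inc G \<theta> e" by (rule neutral_circuit_potential[OF C(1-3)])
  next
    assume g: "gain G e = inc G \<theta> e"
    obtain C where C: "sign_circuit G C" "e \<in> C" "C \<subseteq> insert e B"
      using span_circuit[OF p(1) e] p(2) e(1) unfolding nullv_def by blast
    have "potential G C \<theta>" using th g C(3) unfolding potential_def by blast
    then show "\<exists>C. sign_circuit G C \<and> neutral G C \<and> e \<in> C \<and> C \<subseteq> insert e B"
      using C potential_neutral by blast
  qed
  then show ?thesis using p(1) th unfolding bcl_def potential_def by auto
qed

text \<open>Passing from \<open>A\<close> to \<open>E\<close> raises the hyperbalance term from 0 to
  1. This accounts for the entire rank difference of a coatom, so \<open>A\<close> must have full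
  frame rank, and the flat condition is then computed by \<open>clos_spanning\<close>.\<close>

lemma hyperbalanced_coatom_iff_potential:
  assumes hf: "hyperfrustrated_graph G"
  shows "coatom (gain_matroid G) A \<and> hyperbalanced G A \<longleftrightarrow>
    (\<exists>\<theta>. A = {e \<in> E. gain G e = inc G \<theta> e}) \<and> (\<forall>\<eta>. nullv G A \<eta> \<longrightarrow> nullv G E \<eta>)"
    (is "_ \<longleftrightarrow> ?pot \<and> ?span")
proof
  assume L: "coatom (gain_matroid G) A \<and> hyperbalanced G A"
  then have A: "A \<subseteq> E" and cl: "clos (gain_matroid G) A = A"
    and r: "rk (gain_matroid G) A + 1 = rk (gain_matroid G) E" unfolding coatom_def flat_def by auto
  have "\<rho> E = \<rho> A" using r L hf unfolding gain_rank by simp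
  then have span: ?span using frame_rank_eq_iff[OF A subset_refl] by blast
  obtain \<theta> where "potential G A \<theta>" using L hyperbalanced_iff_potential[OF A] by blast
  then show "?pot \<and> ?span" using clos_spanning[OF A] cl span by metis
next
  assume R: "?pot \<and> ?span"
  then obtain \<theta> where Aeq: "A = {e \<in> E. gain G e = inc G \<theta> e}" and span: ?span by blast
  have A: "A \<subseteq> E" and th: "potential G A \<theta>" unfolding Aeq potential_def by auto
  have "clos (gain_matroid G) A = A" using clos_spanning[OF A _ th] span Aeq by metis
  moreover have "hyperbalanced G A" using th hyperbalanced_iff_potential[OF A] by blast
  moreover have "\<rho> E = \<rho> A"
    using frame_rank_eq_iff[OF A subset_refl] span by blast
  ultimately show "coatom (gain_matroid G) A \<and> hyperbalanced G A"
    using A hf unfolding coatom_def flat_def gain_rank by simp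
qed

lemma hyperbalanced_coatom_iff_basis:
  assumes hf: "hyperfrustrated_graph G"
  shows "coatom (gain_matroid G) A \<and> hyperbalanced G A \<longleftrightarrow>
    (\<exists>B \<theta>. basis (frame_matroid G) B \<and> potential G B \<theta> \<and> A = {e \<in> E. gain G e = inc G \<theta> e})"
  unfolding hyperbalanced_coatom_iff_potential[OF hf]
proof
  assume "(\<exists>\<theta>. A = {e \<in> E. gain G e = inc G \<theta> e}) \<and> (\<forall>\<eta>. nullv G A \<eta> \<longrightarrow> nullv G E \<eta>)"
  then obtain \<theta> where A: "A = {e \<in> E. gain G e = inc G \<theta> e}" and span: "\<And>\<eta>. nullv G A \<eta> \<Longrightarrow> nullv G E \<eta>"
    by blast
  have AE: "A \<subseteq> E" using A by blast
  obtain B where B: "B \<subseteq> A" "basis (frame_matroid G) B" using spanning_contains_basis[OF AE span] by blast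
  have "potential G B \<theta>" using B(1) unfolding A potential_def by blast
  then show "\<exists>B \<theta>. basis (frame_matroid G) B \<and> potential G B \<theta> \<and> A = {e \<in> E. gain G e = inc G \<theta> e}"
    using B(2) A by blast
next
  assume "\<exists>B \<theta>. basis (frame_matroid G) B \<and> potential G B \<theta> \<and> A = {e \<in> E. gain G e = inc G \<theta> e}"
  then obtain B \<theta> where B: "basis (frame_matroid G) B" "potential G B \<theta>"
    and A: "A = {e \<in> E. gain G e = inc G \<theta> e}" by blast
  have "B \<subseteq> A" using frame_basis_props(1)[OF B(1)] B(2) unfolding A potential_def by blast
  then have "nullv G E \<eta>" if "nullv G A \<eta>" for \<eta>
    using frame_basis_props(2)[OF B(1), of \<eta>] that unfolding nullv_def by blast
  then show "(\<exists>\<theta>. A = {e \<in> E. gain G e = inc G \<theta> e}) \<and> (\<forall>\<eta>. nullv G A \<eta> \<longrightarrow> nullv G E \<eta>)"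
    using A by blast
qed

lemma hyperbalanced_coatom_clos:
  assumes "hyperfrustrated_graph G" "hyperbalanced G A"
  shows "coatom (gain_matroid G) A \<longleftrightarrow> (\<exists>F. basis (frame_matroid G) F \<and> A = clos (gain_matroid G) F)"
    "coatom (gain_matroid G) A \<longleftrightarrow> (\<exists>F. basis (frame_matroid G) F \<and> A = bcl G F)"
proof -
  have pot: "\<exists>\<theta>. potential G F \<theta>" if "basis (frame_matroid G) F" for F
    using circuit_free_potential frame_basis_props[OF that] by blast
  have "coatom (gain_matroid G) A \<longleftrightarrow>
    (\<exists>F \<theta>. basis (frame_matroid G) F \<and> potential G F \<theta> \<and> A = {e \<in> E. gain G e = inc G \<theta> e})"
    using hyperbalanced_coatom_iff_basis[OF assms(1), of A] assms(2) by blast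
  also have "\<dots> \<longleftrightarrow> (\<exists>F \<theta>. basis (frame_matroid G) F \<and> potential G F \<theta> \<and> A = clos (gain_matroid G) F)"
    by (intro ex_cong1 conj_cong refl) (simp add: clos_basis)
  also have "\<dots> \<longleftrightarrow> (\<exists>F. basis (frame_matroid G) F \<and> A = clos (gain_matroid G) F)" using pot by blast
  finally show 1: "coatom (gain_matroid G) A \<longleftrightarrow> (\<exists>F. basis (frame_matroid G) F \<and> A = clos (gain_matroid G) F)" .
  have "clos (gain_matroid G) F = bcl G F" if F: "basis (frame_matroid G) F" for F
    using pot[OF F] clos_basis[OF F] bcl_basis[OF F] by auto
  then show "coatom (gain_matroid G) A \<longleftrightarrow> (\<exists>F. basis (frame_matroid G) F \<and> A = bcl G F)"
    unfolding 1 by auto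
qed

text \<open>A maximal hyperbalanced set has to be spanning: a null vector of \<open>A\<close> that
  is nonzero on some edge \<open>e\<close> could be used to shift the potential until it also fits
  \<open>e\<close>.\<close>

lemma maximal_hyperbalanced_coatom:
  assumes hf: "hyperfrustrated_graph G"
  shows "coatom (gain_matroid G) A \<and> hyperbalanced G A \<longleftrightarrow>
    maximal_set (\<lambda>S. S \<subseteq> E \<and> hyperbalanced G S) A"
  unfolding hyperbalanced_coatom_iff_potential[OF hf]
proof
  assume "(\<exists>\<theta>. A = {e \<in> E. gain G e = inc G \<theta> e}) \<and> (\<forall>\<eta>. nullv G A \<eta> \<longrightarrow> nullv G E \<eta>)"
  then obtain \<theta> where Aeq: "A = {e \<in> E. gain G e = inc G \<theta> e}" and span: "\<And>\<eta>. nullv G A \<eta> \<Longrightarrow> nullv G E \<eta>"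
    by blast
  have A: "A \<subseteq> E" and th: "potential G A \<theta>" unfolding Aeq potential_def by auto
  have "\<not> hyperbalanced G B" if AB: "A \<subset> B" and B: "B \<subseteq> E" for B
  proof
    assume hB: "hyperbalanced G B"
    obtain e where e: "e \<in> B" "e \<notin> A" using AB by blast
    have "hyperbalanced G (insert e A)" using e AB by (intro hyperbalanced_mono[OF hB]) blast
    then show False using hyperbalanced_insert_iff[OF A span th] e B Aeq by blast
  qed
  then show "maximal_set (\<lambda>S. S \<subseteq> E \<and> hyperbalanced G S) A"
    using A th hyperbalanced_iff_potential[OF A] unfolding maximal_set_def by blast
next
  assume L: "maximal_set (\<lambda>S. S \<subseteq> E \<and> hyperbalanced G S) A"
  then have A: "A \<subseteq> E" and hb: "hyperbalanced G A"
    and max: "\<And>e \<theta>. e \<in> E \<Longrightarrow> e \<notin> A \<Longrightarrow> \<not> potential G (insert e A) \<theta>"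
    using hyperbalanced_iff_potential[of "insert _ A"] unfolding maximal_set_def by auto
  obtain \<theta> where th: "potential G A \<theta>" using hb hyperbalanced_iff_potential[OF A] by blast
  have "nullv G E \<eta>" if eta: "nullv G A \<eta>" for \<eta> unfolding nullv_def
  proof (rule ballI, rule ccontr)
    fix e assume e: "e \<in> E" "inc G \<eta> e \<noteq> 0"
    let ?c = "(gain G e - inc G \<theta> e) / inc G \<eta> e"
    have "potential G (insert e A) (\<lambda>v. 1 * \<theta> v + ?c * \<eta> v)"
      using th eta e unfolding potential_def nullv_def inc_linear by simp
    moreover have "e \<notin> A" using e(2) eta unfolding nullv_def by blast
    ultimately show False using max e(1) by blast
  qed
  moreover have "A = {e \<in> E. gain G e = inc G \<theta> e}"
    using A th max[of _ \<theta>] unfolding potential_def by blast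
  ultimately show "(\<exists>\<theta>. A = {e \<in> E. gain G e = inc G \<theta> e}) \<and> (\<forall>\<eta>. nullv G A \<eta> \<longrightarrow> nullv G E \<eta>)"
    by blast
qed

lemma hyperbalanced_coatom_exists:
  assumes "hyperfrustrated_graph G"
  shows "\<exists>A. coatom (gain_matroid G) A \<and> hyperbalanced G A"
proof -
  have "potential G {} \<theta>" for \<theta> by (simp add: potential_def)
  then have "hyperbalanced G {}" using hyperbalanced_iff_potential[of "{}"] by blast
  then obtain A where "A \<subseteq> E" "hyperbalanced G A" "\<And>B. A \<subset> B \<Longrightarrow> B \<subseteq> E \<Longrightarrow> \<not> hyperbalanced G B"
    using maximal_subset[OF finite_edges empty_subsetI, of "hyperbalanced G"] by metis
  then have "maximal_set (\<lambda>S. S \<subseteq> E \<and> hyperbalanced G S) A" unfolding maximal_set_def by blast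
  then show ?thesis using maximal_hyperbalanced_coatom[OF assms] by blast
qed

lemma hyperbalanced_cocircuit:
  assumes "hyperfrustrated_graph G"
  shows "(\<exists>A. coatom (gain_matroid G) A \<and> hyperbalanced G A \<and> D = E - A) \<longleftrightarrow>
    minimal_set (hyperbalancing_set G) D"
proof -
  have "(\<exists>A. coatom (gain_matroid G) A \<and> hyperbalanced G A \<and> D = E - A) \<longleftrightarrow>
    (\<exists>A. maximal_set (\<lambda>S. S \<subseteq> E \<and> hyperbalanced G S) A \<and> D = E - A)"
    using maximal_hyperbalanced_coatom[OF assms] by blast
  also have "\<dots> \<longleftrightarrow> minimal_set (hyperbalancing_set G) D"
  proof
    assume "\<exists>A. maximal_set (\<lambda>S. S \<subseteq> E \<and> hyperbalanced G S) A \<and> D = E - A"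
    then obtain A where A: "A \<subseteq> E" "hyperbalanced G A" "D = E - A"
      and max: "\<And>B. A \<subset> B \<Longrightarrow> B \<subseteq> E \<Longrightarrow> \<not> hyperbalanced G B" unfolding maximal_set_def by blast
    have "hyperbalancing_set G D" unfolding hyperbalancing_set_def A(3) using A(1,2) by (simp add: double_diff)
    moreover have "\<not> hyperbalancing_set G D'" if "D' \<subset> D" for D'
      using max[of "E - D'"] that A(1,3) unfolding hyperbalancing_set_def by blast
    ultimately show "minimal_set (hyperbalancing_set G) D" unfolding minimal_set_def by blast
  next
    assume "minimal_set (hyperbalancing_set G) D"
    then have D: "D \<subseteq> E" "hyperbalanced G (E - D)"
      and min: "\<And>D'. D' \<subset> D \<Longrightarrow> \<not> hyperbalancing_set G D'" unfolding minimal_set_def hyperbalancing_set_def by auto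
    have "\<not> hyperbalanced G B" if B: "E - D \<subset> B" "B \<subseteq> E" for B
    proof -
      have "\<not> hyperbalancing_set G (E - B)" using min[of "E - B"] B D(1) by blast
      then show ?thesis using B(2) unfolding hyperbalancing_set_def by (simp add: double_diff)
    qed
    then have "maximal_set (\<lambda>S. S \<subseteq> E \<and> hyperbalanced G S) (E - D)"
      using D(2) unfolding maximal_set_def by blast
    moreover have "D = E - (E - D)" using D(1) by blast
    ultimately show "\<exists>A. maximal_set (\<lambda>S. S \<subseteq> E \<and> hyperbalanced G S) A \<and> D = E - A" by blast
  qed
  finally show ?thesis .
qed

section \<open>Transfer of coatoms between the two matroids\<close>

text \<open>Being a coatom compares only ranks of supersets of \<open>A\<close>, so a constant
  offset cancels. The offset is 0 in a hyperbalanced graph and 1 above a hyperfrustrated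
  set.\<close>

lemma coatom_cong:
  assumes "ground M = ground N" and "A \<subseteq> ground N"
    and "\<And>S. A \<subseteq> S \<Longrightarrow> S \<subseteq> ground N \<Longrightarrow> rk M S = rk N S + c"
  shows "coatom M A \<longleftrightarrow> coatom N A"
proof -
  have "rk M (insert e A) = rk M A \<longleftrightarrow> rk N (insert e A) = rk N A" if "e \<in> ground N" for e
    using assms(3)[of A] assms(3)[OF subset_insertI, of e] assms(2) that by auto
  then have "clos M A = clos N A" using assms(1) unfolding clos_def by auto
  then show ?thesis using assms(3)[of A] assms(3)[of "ground N"] assms(1,2) unfolding coatom_def flat_def by auto
qed

lemma hyperbalanced_graph_coatom:
  assumes "hyperbalanced_graph G"
  shows "coatom (gain_matroid G) A \<longleftrightarrow> coatom (frame_matroid G) A"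
proof (cases "A \<subseteq> E")
  case True
  then show ?thesis
    using hyperbalanced_mono[OF assms] by (intro coatom_cong[where c = 0]) (auto simp: gain_rank)
next
  case False
  then show ?thesis unfolding coatom_def flat_def by simp
qed

lemma hyperfrustrated_coatom:
  assumes "hyperfrustrated G A"
  shows "coatom (gain_matroid G) A \<longleftrightarrow> coatom (frame_matroid G) A"
proof (cases "A \<subseteq> E")
  case True
  then show ?thesis
    using hyperbalanced_mono assms by (intro coatom_cong[where c = 1]) (auto simp: gain_rank)
next
  case False
  then show ?thesis unfolding coatom_def flat_def by simp
qed

text \<open>Choose \<open>A\<close> above \<open>C\<close> maximal with less than full rank. Every
  further edge completes the rank, and a single edge raises it by at most one.\<close>

lemma frame_coatom_above:
  assumes C: "C \<subseteq> E" "\<rho> C < \<rho> E"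
  shows "\<exists>A. C \<subseteq> A \<and> coatom (frame_matroid G) A"
proof -
  obtain A where A: "C \<subseteq> A" and AE: "A \<subseteq> E" and rA: "\<rho> A < \<rho> E"
    and max: "\<And>B. A \<subset> B \<Longrightarrow> B \<subseteq> E \<Longrightarrow> \<not> \<rho> B < \<rho> E"
    using maximal_subset[OF finite_edges C(1), of "\<lambda>A. \<rho> A < \<rho> E"] C(2)
    by metis
  have full: "\<rho> (insert e A) = \<rho> E" if e: "e \<in> E" "e \<notin> A" for e
  proof -
    have sub: "insert e A \<subseteq> E" using e AE by blast
    show ?thesis using max[of "insert e A"] e sub frame_rank_mono[OF sub subset_refl] by auto
  qed
  have "A \<noteq> E" using rA by blast
  then obtain e where e: "e \<in> E" "e \<notin> A" using AE by blast
  have "\<rho> A + 1 = \<rho> E"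
    using frame_rank_insert[of e A] full[OF e] rA AE e(1) by simp
  moreover have "\<rho> (insert e A) \<noteq> \<rho> A" if "e \<in> E" "e \<notin> A" for e
    using full[OF that] rA by simp
  then have "clos (frame_matroid G) A = A"
    using AE unfolding clos_def by (auto simp: insert_absorb)
  ultimately have "coatom (frame_matroid G) A" using AE unfolding coatom_def flat_def by simp
  then show ?thesis using A by blast
qed

text \<open>A hyperfrustrated coatom contains a non-neutral circuit and has less than full frame
  rank. Conversely, a frame coatom above such a circuit is hyperfrustrated because it contains the
  circuit.\<close>

lemma hyperfrustrated_coatom_exists_iff:
  "(\<exists>A. coatom (gain_matroid G) A \<and> hyperfrustrated G A) \<longleftrightarrow>
   (\<exists>C. sign_circuit G C \<and> \<not> neutral G C \<and> \<rho> C < \<rho> E)"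
proof
  assume "\<exists>A. coatom (gain_matroid G) A \<and> hyperfrustrated G A"
  then obtain A where A: "coatom (frame_matroid G) A" "hyperfrustrated G A" using hyperfrustrated_coatom by blast
  then obtain C where C: "sign_circuit G C" "\<not> neutral G C" "C \<subseteq> A" unfolding hyperbalanced_def by blast
  have "A \<subseteq> E" "\<rho> A < \<rho> E"
    using A(1) unfolding coatom_def flat_def by auto
  then have "\<rho> C < \<rho> E" using frame_rank_mono[OF C(3)] by simp
  then show "\<exists>C. sign_circuit G C \<and> \<not> neutral G C \<and> \<rho> C < \<rho> E"
    using C by blast
next
  assume "\<exists>C. sign_circuit G C \<and> \<not> neutral G C \<and> \<rho> C < \<rho> E"
  then obtain C where C: "sign_circuit G C" "\<not> neutral G C" "\<rho> C < \<rho> E"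
    by blast
  obtain A where A: "C \<subseteq> A" "coatom (frame_matroid G) A"
    using frame_coatom_above[OF sign_circuit_subset[OF C(1)] C(3)] by blast
  have "hyperfrustrated G A" using C A(1) unfolding hyperbalanced_def by blast
  then show "\<exists>A. coatom (gain_matroid G) A \<and> hyperfrustrated G A" using A(2) hyperfrustrated_coatom by blast
qed

end

section \<open>Cocircuits of the frame matroid\<close>

text \<open>By \<open>frame_rank_eq_iff\<close> this says that \<open>E - D\<close> has smaller
  frame rank than \<open>E\<close>; in terms of vectors the condition can be restricted to
  components and extended from them.\<close>

definition rank_lowering :: "('v, 'e, 'k::field) gain_signed_graph \<Rightarrow> 'e set \<Rightarrow> bool" where
  "rank_lowering G D \<longleftrightarrow> D \<subseteq> edges G \<and> (\<exists>\<theta>. nullv G (edges G - D) \<theta> \<and> \<not> nullv G (edges G) \<theta>)"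

lemma minimal_set_eqI:
  assumes "\<And>D. Q D \<Longrightarrow> P D" "\<And>D. P D \<Longrightarrow> \<exists>D'\<subseteq>D. Q D'"
  shows "minimal_set P D \<longleftrightarrow> minimal_set Q D"
proof
  assume P: "minimal_set P D"
  then obtain D' where D': "D' \<subseteq> D" "Q D'" using assms(2) unfolding minimal_set_def by meson
  then have "D' = D" using P assms(1)[OF D'(2)] unfolding minimal_set_def by auto
  then show "minimal_set Q D" using P D'(2) assms(1) unfolding minimal_set_def by auto
next
  assume Q: "minimal_set Q D"
  have "\<not> P B" if B: "B \<subset> D" for B
  proof
    assume "P B"
    then obtain D' where "D' \<subseteq> B" "Q D'" using assms(2) by meson
    then show False using Q B unfolding minimal_set_def by auto
  qed
  then show "minimal_set P D" using Q assms(1) unfolding minimal_set_def by simp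
qed

section \<open>Invariance under induced subgraphs and edge deletion\<close>

lemma inc_induced [simp]: "inc (induced G X) = inc G"
  by (intro ext) (simp add: inc_def induced_def)

lemma nullv_induced [simp]: "nullv (induced G X) = nullv G"
  by (intro ext) (simp add: nullv_def)

lemma potential_induced [simp]: "potential (induced G X) = potential G"
  by (intro ext) (simp add: potential_def, simp add: induced_def)

lemma potential_delete [simp]: "potential (delete_edges G D) = potential G"
  by (intro ext) (simp add: potential_def inc_def delete_edges_def)

lemma linked_induced_eq [simp]: "linked (induced G X) S = linked G S"
  by (simp add: linked_def induced_def)

lemma switching_induced [simp]: "switching (induced G X) = switching G"
  by (intro ext) (simp add: switching_def induced_def ordinary_edge_def)

lemma half_edge_induced [simp]: "half_edge (induced G X) = half_edge G"
  by (intro ext) (simp add: half_edge_def induced_def)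

lemma verts_induced [simp]: "verts (induced G X) = X"
  by (simp add: induced_def)

lemma edges_delete [simp]: "edges (delete_edges G D) = edges G - D"
  by (simp add: delete_edges_def)

lemma ends_induced [simp]: "ends (induced G X) = ends G"
  by (simp add: induced_def)

lemma induced_self:
  assumes "\<And>e. e \<in> edges G \<Longrightarrow> ends G e \<noteq> [] \<and> set (ends G e) \<subseteq> verts G"
  shows "induced G (verts G) = G"
proof -
  have "{e \<in> edges G. ends G e \<noteq> [] \<and> set (ends G e) \<subseteq> verts G} = edges G" using assms by blast
  then show ?thesis by (simp add: induced_def)
qed

context gain_graph
begin

lemma induced_subset: "edges (induced G X) \<subseteq> E"
  by (auto simp: induced_edges)

lemma gain_graph_induced:
  assumes "X \<subseteq> V"
  shows "gain_graph (induced G X)"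
proof
  have "finite X" using assms finite_verts finite_subset by blast
  then show "is_gain_signed_graph (induced G X)"
    using gsg induced_subset[of X] finite_subset[OF induced_subset[of X] finite_edges]
    unfolding is_gain_signed_graph_def is_signed_graph_def is_graph_def
    by (auto simp: induced_edges) (auto simp: induced_def half_edge_def loose_edge_def ordinary_edge_def)
qed (rule char_not_2)

lemma gain_graph_delete: "gain_graph (delete_edges G D)"
proof
  show "is_gain_signed_graph (delete_edges G D)"
    using gsg unfolding is_gain_signed_graph_def is_signed_graph_def is_graph_def
    by (auto simp: delete_edges_def half_edge_def loose_edge_def ordinary_edge_def)
qed (rule char_not_2)

lemma sign_balanced_mono: "sign_balanced G T \<Longrightarrow> S \<subseteq> T \<Longrightarrow> sign_balanced G S"
  unfolding sign_balanced_def by blast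

lemma sign_balanced_induced:
  assumes "X \<subseteq> V" "S \<subseteq> edges (induced G X)"
  shows "sign_balanced (induced G X) S \<longleftrightarrow> sign_balanced G S"
proof -
  interpret H: gain_graph "induced G X" by (rule gain_graph_induced[OF assms(1)])
  have "S \<subseteq> E" using assms(2) induced_subset by blast
  then show ?thesis
    unfolding H.sign_balanced_iff_switching[OF assms(2)] by (simp add: sign_balanced_iff_switching)
qed

text \<open>By minimality, returning any edge of \<open>D\<close> restores the full rank, and one
  edge raises the rank by at most one. Hence the rank drop is exactly one and the complement is
  closed.\<close>

lemma frame_cocircuit_iff: "cocircuit (frame_matroid G) D \<longleftrightarrow> minimal_set (rank_lowering G) D"
proof -
  let ?r = "\<rho>"
  have low: "rank_lowering G D \<longleftrightarrow> D \<subseteq> E \<and> ?r (E - D) < ?r E" for D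
    using frame_rank_eq_iff[of "E - D" E] frame_rank_mono[of "E - D" E]
    unfolding rank_lowering_def by (metis Diff_subset nat_less_le subset_refl)
  show ?thesis
  proof
    assume "cocircuit (frame_matroid G) D"
    then obtain A where A: "A \<subseteq> E" "clos (frame_matroid G) A = A" "?r A + 1 = ?r E"
      and D: "D = E - A" unfolding cocircuit_def coatom_def flat_def by auto
    have DA: "E - D = A" using A(1) D by blast
    have "\<not> rank_lowering G D'" if D': "D' \<subset> D" for D'
    proof -
      obtain e where e: "e \<in> D" "e \<notin> D'" using D' by blast
      have sub: "insert e A \<subseteq> E - D'" using A(1) D D' e by blast
      have "?r (insert e A) \<noteq> ?r A" using A(2) e(1) D unfolding clos_def by auto
      moreover have "?r A \<le> ?r (insert e A)" using sub by (intro frame_rank_mono) auto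
      moreover have "?r (insert e A) \<le> ?r (E - D')" using sub by (intro frame_rank_mono) auto
      ultimately show ?thesis using A(3) unfolding low by linarith
    qed
    then show "minimal_set (rank_lowering G) D" using A(3) D DA unfolding minimal_set_def low by auto
  next
    assume "minimal_set (rank_lowering G) D"
    then have D: "D \<subseteq> E" "?r (E - D) < ?r E"
      and min: "\<And>D'. D' \<subset> D \<Longrightarrow> \<not> rank_lowering G D'" unfolding minimal_set_def low by auto
    let ?A = "E - D"
    have full: "?r (insert e ?A) = ?r E" if e: "e \<in> D" for e
    proof -
      have "E - (D - {e}) = insert e ?A" using e D(1) by blast
      moreover have "\<not> rank_lowering G (D - {e})" using min[of "D - {e}"] e by blast
      ultimately have "\<not> ?r (insert e ?A) < ?r E" using D(1) unfolding low by auto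
      moreover have "?r (insert e ?A) \<le> ?r E" using e D(1) by (intro frame_rank_mono) auto
      ultimately show ?thesis by linarith
    qed
    have "D \<noteq> {}" using D(2) by auto
    then obtain e where e: "e \<in> D" by blast
    have "?r ?A + 1 = ?r E" using frame_rank_insert[of e ?A] full[OF e] D e by auto
    moreover have "?r (insert f ?A) \<noteq> ?r ?A" if "f \<in> E" "f \<notin> ?A" for f
      using full[of f] that D(2) by simp
    then have "clos (frame_matroid G) ?A = ?A" unfolding clos_def by (auto simp: insert_absorb)
    ultimately have "coatom (frame_matroid G) ?A" unfolding coatom_def flat_def by auto
    moreover have "D = E - ?A" using D(1) by blast
    ultimately show "cocircuit (frame_matroid G) D" unfolding cocircuit_def by auto
  qed
qed

lemma null_extend:
  assumes X: "\<And>e. e \<in> S \<Longrightarrow> set (ends G e) \<inter> X \<noteq> {} \<Longrightarrow> e \<in> T \<and> set (ends G e) \<subseteq> X"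
    and th: "nullv G T \<theta>"
  shows "nullv G S (\<lambda>v. if v \<in> X then \<theta> v else 0)"
  unfolding nullv_def
proof
  fix e assume e: "e \<in> S"
  show "inc G (\<lambda>v. if v \<in> X then \<theta> v else 0) e = 0"
  proof (cases "set (ends G e) \<inter> X = {}")
    case True
    then show ?thesis by (intro inc_zero) auto
  next
    case False
    then have "e \<in> T" "set (ends G e) \<subseteq> X" using X[OF e] by auto
    moreover have "inc G (\<lambda>v. if v \<in> X then \<theta> v else 0) e = inc G \<theta> e"
      using calculation(2) by (intro inc_cong) auto
    ultimately show ?thesis using th unfolding nullv_def by simp
  qed
qed

text \<open>A witness for lowering the rank is nonzero on some edge, and the part of
  \<open>D\<close> in the component of that edge already lowers the rank. In the other direction a
  witness on a component extends by zero.\<close>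

lemma cocircuit_components:
  "cocircuit (frame_matroid G) D \<longleftrightarrow>
    (\<exists>X\<in>components G E. cocircuit (frame_matroid (induced G X)) D)"
proof -
  have ind: "cocircuit (frame_matroid (induced G X)) D \<longleftrightarrow> minimal_set (rank_lowering (induced G X)) D"
    if "X \<in> components G E" for X D
    using gain_graph.frame_cocircuit_iff[OF gain_graph_induced[OF component_verts[OF that]]] .
  have lift: "rank_lowering G D" if X: "X \<in> components G E" and D: "rank_lowering (induced G X) D" for X D
  proof -
    obtain \<theta> e where D: "D \<subseteq> edges (induced G X)" and th: "nullv G (edges (induced G X) - D) \<theta>"
      and e: "e \<in> edges (induced G X)" "inc G \<theta> e \<noteq> 0"
      using D unfolding rank_lowering_def nullv_induced by (auto simp: nullv_def)
    let ?t = "\<lambda>v. if v \<in> X then \<theta> v else 0"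
    have "nullv G (E - D) ?t"
    proof (rule null_extend[OF _ th])
      fix f assume f: "f \<in> E - D" "set (ends G f) \<inter> X \<noteq> {}"
      then have "set (ends G f) \<subseteq> X" using component_ends[OF subset_refl X] by blast
      moreover have "ends G f \<noteq> []" using f(2) by auto
      ultimately show "f \<in> edges (induced G X) - D \<and> set (ends G f) \<subseteq> X"
        using f by (simp add: induced_edges)
    qed
    moreover have "inc G ?t e = inc G \<theta> e" using e(1) by (intro inc_cong) (auto simp: induced_edges)
    then have "inc G ?t e \<noteq> 0" "e \<in> E" using e induced_subset[of X] by auto
    then have "\<not> nullv G E ?t" unfolding nullv_def by blast
    moreover have "D \<subseteq> E" using D induced_subset by blast
    ultimately show ?thesis unfolding rank_lowering_def by blast
  qed
  have descend: "rank_lowering (induced G X) (D \<inter> edges (induced G X))"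
    if D: "nullv G (E - D) \<theta>" and e: "e \<in> edges (induced G X)" "inc G \<theta> e \<noteq> 0" for X D \<theta> e
  proof -
    have "nullv G (edges (induced G X) - D \<inter> edges (induced G X)) \<theta>"
      using D induced_subset[of X] unfolding nullv_def by blast
    then show ?thesis using e unfolding rank_lowering_def nullv_induced by (auto simp: nullv_def)
  qed
  show ?thesis
  proof
    assume "cocircuit (frame_matroid G) D"
    then have D: "rank_lowering G D" and min: "\<And>D'. D' \<subset> D \<Longrightarrow> \<not> rank_lowering G D'"
      unfolding frame_cocircuit_iff minimal_set_def by auto
    obtain \<theta> where th: "nullv G (E - D) \<theta>" and "\<not> nullv G E \<theta>"
      using D unfolding rank_lowering_def by blast
    then obtain e where e: "e \<in> E" "inc G \<theta> e \<noteq> 0" unfolding nullv_def by blast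
    have "ends G e \<noteq> []" using e(2) inc_loose[of e \<theta>] unfolding loose_edge_def by blast
    then obtain x where x: "x \<in> set (ends G e)" by (cases "ends G e") auto
    then have xv: "x \<in> V" using ends_verts[OF e(1)] by blast
    let ?X = "component_of G E x"
    have X: "?X \<in> components G E" using xv unfolding components_eq by blast
    have "set (ends G e) \<subseteq> ?X" using component_of_ends[OF subset_refl e(1)] x component_of_self[OF xv] by blast
    then have eX: "e \<in> edges (induced G ?X)" using e(1) \<open>ends G e \<noteq> []\<close> unfolding induced_edges by blast
    have D': "rank_lowering (induced G ?X) (D \<inter> edges (induced G ?X))" by (rule descend[OF th eX e(2)])
    then have "D \<inter> edges (induced G ?X) = D" using lift[OF X D'] min by blast
    then have "minimal_set (rank_lowering (induced G ?X)) D"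
      using D' lift[OF X] min unfolding minimal_set_def by auto
    then show "\<exists>X\<in>components G E. cocircuit (frame_matroid (induced G X)) D" using X ind by blast
  next
    assume "\<exists>X\<in>components G E. cocircuit (frame_matroid (induced G X)) D"
    then obtain X where X: "X \<in> components G E" and D: "rank_lowering (induced G X) D"
      and min: "\<And>D'. D' \<subset> D \<Longrightarrow> \<not> rank_lowering (induced G X) D'"
      unfolding minimal_set_def using ind minimal_set_def by metis
    have DX: "D \<subseteq> edges (induced G X)" using D unfolding rank_lowering_def by blast
    have "\<not> rank_lowering G D'" if D': "D' \<subset> D" for D'
    proof
      assume "rank_lowering G D'"
      then obtain \<theta> where th: "nullv G (E - D') \<theta>" and "\<not> nullv G E \<theta>"
        unfolding rank_lowering_def by blast
      then obtain e where e: "e \<in> E" "inc G \<theta> e \<noteq> 0" unfolding nullv_def by blast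
      have "e \<in> D'" using th e unfolding nullv_def by blast
      then have "e \<in> edges (induced G X)" using D' DX by blast
      then have "rank_lowering (induced G X) (D' \<inter> edges (induced G X))" by (rule descend[OF th _ e(2)])
      moreover have "D' \<inter> edges (induced G X) = D'" using D' DX by blast
      ultimately show False using min[OF D'] by simp
    qed
    then show "cocircuit (frame_matroid G) D"
      using lift[OF X D] unfolding frame_cocircuit_iff minimal_set_def by blast
  qed
qed

text \<open>No edge joins \<open>X\<close> to its complement, so potentials of the two parts glue.
  Loose edges lie in \<open>delete_component G X\<close>, because induced subgraphs contain
  none.\<close>

lemma hyperbalanced_split:
  assumes X: "X \<in> components G E" and D: "D \<subseteq> edges (induced G X)"
  shows "hyperbalanced G (E - D) \<longleftrightarrow>
    hyperbalanced_graph (delete_component G X) \<and> hyperbalanced_graph (delete_edges (induced G X) D)"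
proof -
  let ?EX = "edges (induced G X)"
  interpret H: gain_graph "induced G X" by (rule gain_graph_induced[OF component_verts[OF X]])
  interpret H1: gain_graph "delete_edges G ?EX" by (rule gain_graph_delete)
  interpret H2: gain_graph "delete_edges (induced G X) D" by (rule H.gain_graph_delete)
  have 0: "hyperbalanced G (E - D) \<longleftrightarrow> (\<exists>\<theta>. potential G (E - D) \<theta>)"
    by (rule hyperbalanced_iff_potential) blast
  have 1: "hyperbalanced_graph (delete_component G X) \<longleftrightarrow> (\<exists>\<theta>. potential G (E - ?EX) \<theta>)"
    using H1.hyperbalanced_iff_potential[OF subset_refl] unfolding delete_component_def by simp
  have 2: "hyperbalanced_graph (delete_edges (induced G X) D) \<longleftrightarrow> (\<exists>\<theta>. potential G (?EX - D) \<theta>)"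
    using H2.hyperbalanced_iff_potential[OF subset_refl] by simp
  show ?thesis unfolding 0 1 2
  proof
    assume "\<exists>\<theta>. potential G (E - D) \<theta>"
    then show "(\<exists>\<theta>. potential G (E - ?EX) \<theta>) \<and> (\<exists>\<theta>. potential G (?EX - D) \<theta>)"
      using D induced_subset[of X] unfolding potential_def by blast
  next
    assume "(\<exists>\<theta>. potential G (E - ?EX) \<theta>) \<and> (\<exists>\<theta>. potential G (?EX - D) \<theta>)"
    then obtain \<theta> \<eta> where th: "potential G (E - ?EX) \<theta>" and eta: "potential G (?EX - D) \<eta>" by blast
    let ?t = "\<lambda>v. if v \<in> X then \<eta> v else \<theta> v"
    have "gain G e = inc G ?t e" if e: "e \<in> E - D" for e
    proof (cases "e \<in> ?EX")
      case True
      then have "inc G ?t e = inc G \<eta> e" by (intro inc_cong) (auto simp: induced_edges)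
      then show ?thesis using eta True e unfolding potential_def by simp
    next
      case False
      then have "set (ends G e) \<inter> X = {}"
        using component_ends[OF subset_refl X, of e] e unfolding induced_edges by fastforce
      then have "inc G ?t e = inc G \<theta> e" by (intro inc_cong) auto
      then show ?thesis using th False e unfolding potential_def by simp
    qed
    then show "\<exists>\<theta>. potential G (E - D) \<theta>" unfolding potential_def by blast
  qed
qed

section \<open>Connectivity, cuts and bonds\<close>

lemma connected_graph_iff:
  "connected_graph G \<longleftrightarrow> V \<noteq> {} \<and> (\<forall>u\<in>V. \<forall>w\<in>V. (u, w) \<in> linked G E)"
proof
  assume "connected_graph G"
  then obtain X where X: "component_of G E ` V = {X}"
    unfolding connected_graph_def components_eq by blast
  have "(u, w) \<in> linked G E" if uw: "u \<in> V" "w \<in> V" for u w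
  proof -
    have "component_of G E u = component_of G E w" using X uw by blast
    then show ?thesis using component_of_self[OF uw(2), of E] unfolding component_of_def by blast
  qed
  then show "V \<noteq> {} \<and> (\<forall>u\<in>V. \<forall>w\<in>V. (u, w) \<in> linked G E)" using X by auto
next
  assume R: "V \<noteq> {} \<and> (\<forall>u\<in>V. \<forall>w\<in>V. (u, w) \<in> linked G E)"
  then have "component_of G E u = V" if "u \<in> V" for u
    using that unfolding component_of_def by blast
  then have "component_of G E ` V = {V}" using R by auto
  then show "connected_graph G" unfolding connected_graph_def components_eq by blast
qed

lemma linked_within:
  assumes "(u, w) \<in> linked G S" "u \<in> X" and S: "S \<subseteq> E"
    and X: "\<And>e. e \<in> S \<Longrightarrow> set (ends G e) \<inter> X \<noteq> {} \<Longrightarrow> set (ends G e) \<subseteq> X"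
  shows "(u, w) \<in> linked G (S \<inter> edges (induced G X))"
proof -
  let ?T = "S \<inter> edges (induced G X)"
  have "w \<in> {w \<in> X. (u, w) \<in> linked G ?T}"
  proof (rule linked_invariant[OF assms(1)])
    show "u \<in> {w \<in> X. (u, w) \<in> linked G ?T}" using assms(2) by simp
    fix e x y assume e: "e \<in> S" "set (ends G e) = {x, y}" and x: "x \<in> {w \<in> X. (u, w) \<in> linked G ?T}"
    have sub: "set (ends G e) \<subseteq> X" using X[OF e(1)] e(2) x by blast
    moreover have "ends G e \<noteq> []" using e(2) by auto
    ultimately have eT: "e \<in> ?T" using e(1) S unfolding Int_iff induced_edges by blast
    have "(x, y) \<in> linked G ?T" by (rule edge_linked[OF _ eT]) (use S e(2) in auto)
    then have "(u, y) \<in> linked G ?T" using x linked_trans by (metis (lifting) mem_Collect_eq)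
    then show "y \<in> {w \<in> X. (u, w) \<in> linked G ?T}" using sub e(2) by simp
  qed
  then show ?thesis by simp
qed

lemma between_subset: "between G Y \<subseteq> E"
  unfolding between_def by blast

lemma between_ends:
  assumes "e \<in> between G Y"
  obtains x y where "x \<in> set (ends G e)" "x \<in> Y" "y \<in> set (ends G e)" "y \<in> V" "y \<notin> Y"
  using assms unfolding between_def by blast

lemma not_between_ends: "e \<in> E \<Longrightarrow> e \<notin> between G Y \<Longrightarrow> set (ends G e) \<inter> Y \<noteq> {} \<Longrightarrow> set (ends G e) \<subseteq> Y"
  using ends_verts[of e] unfolding between_def by blast

lemma between_disjoint_induced: "between G Y \<inter> edges (induced G Y) = {}" "between G Y \<inter> edges (induced G (V - Y)) = {}"
  unfolding between_def by (auto simp: induced_edges)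

lemma cut_switching_null:
  assumes "sign_balanced G (edges (induced G Y) - D)"
  shows "\<exists>\<theta>. nullv G (E - (between G Y \<union> D)) \<theta> \<and> (\<forall>v. v \<notin> Y \<longrightarrow> \<theta> v = 0) \<and>
    (\<forall>v\<in>Y. \<theta> v = 1 \<or> \<theta> v = -1)"
proof (rule switching_null)
  show "sign_balanced G ((E - (between G Y \<union> D)) \<inter> edges (induced G Y))"
    by (rule sign_balanced_mono[OF assms]) blast
qed (use not_between_ends in blast)+

lemma between_nonempty:
  assumes "connected_graph G" "Y \<subseteq> V" "Y \<noteq> {}" "Y \<noteq> V"
  shows "between G Y \<noteq> {}"
proof
  assume none: "between G Y = {}"
  obtain u w where u: "u \<in> Y" and w: "w \<in> V" "w \<notin> Y" using assms by blast
  have "(u, w) \<in> linked G E" using assms(1,2) u w(1) unfolding connected_graph_iff by blast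
  then have "w \<in> Y"
  proof (rule linked_invariant[OF _ u])
    fix e x y assume e: "e \<in> E" "set (ends G e) = {x, y}" "x \<in> Y"
    have "e \<notin> between G Y" using none by blast
    from not_between_ends[OF e(1) this] show "y \<in> Y" using e(2,3) by auto
  qed
  then show False using w(2) by blast
qed

lemma component_between:
  assumes S: "S \<subseteq> E"
  shows "between G (component_of G S u) \<subseteq> E - S"
proof
  fix e assume e: "e \<in> between G (component_of G S u)"
  have "e \<notin> S"
  proof
    assume "e \<in> S"
    then have "set (ends G e) \<inter> component_of G S u \<noteq> {} \<Longrightarrow> set (ends G e) \<subseteq> component_of G S u"
      by (rule component_of_ends[OF S])
    then show False using e unfolding between_def by blast
  qed
  then show "e \<in> E - S" using e between_subset by blast
qed

text \<open>If removing \<open>D\<close> separated \<open>u\<close> from \<open>w\<close>, some edge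
  of \<open>D\<close> would join two components of what remains. Putting it back keeps the rest
  balanced by \<open>switching_insert\<close>, contrary to minimality.\<close>

lemma minimal_deletion_connected:
  assumes conn: "connected_graph G" and D: "minimal_set (deletion_set G) D"
    and uw: "u \<in> V" "w \<in> V"
  shows "(u, w) \<in> linked G (E - D)"
proof (rule ccontr)
  assume nl: "(u, w) \<notin> linked G (E - D)"
  let ?S = "E - D"
  have S: "?S \<subseteq> E" by blast
  have DE: "D \<subseteq> E" and bal: "sign_balanced G ?S" and min: "\<And>D'. D' \<subset> D \<Longrightarrow> \<not> deletion_set G D'"
    using D unfolding minimal_set_def deletion_set_def by auto
  let ?Y = "component_of G ?S u"
  have "?Y \<subseteq> V" "u \<in> ?Y" "w \<notin> ?Y" using component_of_self[OF uw(1)] nl unfolding component_of_def by auto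
  then obtain e where e: "e \<in> between G ?Y" using between_nonempty[OF conn, of ?Y] uw(2) by blast
  then have eD: "e \<in> D" "e \<in> E" using component_between[OF S, of u] by auto
  obtain x y where xy: "x \<in> set (ends G e)" "x \<in> ?Y" "y \<in> set (ends G e)" "y \<in> V" "y \<notin> ?Y"
    by (rule between_ends[OF e])
  have nxy: "(x, y) \<notin> linked G ?S"
  proof
    assume "(x, y) \<in> linked G ?S"
    then have "(u, y) \<in> linked G ?S" using xy(2) linked_trans unfolding component_of_def by (metis (lifting) mem_Collect_eq)
    then show False using xy(4,5) unfolding component_of_def by blast
  qed
  have o: "ordinary_edge G e"
  proof (cases rule: edge_kinds[OF eD(2)])
    case 1
    then show ?thesis using xy(1) by (simp add: loose_edge_def)
  next
    case (2 v)
    then show ?thesis using xy by auto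
  qed
  have "{x, y} = {ends G e ! 0, ends G e ! 1}"
    using set_ends_step[OF o, of 0] xy by auto
  then have "(ends G e ! 0, ends G e ! 1) \<notin> linked G ?S"
    using nxy linked_sym by (metis doubleton_eq_iff)
  moreover obtain s where "switching G ?S s" and nh: "\<forall>h\<in>?S. \<not> half_edge G h"
    using bal unfolding sign_balanced_iff_switching[OF S] by blast
  ultimately obtain s' where "switching G (insert e ?S) s'" using switching_insert[OF S _ eD(2)] by blast
  moreover have "\<not> half_edge G e" using o by (simp add: half_edge_def ordinary_edge_def)
  moreover have eq: "E - (D - {e}) = insert e ?S" using eD DE by blast
  moreover have "insert e ?S \<subseteq> E" using eD by blast
  ultimately have "sign_balanced G (E - (D - {e}))"
    using nh unfolding eq by (subst sign_balanced_iff_switching) blast+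
  then have "deletion_set G (D - {e})" using DE unfolding deletion_set_def by blast
  then show False using min[of "D - {e}"] eD(1) by blast
qed

text \<open>Every cut lowers the rank and every set that lowers the rank contains a cut, so both families
  have the same minimal members.\<close>

lemma balanced_cocircuit_bond:
  assumes conn: "connected_graph G" and bal: "sign_balanced G E"
  shows "cocircuit (frame_matroid G) D \<longleftrightarrow> bond G D"
  unfolding frame_cocircuit_iff bond_def
proof (rule minimal_set_eqI)
  fix D assume "cut G D"
  then obtain Y where Y: "Y \<subseteq> V" "D = between G Y" "D \<noteq> {}" unfolding cut_def by blast
  have "sign_balanced G (edges (induced G Y) - {})" using sign_balanced_mono[OF bal] induced_subset by simp
  from cut_switching_null[OF this] obtain \<theta> where th: "nullv G (E - D) \<theta>"
    "\<And>v. v \<notin> Y \<Longrightarrow> \<theta> v = 0" "\<And>v. v \<in> Y \<Longrightarrow> \<theta> v = 1 \<or> \<theta> v = -1"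
    unfolding Un_empty_right Y(2)[symmetric] by blast
  obtain e where e: "e \<in> between G Y" using Y by blast
  obtain x y where xy: "x \<in> set (ends G e)" "x \<in> Y" "y \<in> set (ends G e)" "y \<notin> Y" by (rule between_ends[OF e])
  have "e \<in> E" using e between_subset by blast
  then have "inc G \<theta> e \<noteq> 0"
    using null_step[of e \<theta> y x] xy th(2)[OF xy(4)] th(3)[OF xy(2)] by auto
  then show "rank_lowering G D" using th(1) e between_subset[of Y] Y(2) unfolding rank_lowering_def nullv_def by blast
next
  fix D assume "rank_lowering G D"
  then obtain \<theta> e where D: "D \<subseteq> E" and th: "nullv G (E - D) \<theta>" and e: "e \<in> E" "inc G \<theta> e \<noteq> 0"
    unfolding rank_lowering_def nullv_def by blast
  obtain u where u: "u \<in> set (ends G e)" using e(2) inc_zero[of e \<theta>] by blast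
  then have uv: "u \<in> V" using ends_verts[OF e(1)] by blast
  have "sign_balanced G (E \<inter> edges (induced G V))" by (rule sign_balanced_mono[OF bal]) blast
  from switching_null[OF subset_refl ends_verts this]
  obtain \<eta> where eta: "nullv G E \<eta>" "\<And>v. v \<in> V \<Longrightarrow> \<eta> v = 1 \<or> \<eta> v = -1" by blast
  \<comment> \<open>As \<open>\<eta> u\<close> is 1 or -1, subtracting \<open>c\<close> times
    \<open>\<eta>\<close> makes the difference vanish at \<open>u\<close>. If all vertices were
    linked to \<open>u\<close> outside \<open>D\<close>, the difference would vanish everywhere,
    including on \<open>e\<close>.\<close>
  define c where "c = \<theta> u * \<eta> u"
  let ?d = "\<lambda>v. \<theta> v - c * \<eta> v"
  have d: "nullv G (E - D) ?d" using th eta(1) unfolding nullv_def inc_diff inc_scale by simp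
  have du: "?d u = 0" using eta(2)[OF uv] unfolding c_def by auto
  obtain w where w: "w \<in> V" "(u, w) \<notin> linked G (E - D)"
  proof (rule ccontr)
    assume "\<not> thesis"
    then have all: "\<And>w. w \<in> V \<Longrightarrow> (u, w) \<in> linked G (E - D)" using that by blast
    have "?d v = 0" if "v \<in> V" for v
      using null_linked[OF _ d all[OF that]] du by auto
    then have "inc G ?d e = 0" using ends_verts[OF e(1)] by (intro inc_zero) blast
    then show False using e eta(1) unfolding inc_diff inc_scale nullv_def by simp
  qed
  let ?Y = "component_of G (E - D) u"
  have "?Y \<subseteq> V" "u \<in> ?Y" "w \<notin> ?Y" using component_of_self[OF uv] w(2) unfolding component_of_def by auto
  then have "cut G (between G ?Y)" using between_nonempty[OF conn, of ?Y] w(1) unfolding cut_def by blast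
  moreover have "between G ?Y \<subseteq> D" using component_between[of "E - D" u] D by blast
  ultimately show "\<exists>D'\<subseteq>D. cut G D'" by blast
qed

section \<open>Sign-unbalanced connected graphs\<close>

lemma unbalanced_null:
  assumes "connected_graph G" "\<not> sign_balanced G E" "nullv G E \<theta>" "v \<in> V"
  shows "\<theta> v = 0"
proof (rule ccontr)
  assume nz: "\<theta> v \<noteq> 0"
  have "sign_balanced G E"
  proof (rule null_balanced[OF subset_refl assms(3) _ nz])
    fix e x assume "e \<in> E" "x \<in> set (ends G e)"
    then have "(v, x) \<in> linked G E" using assms(1,4) ends_verts unfolding connected_graph_iff by blast
    then show "\<theta> x = \<theta> v \<or> \<theta> x = - \<theta> v" by (rule null_linked[OF subset_refl assms(3)])
  qed
  then show False using assms(2) by blast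
qed

lemma rank_lowering_unbalanced:
  assumes conn: "connected_graph G" and unbal: "\<not> sign_balanced G E"
  shows "rank_lowering G D \<longleftrightarrow> D \<subseteq> E \<and> (\<exists>\<theta>. nullv G (E - D) \<theta> \<and> (\<exists>v\<in>V. \<theta> v \<noteq> 0))"
proof -
  have "nullv G E \<theta> \<longleftrightarrow> (\<forall>v\<in>V. \<theta> v = 0)" for \<theta>
    using unbalanced_null[OF assms] inc_zero ends_verts unfolding nullv_def by blast
  then show ?thesis unfolding rank_lowering_def by auto
qed

text \<open>The sets \<open>between G Y \<union> D1\<close> are of type D2 if \<open>Y\<close> is the whole vertex set, of type D3 if
  \<open>D1\<close> is empty, and of type D4 otherwise.\<close>

definition cut_deletion :: "'v set \<Rightarrow> 'e set \<Rightarrow> bool" where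
  "cut_deletion Y D1 \<longleftrightarrow> Y \<subseteq> V \<and> connected_graph (induced G Y) \<and>
     balanced_components (induced G (V - Y)) (edges (induced G (V - Y))) = {} \<and>
     minimal_set (deletion_set (induced G Y)) D1"

lemma balanced_component_induced:
  assumes Y: "Y \<subseteq> V" and th: "nullv G (edges (induced G Y)) \<theta>" "v \<in> Y" "\<theta> v \<noteq> 0"
  shows "balanced_components (induced G Y) (edges (induced G Y)) \<noteq> {}"
proof -
  interpret H: gain_graph "induced G Y" by (rule gain_graph_induced[OF Y])
  let ?Z = "component_of (induced G Y) (edges (induced G Y)) v"
  have v: "v \<in> verts (induced G Y)" using th(2) by simp
  have Z: "?Z \<in> components (induced G Y) (edges (induced G Y))" using v unfolding components_eq by blast
  have "v \<in> ?Z" by (rule H.component_of_self[OF v])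
  then have "?Z \<in> balanced_components (induced G Y) (edges (induced G Y))"
    using H.component_balanced_iff[OF subset_refl Z] th Z unfolding balanced_components_def by auto
  then show ?thesis by blast
qed

text \<open>For minimality take a witness \<open>\<eta>\<close> for a smaller set \<open>D'\<close>.
  It vanishes off \<open>Y\<close>, where no component is balanced, and is constant up to sign on
  \<open>Y\<close>, which stays connected after deleting \<open>D1\<close>. So it is nonzero on
  every cut edge, which puts the whole cut into \<open>D'\<close>, and inside \<open>Y\<close> the
  set \<open>D'\<close> would be a smaller deletion set.\<close>

lemma cut_deletion_cocircuit:
  assumes conn: "connected_graph G" and unbal: "\<not> sign_balanced G E"
    and cd: "cut_deletion Y D1"
  shows "minimal_set (rank_lowering G) (between G Y \<union> D1)"
proof -
  have Y: "Y \<subseteq> V" and c1: "connected_graph (induced G Y)"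
    and nob: "balanced_components (induced G (V - Y)) (edges (induced G (V - Y))) = {}"
    and min: "minimal_set (deletion_set (induced G Y)) D1"
    using cd unfolding cut_deletion_def by auto
  interpret H: gain_graph "induced G Y" by (rule gain_graph_induced[OF Y])
  let ?E1 = "edges (induced G Y)" and ?E2 = "edges (induced G (V - Y))"
  let ?D = "between G Y \<union> D1"
  have D1: "D1 \<subseteq> ?E1" and bal: "sign_balanced (induced G Y) (?E1 - D1)"
    and min1: "\<And>D'. D' \<subset> D1 \<Longrightarrow> \<not> deletion_set (induced G Y) D'"
    using min unfolding minimal_set_def deletion_set_def by auto
  have bal': "sign_balanced G (?E1 - D1)" using bal sign_balanced_induced[OF Y] by blast
  have link: "(u, w) \<in> linked G (?E1 - D1)" if "u \<in> Y" "w \<in> Y" for u w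
    using H.minimal_deletion_connected[OF c1 min, of u w] that by simp
  have DE: "?D \<subseteq> E" using between_subset D1 induced_subset by blast
  obtain \<theta> where th: "nullv G (E - ?D) \<theta>" "\<And>v. v \<in> Y \<Longrightarrow> \<theta> v = 1 \<or> \<theta> v = -1"
    using cut_switching_null[OF bal'] by blast
  obtain y0 where y0: "y0 \<in> Y" using c1 unfolding H.connected_graph_iff by auto
  have "\<theta> y0 \<noteq> 0" using th(2)[OF y0] by auto
  then have low: "rank_lowering G ?D"
    using th(1) DE y0 Y unfolding rank_lowering_unbalanced[OF conn unbal] by blast
  have "\<not> rank_lowering G D'" if D': "D' \<subset> ?D" for D'
  proof
    assume "rank_lowering G D'"
    then obtain \<eta> v where eta: "nullv G (E - D') \<eta>" "v \<in> V" "\<eta> v \<noteq> 0"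
      unfolding rank_lowering_unbalanced[OF conn unbal] by blast
    have "?E2 \<inter> ?E1 = {}" by (auto simp: induced_edges) (metis Diff_iff last_in_set subsetD)
    then have E2: "?E2 \<subseteq> E - D'"
      using D' D1 between_disjoint_induced(2)[of Y] induced_subset[of "V - Y"] by blast
    have null2: "nullv G ?E2 \<eta>" using eta(1) E2 unfolding nullv_def by blast
    have off: "\<eta> w = 0" if "w \<in> V - Y" for w
      using balanced_component_induced[OF Diff_subset null2 that] nob by blast
    have vY: "v \<in> Y" using off[of v] eta(2,3) by blast
    have E1: "?E1 - D1 \<subseteq> E - D'"
      using D' between_disjoint_induced(1)[of Y] induced_subset[of Y] by blast
    have null1: "nullv G (?E1 - D1) \<eta>" using eta(1) E1 unfolding nullv_def by blast
    have on: "\<eta> w = \<eta> v \<or> \<eta> w = - \<eta> v" if "w \<in> Y" for w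
      using induced_subset[of Y] by (intro null_linked[OF _ null1 link[OF vY that]]) blast
    have bt: "between G Y \<subseteq> D'"
    proof
      fix e assume e: "e \<in> between G Y"
      obtain x y where xy: "x \<in> set (ends G e)" "x \<in> Y" "y \<in> set (ends G e)" "y \<in> V" "y \<notin> Y"
        by (rule between_ends[OF e])
      have "e \<in> E" using e between_subset by blast
      then have "inc G \<eta> e \<noteq> 0"
        using null_step[of e \<eta> y x] xy off[of y] on[OF xy(2)] eta(3) by auto
      then show "e \<in> D'" using eta(1) e between_subset unfolding nullv_def by blast
    qed
    let ?D1 = "D' \<inter> ?E1"
    have "?D1 \<subset> D1" using D' bt between_disjoint_induced(1)[of Y] by blast
    moreover have "sign_balanced G (?E1 - ?D1)"
    proof (rule null_balanced[OF _ _ _ eta(3)])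
      show "nullv G (?E1 - ?D1) \<eta>" using eta(1) induced_subset[of Y] unfolding nullv_def by blast
      show "\<eta> x = \<eta> v \<or> \<eta> x = - \<eta> v" if "e \<in> ?E1 - ?D1" "x \<in> set (ends G e)" for e x
        using on[of x] that by (auto simp: induced_edges)
    qed (use induced_subset[of Y] in blast)
    then have "deletion_set (induced G Y) ?D1"
      using sign_balanced_induced[OF Y, of "?E1 - ?D1"] unfolding deletion_set_def by blast
    ultimately show False using min1 by blast
  qed
  then show ?thesis using low unfolding minimal_set_def by blast
qed

text \<open>\<open>Y\<close> is the component, in \<open>E - D\<close>, of a vertex where the
  witness \<theta> is nonzero. Cutting \<theta> off outside \<open>Y\<close> still gives a witness
  for the cut together with the edges of \<open>D\<close> inside \<open>Y\<close>, so minimality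
  makes these all of \<open>D\<close>. Since \<theta> is constant up to sign on \<open>Y\<close>,
  those inner edges form a deletion set.\<close>

lemma cocircuit_cut_deletion:
  assumes conn: "connected_graph G" and unbal: "\<not> sign_balanced G E"
    and D: "minimal_set (rank_lowering G) D"
  shows "\<exists>Y D1. cut_deletion Y D1 \<and> D = between G Y \<union> D1"
proof -
  have low: "rank_lowering G D" and min: "\<And>D'. D' \<subset> D \<Longrightarrow> \<not> rank_lowering G D'"
    using D unfolding minimal_set_def by auto
  obtain \<theta> v where DE: "D \<subseteq> E" and th: "nullv G (E - D) \<theta>" "v \<in> V" "\<theta> v \<noteq> 0"
    using low unfolding rank_lowering_unbalanced[OF conn unbal] by blast
  let ?S = "E - D"
  have S: "?S \<subseteq> E" by blast
  define Y where "Y = component_of G ?S v"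
  let ?E1 = "edges (induced G Y)" and ?E2 = "edges (induced G (V - Y))"
  have Y: "Y \<subseteq> V" and vY: "v \<in> Y" using component_of_self[OF th(2)] unfolding Y_def component_of_def by auto
  interpret H: gain_graph "induced G Y" by (rule gain_graph_induced[OF Y])
  have closed: "set (ends G e) \<subseteq> Y" if "e \<in> ?S" "set (ends G e) \<inter> Y \<noteq> {}" for e
    using component_of_ends[OF S] that unfolding Y_def by blast
  have on: "\<theta> w = \<theta> v \<or> \<theta> w = - \<theta> v" if "w \<in> Y" for w
    using that unfolding Y_def component_of_def by (intro null_linked[OF S th(1)]) blast
  have bt: "between G Y \<subseteq> D" using component_between[OF S, of v] DE unfolding Y_def by blast
  define D1 where "D1 = D \<inter> ?E1"
  let ?t = "\<lambda>x. if x \<in> Y then \<theta> x else 0"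
  have inside: "e \<in> ?E1 \<and> set (ends G e) \<subseteq> Y" if e: "e \<in> E - between G Y" "set (ends G e) \<inter> Y \<noteq> {}" for e
  proof -
    have "set (ends G e) \<subseteq> Y" using not_between_ends[of e Y] e by blast
    moreover have "ends G e \<noteq> []" using e(2) by auto
    ultimately show ?thesis using e(1) unfolding induced_edges by blast
  qed
  have "nullv G (E - (between G Y \<union> D1)) ?t"
    by (rule null_extend[OF _ th(1)]) (use inside in \<open>auto simp: D1_def\<close>)
  then have "rank_lowering G (between G Y \<union> D1)"
    using vY th(2,3) between_subset[of Y] DE unfolding rank_lowering_unbalanced[OF conn unbal] D1_def
    by (intro conjI exI[of _ ?t]) auto
  moreover have "between G Y \<union> D1 \<subseteq> D" using bt unfolding D1_def by blast
  ultimately have Deq: "D = between G Y \<union> D1" using min by blast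
  have SE1: "?S \<inter> ?E1 = ?E1 - D1" using induced_subset[of Y] unfolding D1_def by blast
  have link: "(u, w) \<in> linked G (?E1 - D1)" if uw: "u \<in> Y" "w \<in> Y" for u w
  proof -
    have "(v, u) \<in> linked G ?S" "(v, w) \<in> linked G ?S" using uw unfolding Y_def component_of_def by auto
    then have "(u, w) \<in> linked G ?S" using linked_sym linked_trans by metis
    then have "(u, w) \<in> linked G (?S \<inter> ?E1)" by (rule linked_within[OF _ uw(1) S closed])
    then show ?thesis unfolding SE1 .
  qed
  have c1: "connected_graph (induced G Y)"
    unfolding H.connected_graph_iff using link linked_mono[of "?E1 - D1" ?E1 G] vY by auto
  have "sign_balanced G (?E1 - D1)"
  proof (rule null_balanced[OF _ _ _ th(3)])
    show "nullv G (?E1 - D1) \<theta>" using th(1) unfolding SE1[symmetric] nullv_def by blast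
    show "\<theta> x = \<theta> v \<or> \<theta> x = - \<theta> v" if "e \<in> ?E1 - D1" "x \<in> set (ends G e)" for e x
      using on[of x] that by (auto simp: induced_edges)
  qed (use induced_subset[of Y] in blast)
  then have del: "deletion_set (induced G Y) D1"
    using sign_balanced_induced[OF Y, of "?E1 - D1"] unfolding deletion_set_def D1_def by blast
  have "\<not> deletion_set (induced G Y) D'" if D': "D' \<subset> D1" for D'
  proof
    assume "deletion_set (induced G Y) D'"
    then have "sign_balanced (induced G Y) (?E1 - D')" unfolding deletion_set_def by blast
    then have b: "sign_balanced G (?E1 - D')" using sign_balanced_induced[OF Y] by blast
    let ?D' = "between G Y \<union> D'"
    obtain \<eta> where eta: "nullv G (E - ?D') \<eta>" "\<And>v. v \<in> Y \<Longrightarrow> \<eta> v = 1 \<or> \<eta> v = -1"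
      using cut_switching_null[OF b] by blast
    have "\<eta> v \<noteq> 0" using eta(2)[OF vY] by auto
    then have "rank_lowering G ?D'" using eta(1) th(2) between_subset[of Y] DE D'
      unfolding rank_lowering_unbalanced[OF conn unbal] D1_def by blast
    moreover have "?D' \<subset> D" using D' between_disjoint_induced(1)[of Y] Deq unfolding D1_def by blast
    ultimately show False using min by blast
  qed
  then have min1: "minimal_set (deletion_set (induced G Y)) D1" using del unfolding minimal_set_def by blast
  have "balanced_components (induced G (V - Y)) ?E2 = {}"
  proof (rule ccontr)
    assume "balanced_components (induced G (V - Y)) ?E2 \<noteq> {}"
    then obtain Z where Z: "Z \<in> components (induced G (V - Y)) ?E2"
      and Zb: "sign_balanced (induced G (V - Y)) (?E2 \<inter> edges (induced (induced G (V - Y)) Z))"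
      unfolding balanced_components_def by blast
    interpret H2: gain_graph "induced G (V - Y)" by (rule gain_graph_induced) blast
    obtain \<eta> z where eta: "nullv G ?E2 \<eta>" "z \<in> Z" "\<eta> z \<noteq> 0"
      using H2.component_balanced_iff[OF subset_refl Z] Zb by auto
    have z: "z \<in> V - Y" using H2.component_verts[OF Z] eta(2) by auto
    let ?h = "\<lambda>x. if x \<in> V - Y then \<eta> x else 0"
    have h: "nullv G ?S ?h"
    proof (rule null_extend[OF _ eta(1)])
      fix e assume e: "e \<in> ?S" "set (ends G e) \<inter> (V - Y) \<noteq> {}"
      have "set (ends G e) \<subseteq> V - Y" using closed[OF e(1)] e ends_verts[of e] by blast
      moreover have "ends G e \<noteq> []" using e(2) by auto
      ultimately show "e \<in> ?E2 \<and> set (ends G e) \<subseteq> V - Y" using e(1) unfolding induced_edges by blast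
    qed
    have t: "nullv G ?S ?t" by (rule null_extend[OF _ th(1)]) (use closed in auto)
    have "D \<noteq> {}" using th unbalanced_null[OF conn unbal, of \<theta>] by auto
    then obtain e where e: "e \<in> D" by blast
    \<comment> \<open>A balanced component on the other side would supply a second vector, with
      support disjoint from \<open>Y\<close>. Some nontrivial combination of the two is annihilated
      by \<open>e\<close> as well, so \<open>D - {e}\<close> would still lower the rank.\<close>
    obtain a b where ab: "a * inc G ?t e + b * inc G ?h e = 0" "a \<noteq> 0 \<or> b \<noteq> 0"
    proof (cases "inc G ?t e = 0 \<and> inc G ?h e = 0")
      case True
      then show ?thesis using that[of 1 0] by simp
    next
      case False
      then show ?thesis using that[of "inc G ?h e" "- inc G ?t e"] by auto
    qed
    let ?c = "\<lambda>x. a * ?t x + b * ?h x"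
    have "inc G ?c f = 0" if f: "f \<in> E - (D - {e})" for f
    proof (cases "f = e")
      case True
      then show ?thesis using ab(1) by (simp only: inc_linear)
    next
      case False
      then have "inc G ?t f = 0" "inc G ?h f = 0" using f t h unfolding nullv_def by auto
      then show ?thesis by (simp only: inc_linear) simp
    qed
    then have "nullv G (E - (D - {e})) ?c" unfolding nullv_def by blast
    moreover have "?c v \<noteq> 0 \<or> ?c z \<noteq> 0" using ab(2) vY z th(3) eta(3) by auto
    ultimately have "rank_lowering G (D - {e})"
      using th(2) z DE unfolding rank_lowering_unbalanced[OF conn unbal] by blast
    then show False using min[of "D - {e}"] e by blast
  qed
  then have "cut_deletion Y D1" using Y c1 min1 unfolding cut_deletion_def by blast
  then show ?thesis using Deq by blast
qed

lemma cut_deletion_types: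
  assumes conn: "connected_graph G" and unbal: "\<not> sign_balanced G E"
    and no_loose: "\<And>e. e \<in> E \<Longrightarrow> ends G e \<noteq> []"
  shows "(\<exists>Y D1. cut_deletion Y D1 \<and> D = between G Y \<union> D1) \<longleftrightarrow> type_D2 G D \<or> type_D3 G D \<or> type_D4 G D"
proof -
  have self: "induced G V = G" using no_loose ends_verts by (intro induced_self) blast
  have bt: "between G V = {}" unfolding between_def by blast
  have empty: "balanced_components (induced G {}) S = {}" for S
    unfolding balanced_components_def components_eq by simp
  show ?thesis
  proof
    assume "\<exists>Y D1. cut_deletion Y D1 \<and> D = between G Y \<union> D1"
    then obtain Y D1 where Y: "Y \<subseteq> V" and c1: "connected_graph (induced G Y)"
      and nob: "balanced_components (induced G (V - Y)) (edges (induced G (V - Y))) = {}"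
      and D1: "minimal_set (deletion_set (induced G Y)) D1" and D: "D = between G Y \<union> D1"
      unfolding cut_deletion_def by blast
    show "type_D2 G D \<or> type_D3 G D \<or> type_D4 G D"
    proof (cases "Y = V")
      case True
      then show ?thesis using D1 D bt self unfolding type_D2_def by simp
    next
      case False
      interpret H: gain_graph "induced G Y" by (rule gain_graph_induced[OF Y])
      interpret H2: gain_graph "induced G (V - Y)" by (rule gain_graph_induced) blast
      have "Y \<noteq> {}" using c1 unfolding H.connected_graph_iff by simp
      then have ne: "between G Y \<noteq> {}" by (rule between_nonempty[OF conn Y _ False])
      show ?thesis
      proof (cases "D1 = {}")
        case True
        then have "sign_balanced (induced G Y) (edges (induced G Y))"
          using D1 unfolding minimal_set_def deletion_set_def by simp
        then have "type_D3 G D" unfolding type_D3_def using Y ne D True c1 nob by auto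
        then show ?thesis by blast
      next
        case D1ne: False
        then have u1: "\<not> sign_balanced (induced G Y) (edges (induced G Y))"
          using D1 unfolding minimal_set_def deletion_set_def by (metis Diff_empty empty_subsetI psubsetI)
        \<comment> \<open>Type D4 asks that the second side be unbalanced, which follows from the
          absence of balanced components only once this side has a vertex.\<close>
        obtain w where w: "w \<in> V - Y" using Y False by blast
        let ?Z = "component_of (induced G (V - Y)) (edges (induced G (V - Y))) w"
        have "?Z \<in> components (induced G (V - Y)) (edges (induced G (V - Y)))"
          using w unfolding components_eq by simp
        then have "\<not> sign_balanced (induced G (V - Y))
            (edges (induced G (V - Y)) \<inter> edges (induced (induced G (V - Y)) ?Z))"
          using nob unfolding balanced_components_def by blast
        then have u2: "\<not> sign_balanced (induced G (V - Y)) (edges (induced G (V - Y)))"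
          using H2.sign_balanced_mono by blast
        have "type_D4 G D" unfolding type_D4_def using Y ne u1 u2 c1 nob D1 D by blast
        then show ?thesis by blast
      qed
    qed
  next
    assume "type_D2 G D \<or> type_D3 G D \<or> type_D4 G D"
    then show "\<exists>Y D1. cut_deletion Y D1 \<and> D = between G Y \<union> D1"
    proof (elim disjE)
      assume "type_D2 G D"
      then have "cut_deletion V D"
        unfolding type_D2_def cut_deletion_def using conn self empty by simp
      moreover have "D = between G V \<union> D" using bt by simp
      ultimately show ?thesis by blast
    next
      assume "type_D3 G D"
      then obtain Y where Y: "Y \<subseteq> V" "D = between G Y" "connected_graph (induced G Y)"
        "sign_balanced (induced G Y) (edges (induced G Y))"
        "balanced_components (induced G (V - Y)) (edges (induced G (V - Y))) = {}"
        unfolding type_D3_def by blast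
      then have "cut_deletion Y {}" unfolding cut_deletion_def minimal_set_def deletion_set_def by simp
      moreover have "D = between G Y \<union> {}" using Y(2) by simp
      ultimately show ?thesis by blast
    next
      assume "type_D4 G D"
      then show ?thesis unfolding type_D4_def cut_deletion_def by blast
    qed
  qed
qed

lemma unbalanced_cocircuit_types:
  assumes "connected_graph G" "\<not> sign_balanced G E" "\<And>e. e \<in> E \<Longrightarrow> ends G e \<noteq> []"
  shows "cocircuit (frame_matroid G) D \<longleftrightarrow> type_D2 G D \<or> type_D3 G D \<or> type_D4 G D"
proof -
  have "minimal_set (rank_lowering G) D \<longleftrightarrow> (\<exists>Y D1. cut_deletion Y D1 \<and> D = between G Y \<union> D1)"
    using cut_deletion_cocircuit[OF assms(1,2)] cocircuit_cut_deletion[OF assms(1,2), of D] by metis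
  then show ?thesis using cut_deletion_types[OF assms, of D] unfolding frame_cocircuit_iff by simp
qed

section \<open>Back to the components of the whole graph\<close>

lemma connected_component:
  assumes X: "X \<in> components G E"
  shows "connected_graph (induced G X)"
proof -
  interpret H: gain_graph "induced G X" by (rule gain_graph_induced[OF component_verts[OF X]])
  have "(u, w) \<in> linked G (edges (induced G X))" if uw: "u \<in> X" "w \<in> X" for u w
  proof -
    have "(u, w) \<in> linked G E" using component_eq[OF X uw(1)] uw(2) unfolding component_of_def by blast
    then have "(u, w) \<in> linked G (E \<inter> edges (induced G X))"
      by (rule linked_within[OF _ uw(1) subset_refl component_ends[OF subset_refl X]])
    then show ?thesis using linked_mono[of "E \<inter> edges (induced G X)" "edges (induced G X)" G] by blast
  qed
  then show ?thesis using component_nonempty[OF X] unfolding H.connected_graph_iff by simp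
qed

lemma component_cocircuit:
  assumes X: "X \<in> components G E"
  shows "cocircuit (frame_matroid (induced G X)) D \<longleftrightarrow>
    (if sign_balanced (induced G X) (edges (induced G X)) then bond (induced G X) D
     else type_D2 (induced G X) D \<or> type_D3 (induced G X) D \<or> type_D4 (induced G X) D)"
proof -
  interpret H: gain_graph "induced G X" by (rule gain_graph_induced[OF component_verts[OF X]])
  have "ends (induced G X) e \<noteq> []" if "e \<in> edges (induced G X)" for e
    using that by (simp add: induced_edges)
  then show ?thesis
    using H.balanced_cocircuit_bond[OF connected_component[OF X]]
      H.unbalanced_cocircuit_types[OF connected_component[OF X]] by auto
qed

text \<open>A cocircuit of the frame matroid lives in one component, and
  \<open>hyperbalanced_split\<close> divides the frustration of its complement between the rest of
  the graph and what remains of this component.\<close>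

lemma hyperfrustrated_cocircuit:
  "(\<exists>A. coatom (gain_matroid G) A \<and> hyperfrustrated G A \<and> D = E - A) \<longleftrightarrow>
    (\<exists>X\<in>components G E. cocircuit (frame_matroid (induced G X)) D \<and>
       (hyperfrustrated_graph (delete_component G X) \<or> hyperfrustrated_graph (delete_edges (induced G X) D)))"
proof -
  have sub: "D \<subseteq> edges (induced G X)" if "cocircuit (frame_matroid (induced G X)) D" for X
    using that unfolding cocircuit_def by (auto simp: frame_matroid_def)
  have "(\<exists>A. coatom (gain_matroid G) A \<and> hyperfrustrated G A \<and> D = E - A) \<longleftrightarrow>
    (\<exists>A. coatom (frame_matroid G) A \<and> D = E - A \<and> hyperfrustrated G (E - D))"
  proof -
    have "E - (E - A) = A" if "coatom (frame_matroid G) A" for A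
      using that unfolding coatom_def flat_def by auto
    then show ?thesis using hyperfrustrated_coatom by metis
  qed
  also have "\<dots> \<longleftrightarrow> cocircuit (frame_matroid G) D \<and> hyperfrustrated G (E - D)"
    unfolding cocircuit_def by auto
  also have "\<dots> \<longleftrightarrow> (\<exists>X\<in>components G E. cocircuit (frame_matroid (induced G X)) D \<and>
      hyperfrustrated G (E - D))"
    unfolding cocircuit_components by blast
  also have "\<dots> \<longleftrightarrow> (\<exists>X\<in>components G E. cocircuit (frame_matroid (induced G X)) D \<and>
       (hyperfrustrated_graph (delete_component G X) \<or> hyperfrustrated_graph (delete_edges (induced G X) D)))"
    using hyperbalanced_split sub by blast
  finally show ?thesis .
qed

end

text \<open>Hyperfrustrated coatoms do not always exist, so their existence appears as an
  equivalence with a rank criterion. If the graph has a single edge, loose and non-neutral, the gain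
  matroid has rank 1 and its only coatom is the empty set, which is hyperbalanced.\<close>

theorem theorem6p3:
  fixes \<Upsilon> :: "('v, 'e, 'k::field) gain_signed_graph"
  assumes char_not_2: "(2::'k) \<noteq> 0"
    and gsg: "is_gain_signed_graph \<Upsilon>"
  shows
    "(hyperbalanced_graph \<Upsilon> \<longrightarrow>
        (\<forall>A. coatom (gain_matroid \<Upsilon>) A \<longleftrightarrow> coatom (frame_matroid \<Upsilon>) A) \<and>
        (\<forall>D. cocircuit (gain_matroid \<Upsilon>) D \<longleftrightarrow> cocircuit (frame_matroid \<Upsilon>) D))
     \<and>
     (hyperfrustrated_graph \<Upsilon> \<longrightarrow>
        (\<exists>A. coatom (gain_matroid \<Upsilon>) A \<and> hyperbalanced \<Upsilon> A) \<and>
        ((\<exists>A. coatom (gain_matroid \<Upsilon>) A \<and> hyperfrustrated \<Upsilon> A) \<longleftrightarrow>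
         (\<exists>C. sign_circuit \<Upsilon> C \<and> \<not> neutral \<Upsilon> C \<and>
              rk (frame_matroid \<Upsilon>) C < rk (frame_matroid \<Upsilon>) (edges \<Upsilon>)))
        \<and>
        (\<forall>A\<subseteq>edges \<Upsilon>. hyperbalanced \<Upsilon> A \<longrightarrow>
           (coatom (gain_matroid \<Upsilon>) A \<longleftrightarrow>
            maximal_set (\<lambda>S. S \<subseteq> edges \<Upsilon> \<and> hyperbalanced \<Upsilon> S) A) \<and>
           (coatom (gain_matroid \<Upsilon>) A \<longleftrightarrow>
            (\<exists>F. basis (frame_matroid \<Upsilon>) F \<and> A = clos (gain_matroid \<Upsilon>) F)) \<and>
           (coatom (gain_matroid \<Upsilon>) A \<longleftrightarrow>
            (\<exists>F. basis (frame_matroid \<Upsilon>) F \<and> A = bcl \<Upsilon> F))) \<and>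
        (\<forall>D. (\<exists>A. coatom (gain_matroid \<Upsilon>) A \<and> hyperbalanced \<Upsilon> A \<and> D = edges \<Upsilon> - A) \<longleftrightarrow>
             minimal_set (hyperbalancing_set \<Upsilon>) D)
        \<and>
        (\<forall>A. coatom (gain_matroid \<Upsilon>) A \<and> hyperfrustrated \<Upsilon> A \<longleftrightarrow>
             coatom (frame_matroid \<Upsilon>) A \<and> hyperfrustrated \<Upsilon> A) \<and>
        (\<forall>D. (\<exists>A. coatom (gain_matroid \<Upsilon>) A \<and> hyperfrustrated \<Upsilon> A \<and> D = edges \<Upsilon> - A) \<longleftrightarrow>
             (\<exists>X\<in>components \<Upsilon> (edges \<Upsilon>).
                (hyperfrustrated_graph (delete_component \<Upsilon> X) \<and>
                   cocircuit (frame_matroid (induced \<Upsilon> X)) D) \<or>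
                (hyperbalanced_graph (delete_component \<Upsilon> X) \<and>
                   ((sign_balanced (induced \<Upsilon> X) (edges (induced \<Upsilon> X)) \<and>
                       bond (induced \<Upsilon> X) D \<and>
                       hyperfrustrated_graph (delete_edges (induced \<Upsilon> X) D)) \<or>
                    (\<not> sign_balanced (induced \<Upsilon> X) (edges (induced \<Upsilon> X)) \<and>
                       ((minimal_set (deletion_set (induced \<Upsilon> X)) D \<and>
                         hyperfrustrated_graph (delete_edges (induced \<Upsilon> X) D)) \<or>
                        ((type_D2 (induced \<Upsilon> X) D \<or> type_D3 (induced \<Upsilon> X) D \<or>
                          type_D4 (induced \<Upsilon> X) D) \<and>
                         hyperfrustrated_graph (delete_edges (induced \<Upsilon> X) D)))))))))"
proof -
  interpret gain_graph \<Upsilon> by unfold_locales (fact assms)+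
  show ?thesis
  proof (intro conjI impI allI, goal_cases)
    case 1
    then show ?case by (rule hyperbalanced_graph_coatom)
  next
    case 2
    then show ?case unfolding cocircuit_def by (simp add: hyperbalanced_graph_coatom)
  next
    case 3
    then show ?case by (rule hyperbalanced_coatom_exists)
  next
    case 4
    show ?case by (rule hyperfrustrated_coatom_exists_iff)
  next
    case (5 A)
    then show ?case using maximal_hyperbalanced_coatom[of A] by blast
  next
    case (6 A)
    then show ?case by (intro hyperbalanced_coatom_clos)
  next
    case (7 A)
    then show ?case by (intro hyperbalanced_coatom_clos)
  next
    case (8 D)
    then show ?case by (intro hyperbalanced_cocircuit)
  next
    case (9 A)
    show ?case using hyperfrustrated_coatom by blast
  next
    case (10 D)
    \<comment> \<open>For each component the frustration condition is split by the state of
      \<open>delete_component \<Upsilon> X\<close>: if that part is hyperfrustrated, nothing more is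
      asked of \<open>D\<close>. Unfolding \<open>type_D2\<close> merges the two mentions of minimal
      deletion sets.\<close>
    show ?case unfolding hyperfrustrated_cocircuit
      by (intro bex_cong refl) (simp add: component_cocircuit type_D2_def; argo)
  qed
qed

end
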